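(* Let $G=\mathrm{Aut}(\mathbb R,<)$ be the group of all order-preserving self-bijections of the real line. For $\epsilon,\delta\in\{-1,0\}$ there exists a unique ring homomorphism $$\mu_{\epsilon,\delta}\colon\Theta(G)\to\mathbb Z$$ given by (for $n\ge0$) $$\mu_{\epsilon,\delta}([I^{(n)}])=\begin{cases}(-1)^n&\text{if $I$ is a middle interval}\\ \epsilon^n&\text{if $I$ is a left interval}\\ \delta^n&\text{if $I$ is a right interval.}\end{cases}$$ The ring homomorphism $\Theta(G)\to\mathbb Z^4$ furnished by the four homomorphisms $\mu_{\epsilon,\delta}$ is an isomorphism.
   Context: Intervals are open intervals in $\mathbb R$. A left interval is $(-\infty,a)$ with $a<\infty$, a right interval is $(a,\infty)$ with $a>-\infty$, and a middle interval is $(a,b)$ with $a<b$ both finite. $I^{(n)}$ is the set of $n$-element subsets of $I$; it is a $\hat G$-set via the pointwise stabilizer of the finite endpoints of $I$. Here $0^0=1$. $G$ carries the topology in which the pointwise stabilizers of finite subsets of $\mathbb R$ form a neighborhood basis of the identity. A $G$-set is a set with a smooth action of $G$, i.e. every stabilizer is open (same for open subgroups). Finitary means finitely many orbits. A $\hat G$-set is a set $X$ with a smooth action of some open subgroup $U$ of $G$ (a group of definition), where shrinking $U$ does not change the $\hat G$-set; it is finitary if $U$ has finitely many orbits (independent of $U$). Maps of $\hat G$-sets are functions equivariant for some common open group of definition. For $g\in G$, $X^g$ is the same set with action $h\bullet x=(g^{-1}hg)\cdot x$. $\Theta(G)$ is the commutative ring generated by symbols $[X]$, one for each finitary $\hat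 G$-set $X$, subject to: (a) $[X]=[Y]$ if $X\cong Y$; (b) $[X]=1$ if $X$ is a singleton; (c) $[X\amalg Y]=[X]+[Y]$; (d) $[X]=[X^g]$ for $g\in G$; (e) if $U$ is an open subgroup and $X\to Y$ is a map of transitive $U$-sets with fiber $F$ over some point, then $[X]=[F]\cdot[Y]$. *)

theory Defs
  imports
    "HOL-Analysis.Analysis"
    "HOL-Algebra.Algebra"
    "HOL-Algebra.Chinese_Remainder"
    "HOL-Algebra.Algebraic_Closure_Type"
    "HOL-Library.Poly_Mapping"
begin

section \<open>The topological group of order automorphisms of the real line\<close>

definition autR :: "(real \<Rightarrow> real) monoid" where
  "autR = \<lparr>carrier = {g. bij g \<and> strict_mono g}, mult = (\<circ>), one = id\<rparr>"

definition pw_stab :: "real set \<Rightarrow> (real \<Rightarrow> real) set" where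
  "pw_stab A = {g \<in> carrier autR. \<forall>a\<in>A. g a = a}"

text \<open>The group topology for which the pointwise stabilizers of finite sets form a neighbourhood
  basis of the identity; their left translates then form a neighbourhood basis at every other
  point.\<close>

definition aut_topology :: "(real \<Rightarrow> real) topology" where
  "aut_topology = topology (\<lambda>W. W \<subseteq> carrier autR \<and>
     (\<forall>g\<in>W. \<exists>A. finite A \<and> g <#\<^bsub>autR\<^esub> pw_stab A \<subseteq> W))"

definition open_subgroup :: "(real \<Rightarrow> real) set \<Rightarrow> bool" where
  "open_subgroup U \<longleftrightarrow> subgroup U autR \<and> openin aut_topology U"

lemma autR_simps [simp]:
  "g \<in> carrier autR \<longleftrightarrow> bij g \<and> strict_mono g"
  "g \<otimes>\<^bsub>autR\<^esub> h = g \<circ> h"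
  "\<one>\<^bsub>autR\<^esub> = id"
  by (simp_all add: autR_def)

lemma strict_mono_inv_real:
  fixes g :: "real \<Rightarrow> real"
  assumes "bij g" "strict_mono g"
  shows "strict_mono (inv_into UNIV g)"
proof (rule strict_monoI)
  fix x y :: real assume "x < y"
  then have "g (inv_into UNIV g x) < g (inv_into UNIV g y)"
    using assms(1) by (simp add: bij_is_surj surj_f_inv_f)
  then show "inv_into UNIV g x < inv_into UNIV g y"
    using assms(2) strict_mono_less by blast
qed

lemma group_autR: "group autR"
proof (rule groupI)
  fix g assume "g \<in> carrier autR"
  then have g: "bij g" "strict_mono g" by auto
  then have "inv_into UNIV g \<in> carrier autR" "inv_into UNIV g \<otimes>\<^bsub>autR\<^esub> g = \<one>\<^bsub>autR\<^esub>"
    by (auto simp: bij_imp_bij_inv strict_mono_inv_real bij_is_inj)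
  then show "\<exists>h\<in>carrier autR. h \<otimes>\<^bsub>autR\<^esub> g = \<one>\<^bsub>autR\<^esub>" by blast
qed (auto simp: bij_comp strict_mono_def comp_assoc)

lemma pw_stab_subgroup: "subgroup (pw_stab A) autR"
proof -
  interpret group autR by (rule group_autR)
  show ?thesis
  proof (rule subgroupI)
    fix g assume g: "g \<in> pw_stab A"
    then have *: "bij g" "strict_mono g" "\<forall>a\<in>A. g a = a" by (auto simp: pw_stab_def)
    have "inv\<^bsub>autR\<^esub> g = inv_into UNIV g"
      by (rule inv_equality) (use * in \<open>auto simp: bij_imp_bij_inv strict_mono_inv_real bij_is_inj\<close>)
    then show "inv\<^bsub>autR\<^esub> g \<in> pw_stab A"
      using * by (auto simp: pw_stab_def bij_imp_bij_inv strict_mono_inv_real bij_is_inj inv_f_eq)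
  next
    have "id \<in> pw_stab A" by (auto simp: pw_stab_def strict_mono_def)
    then show "pw_stab A \<noteq> {}" by blast
  qed (auto simp: pw_stab_def bij_comp strict_mono_def)
qed

lemma openin_aut_topology:
  "openin aut_topology W \<longleftrightarrow> W \<subseteq> carrier autR \<and>
     (\<forall>g\<in>W. \<exists>A. finite A \<and> g <#\<^bsub>autR\<^esub> pw_stab A \<subseteq> W)"
proof -
  have "istopology (\<lambda>W. W \<subseteq> carrier autR \<and>
     (\<forall>g\<in>W. \<exists>A. finite A \<and> g <#\<^bsub>autR\<^esub> pw_stab A \<subseteq> W))"
    unfolding istopology_def
  proof (intro conjI allI impI ballI; (elim conjE)?)
    fix S T g
    assume S: "\<forall>g\<in>S. \<exists>A. finite A \<and> g <#\<^bsub>autR\<^esub> pw_stab A \<subseteq> S"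
      and T: "\<forall>g\<in>T. \<exists>A. finite A \<and> g <#\<^bsub>autR\<^esub> pw_stab A \<subseteq> T"
      and g: "g \<in> S \<inter> T"
    obtain A B where "finite A" "g <#\<^bsub>autR\<^esub> pw_stab A \<subseteq> S" "finite B" "g <#\<^bsub>autR\<^esub> pw_stab B \<subseteq> T"
      using S T g by blast
    then have "finite (A \<union> B) \<and> g <#\<^bsub>autR\<^esub> pw_stab (A \<union> B) \<subseteq> S \<inter> T"
      by (fastforce simp: l_coset_def pw_stab_def)
    then show "\<exists>A. finite A \<and> g <#\<^bsub>autR\<^esub> pw_stab A \<subseteq> S \<inter> T" by blast
  next
    fix K g
    assume K: "\<forall>k\<in>K. k \<subseteq> carrier autR \<and>
        (\<forall>g\<in>k. \<exists>A. finite A \<and> g <#\<^bsub>autR\<^esub> pw_stab A \<subseteq> k)"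
      and g: "g \<in> \<Union> K"
    then obtain k where k: "k \<in> K" "g \<in> k" by blast
    then obtain A where "finite A" "g <#\<^bsub>autR\<^esub> pw_stab A \<subseteq> k" using K by blast
    then show "\<exists>A. finite A \<and> g <#\<^bsub>autR\<^esub> pw_stab A \<subseteq> \<Union> K" using k by blast
  qed blast+
  then show ?thesis by (simp add: aut_topology_def topology_inverse')
qed

lemma openin_subgroup_iff:
  assumes "subgroup U autR"
  shows "openin aut_topology U \<longleftrightarrow> (\<exists>A. finite A \<and> pw_stab A \<subseteq> U)"
proof
  assume "openin aut_topology U"
  moreover have "id \<in> U" using subgroup.one_closed[OF assms] by simp
  ultimately obtain A where "finite A" "id <#\<^bsub>autR\<^esub> pw_stab A \<subseteq> U"
    unfolding openin_aut_topology by blast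
  then show "\<exists>A. finite A \<and> pw_stab A \<subseteq> U" by (auto simp: l_coset_def)
next
  assume "\<exists>A. finite A \<and> pw_stab A \<subseteq> U"
  then obtain A where A: "finite A" "pw_stab A \<subseteq> U" by blast
  have "g <#\<^bsub>autR\<^esub> pw_stab A \<subseteq> U" if "g \<in> U" for g
    using that A subgroup.m_closed[OF assms] by (fastforce simp: l_coset_def)
  then show "openin aut_topology U"
    unfolding openin_aut_topology using A subgroup.subset[OF assms] by blast
qed

lemma open_subgroup_iff:
  "open_subgroup U \<longleftrightarrow> subgroup U autR \<and> (\<exists>A. finite A \<and> pw_stab A \<subseteq> U)"
  using openin_subgroup_iff by (auto simp: open_subgroup_def)

lemma open_subgroup_carrier: "open_subgroup (carrier autR)"
  unfolding open_subgroup_iff using group.subgroup_self[OF group_autR]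
  by (auto simp: pw_stab_def intro: exI[of _ "{}"])


section \<open>Sets with a smooth action of an open subgroup\<close>

lemma group_actionI:
  assumes "group G"
    and "\<And>g. g \<in> carrier G \<Longrightarrow> \<phi> g \<in> extensional E"
    and maps: "\<And>g x. g \<in> carrier G \<Longrightarrow> x \<in> E \<Longrightarrow> \<phi> g x \<in> E"
    and one: "\<And>x. x \<in> E \<Longrightarrow> \<phi> \<one>\<^bsub>G\<^esub> x = x"
    and mult: "\<And>g h x. g \<in> carrier G \<Longrightarrow> h \<in> carrier G \<Longrightarrow> x \<in> E \<Longrightarrow>
      \<phi> (g \<otimes>\<^bsub>G\<^esub> h) x = \<phi> g (\<phi> h x)"
  shows "group_action G E \<phi>"
proof -
  interpret group G by fact
  have Bij: "\<phi> g \<in> Bij E" if g: "g \<in> carrier G" for g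
  proof -
    have 1: "\<phi> (inv\<^bsub>G\<^esub> g) (\<phi> g x) = x" "\<phi> g (\<phi> (inv\<^bsub>G\<^esub> g) x) = x" if "x \<in> E" for x
      using mult[of "inv\<^bsub>G\<^esub> g" g x] mult[of g "inv\<^bsub>G\<^esub> g" x] that g one by auto
    have "bij_betw (\<phi> g) E E"
      by (rule bij_betw_byWitness[where f' = "\<phi> (inv\<^bsub>G\<^esub> g)"]) (use 1 maps g in auto)
    then show ?thesis using assms(2) g by (simp add: Bij_def)
  qed
  have "\<phi> (g \<otimes>\<^bsub>G\<^esub> h) = \<phi> g \<otimes>\<^bsub>BijGroup E\<^esub> \<phi> h" if "g \<in> carrier G" "h \<in> carrier G" for g h
  proof
    fix x
    show "\<phi> (g \<otimes>\<^bsub>G\<^esub> h) x = (\<phi> g \<otimes>\<^bsub>BijGroup E\<^esub> \<phi> h) x"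
      using that Bij mult assms(2)[of "g \<otimes>\<^bsub>G\<^esub> h"]
      by (cases "x \<in> E") (auto simp: BijGroup_def compose_def extensional_def)
  qed
  then have "\<phi> \<in> hom G (BijGroup E)"
    using Bij by (auto simp: hom_def BijGroup_def)
  then show ?thesis
    by (simp add: group_action_def group_hom_def group_hom_axioms_def group_BijGroup is_group)
qed

lemma group_gp: "subgroup U autR \<Longrightarrow> group (autR\<lparr>carrier := U\<rparr>)"
  by (rule group.subgroup_imp_group[OF group_autR])

text \<open>A record stores a group of definition together with the action. Shrinking the group of
  definition gives a different record, but an isomorphic one in the sense of \<open>ghat_iso\<close> below.\<close>

record 'x ghat =
  gdef :: "(real \<Rightarrow> real) set"
  pts :: "'x set"
  act :: "(real \<Rightarrow> real) \<Rightarrow> 'x \<Rightarrow> 'x"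

abbreviation gp :: "'x ghat \<Rightarrow> (real \<Rightarrow> real) monoid" where
  "gp M \<equiv> autR\<lparr>carrier := gdef M\<rparr>"

definition ghat_set :: "'x ghat \<Rightarrow> bool" where
  "ghat_set M \<longleftrightarrow> open_subgroup (gdef M) \<and> group_action (gp M) (pts M) (act M) \<and>
     (\<forall>x\<in>pts M. openin aut_topology (stabilizer (gp M) (act M) x))"

definition finitary :: "'x ghat \<Rightarrow> bool" where
  "finitary M \<longleftrightarrow> finite (orbits (gp M) (pts M) (act M))"

definition equivariant ::
  "(real \<Rightarrow> real) set \<Rightarrow> 'x ghat \<Rightarrow> 'y ghat \<Rightarrow> ('x \<Rightarrow> 'y) \<Rightarrow> bool" where
  "equivariant V M N f \<longleftrightarrow> f \<in> pts M \<rightarrow> pts N \<and>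
     (\<forall>g\<in>V. \<forall>x\<in>pts M. f (act M g x) = act N g (f x))"

definition ghat_map :: "'x ghat \<Rightarrow> 'y ghat \<Rightarrow> ('x \<Rightarrow> 'y) \<Rightarrow> bool" where
  "ghat_map M N f \<longleftrightarrow>
     (\<exists>V. open_subgroup V \<and> V \<subseteq> gdef M \<and> V \<subseteq> gdef N \<and> equivariant V M N f)"

definition ghat_iso :: "'x ghat \<Rightarrow> 'y ghat \<Rightarrow> bool" where
  "ghat_iso M N \<longleftrightarrow> (\<exists>f. ghat_map M N f \<and> bij_betw f (pts M) (pts N))"

text \<open>Group actions in \<^locale>\<open>group_action\<close> are by extensional functions, hence the restrictions in
  the following constructions.\<close>

definition coprod :: "'x ghat \<Rightarrow> 'y ghat \<Rightarrow> ('x + 'y) ghat" where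
  "coprod M N = \<lparr>gdef = gdef M \<inter> gdef N, pts = pts M <+> pts N,
     act = (\<lambda>g. restrict (map_sum (act M g) (act N g)) (pts M <+> pts N))\<rparr>"

definition conj_ghat :: "'x ghat \<Rightarrow> (real \<Rightarrow> real) \<Rightarrow> 'x ghat" where
  "conj_ghat M g =
     \<lparr>gdef = (\<lambda>h. g \<otimes>\<^bsub>autR\<^esub> h \<otimes>\<^bsub>autR\<^esub> inv\<^bsub>autR\<^esub> g) ` gdef M, pts = pts M,
      act = (\<lambda>h. act M (inv\<^bsub>autR\<^esub> g \<otimes>\<^bsub>autR\<^esub> h \<otimes>\<^bsub>autR\<^esub> g))\<rparr>"

definition transitive_ghat :: "'x ghat \<Rightarrow> bool" where
  "transitive_ghat M \<longleftrightarrow> pts M \<noteq> {} \<and> transitive_action (gp M) (pts M) (act M)"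

definition fiber :: "'x ghat \<Rightarrow> 'y ghat \<Rightarrow> ('x \<Rightarrow> 'y) \<Rightarrow> 'y \<Rightarrow> 'x ghat" where
  "fiber M N f y = \<lparr>gdef = stabilizer (gp N) (act N) y, pts = {x \<in> pts M. f x = y},
     act = (\<lambda>g. restrict (act M g) {x \<in> pts M. f x = y})\<rparr>"

text \<open>\<open>I\<^sup>(\<^sup>n\<^sup>)\<close>. For the intervals considered (nonempty, open, not the whole line), \<open>frontier I\<close> is the
  set of finite endpoints.\<close>

definition config :: "real set \<Rightarrow> nat \<Rightarrow> real set ghat" where
  "config I n = \<lparr>gdef = pw_stab (frontier I), pts = {S. S \<subseteq> I \<and> finite S \<and> card S = n},
     act = (\<lambda>g. restrict ((`) g) {S. S \<subseteq> I \<and> finite S \<and> card S = n})\<rparr>"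


section \<open>The ring \<open>\<Theta>(G)\<close>\<close>

text \<open>Generators are taken from a fixed universe: underlying sets are sets of elements of
  \<^typ>\<open>real set\<close>. Up to isomorphism this loses nothing, see \<open>universe_complete\<close> below.\<close>

typedef fin_ghat = "{M :: real set ghat. ghat_set M \<and> finitary M}"
proof
  let ?E = "\<lparr>gdef = carrier autR, pts = {}, act = (\<lambda>g x. undefined)\<rparr> :: real set ghat"
  have "group_action autR {} (\<lambda>g x. undefined :: real set)"
    by (rule group_actionI) (auto simp: group_autR extensional_def)
  then show "?E \<in> {M. ghat_set M \<and> finitary M}"
    by (simp add: ghat_set_def finitary_def orbits_def open_subgroup_carrier)
qed

lemma universe_complete:
  fixes M :: "'x ghat"
  assumes M: "ghat_set M" and fin: "finitary M"
  shows "\<exists>A. ghat_iso (Rep_fin_ghat A) M"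
proof -
  interpret group_action "gp M" "pts M" "act M" using M by (simp add: ghat_set_def)
  have U: "open_subgroup (gdef M)" using M by (simp add: ghat_set_def)
  interpret grp: group "gp M"
    using U by (simp add: open_subgroup_iff group_gp)
  obtain p :: "real \<times> real \<Rightarrow> real" where p: "inj p"
    using card_of_Times_same_infinite[OF infinite_UNIV_char_0[where 'a = real]]
    by (metis UNIV_Times_UNIV bij_betw_def card_of_ordIso)
  obtain k :: "'x set \<Rightarrow> nat" where k: "inj_on k (orbits (gp M) (pts M) (act M))"
    using fin finite_imp_inj_to_nat_seg[of "orbits (gp M) (pts M) (act M)"]
    by (auto simp: finitary_def)
  define orb where "orb = orbit (gp M) (act M)"
  have "\<exists>g. act M g (SOME y. y \<in> orb x) = x" if x: "x \<in> pts M" for x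
  proof -
    let ?y = "SOME y. y \<in> orb x"
    have y: "?y \<in> orb x" using orbit_refl[OF x] unfolding orb_def by (rule someI)
    then have "?y \<in> pts M" using element_image x by (auto simp: orb_def orbit_def)
    with y x have "x \<in> orb ?y" unfolding orb_def using orbit_sym by blast
    then obtain g where "x = act M g ?y" unfolding orb_def orbit_def by blast
    then show ?thesis by metis
  qed
  then obtain t where t: "\<And>x. x \<in> pts M \<Longrightarrow> act M (t x) (SOME y. y \<in> orb x) = x" by metis
  define j where "j x = range (\<lambda>r. p (real (k (orb x)), p (r, t x r)))" for x
  have inj: "inj_on j (pts M)"
  proof (rule inj_onI)
    fix x y assume xy: "x \<in> pts M" "y \<in> pts M" "j x = j y"
    have eq: "k (orb x) = k (orb y) \<and> t x r = t y r" for r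
    proof -
      have "p (real (k (orb x)), p (r, t x r)) \<in> j y" using xy(3) by (auto simp: j_def)
      then obtain q where "p (real (k (orb x)), p (r, t x r)) = p (real (k (orb y)), p (q, t y q))"
        by (auto simp: j_def)
      then have 1: "(real (k (orb x)), p (r, t x r)) = (real (k (orb y)), p (q, t y q))"
        by (rule injD[OF p])
      then have "p (r, t x r) = p (q, t y q)" by simp
      then have "(r, t x r) = (q, t y q)" by (rule injD[OF p])
      then have "t x r = t y r" by auto
      then show ?thesis using 1 by simp
    qed
    then have "orb x = orb y"
      using k xy by (auto simp: inj_on_def orbits_def orb_def)
    moreover have "t x = t y" using eq by blast
    ultimately show "x = y" using t xy by metis
  qed
  define i where "i = inv_into (pts M) j"
  have ij: "i (j x) = x" if "x \<in> pts M" for x using that inj by (simp add: i_def)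
  define N where "N = \<lparr>gdef = gdef M, pts = j ` pts M,
    act = (\<lambda>g. restrict (\<lambda>z. j (act M g (i z))) (j ` pts M))\<rparr>"
  have act_cl: "act M g x \<in> pts M" if "g \<in> gdef M" "x \<in> pts M" for g x
    using element_image that by simp
  have stab: "stabilizer (gp N) (act N) (j x) = stabilizer (gp M) (act M) x"
    if x: "x \<in> pts M" for x
    using x ij inj act_cl by (auto simp: N_def stabilizer_def inj_on_eq_iff)
  have orbN: "orbit (gp N) (act N) (j x) = j ` orbit (gp M) (act M) x" if "x \<in> pts M" for x
    using that ij by (auto simp: N_def orbit_def)
  have act_one: "act M \<one>\<^bsub>gp M\<^esub> x = x" if "x \<in> pts M" for x
    using id_eq_one that by (metis restrict_apply')
  have "group_action (gp N) (pts N) (act N)"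
  proof (rule group_actionI)
    show "group (gp N)" using grp.is_group by (simp add: N_def)
    show "act N g z \<in> pts N" if "g \<in> carrier (gp N)" "z \<in> pts N" for g z
      using that ij act_cl by (auto simp: N_def)
    show "act N \<one>\<^bsub>gp N\<^esub> z = z" if "z \<in> pts N" for z
      using that ij act_one by (auto simp: N_def)
    show "act N (g \<otimes>\<^bsub>gp N\<^esub> h) z = act N g (act N h z)"
      if "g \<in> carrier (gp N)" "h \<in> carrier (gp N)" "z \<in> pts N" for g h z
      using that ij act_cl composition_rule by (auto simp: N_def)
  qed (auto simp: N_def)
  moreover have "openin aut_topology (stabilizer (gp N) (act N) z)" if "z \<in> pts N" for z
    using that M stab by (auto simp: N_def ghat_set_def)
  ultimately have "ghat_set N" using U by (simp add: ghat_set_def N_def)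
  moreover have "finitary N"
  proof -
    have "orbits (gp N) (pts N) (act N) \<subseteq> (`) j ` orbits (gp M) (pts M) (act M)"
      using orbN by (auto simp: orbits_def N_def)
    then show ?thesis using fin finite_surj unfolding finitary_def by blast
  qed
  moreover have "ghat_iso N M"
    unfolding ghat_iso_def
  proof (intro exI conjI)
    show "ghat_map N M i"
      unfolding ghat_map_def equivariant_def
      by (rule exI[of _ "gdef M"]) (use U ij act_cl in \<open>auto simp: N_def\<close>)
    show "bij_betw i (pts N) (pts M)"
      unfolding i_def N_def using inj by (simp add: bij_betw_inv_into inj_on_imp_bij_betw)
  qed
  ultimately show ?thesis
    by (metis (mono_tags, lifting) Abs_fin_ghat_inverse mem_Collect_eq)
qed

lemma aut_move_above:
  fixes m b c :: real
  assumes "m < b" "m < c"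
  shows "\<exists>h\<in>carrier autR. (\<forall>x\<le>m. h x = x) \<and> h c = b"
proof -
  define s where "s = (b - m) / (c - m)"
  have s: "s > 0" using assms by (simp add: s_def)
  define h where "h x = (if x \<le> m then x else m + (x - m) * s)" for x
  define h' where "h' x = (if x \<le> m then x else m + (x - m) / s)" for x
  have pos: "0 < (x - m) * s" "0 < (x - m) / s" if "x > m" for x using s that by simp_all
  have "bij h"
    by (rule bij_betw_byWitness[where f' = h'])
       (use s pos in \<open>auto simp: h_def h'_def not_le\<close>)
  moreover have "strict_mono h"
  proof (rule strict_monoI)
    fix x y :: real assume "x < y"
    then show "h x < h y" using s pos[of y] by (cases "x \<le> m"; cases "y \<le> m"; simp add: h_def; linarith)
  qed
  moreover have "h c = b" using assms by (simp add: h_def s_def)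
  moreover have "\<forall>x\<le>m. h x = x" by (simp add: h_def)
  ultimately show ?thesis by (intro bexI[of _ h]) auto
qed

lemma aut_finite_homogeneous:
  fixes A B :: "real set"
  assumes "finite A" "finite B" "card A = card B"
  shows "\<exists>g\<in>carrier autR. g ` A = B"
  using assms
proof (induction A arbitrary: B rule: finite_linorder_max_induct)
  case empty
  then show ?case by (intro bexI[of _ id]) (auto simp: strict_mono_def)
next
  case (insert a A)
  have card: "card B = Suc (card A)" using insert by (metis card_insert_disjoint less_irrefl)
  then have B: "Max B \<in> B" using insert.prems by (metis Max_in card.empty nat.distinct(1))
  have "card (B - {Max B}) = card A" using card B by simp
  then obtain g where g: "bij g" "strict_mono g" "g ` A = B - {Max B}"
    using insert.IH[of "B - {Max B}"] insert.prems by auto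
  define m where "m = Max (insert (min (g a) (Max B) - 1) (g ` A))"
  have less: "x < g a \<and> x < Max B" if x: "x \<in> g ` A" for x
  proof
    show "x < g a" using x insert.hyps g(2) by (auto simp: strict_mono_def)
    have "x \<in> B - {Max B}" using x g(3) by simp
    then show "x < Max B" using Max_ge[of B x] insert.prems by (simp add: less_le)
  qed
  have "m \<in> insert (min (g a) (Max B) - 1) (g ` A)"
    unfolding m_def by (rule Max_in) (use insert in auto)
  then have "m < Max B" "m < g a" using less by auto
  then obtain h where h: "bij h" "strict_mono h" "\<And>x. x \<le> m \<Longrightarrow> h x = x" "h (g a) = Max B"
    using aut_move_above[of m "Max B" "g a"] by auto
  have "h (g x) = g x" if "x \<in> A" for x
    by (rule h(3)) (use that insert in \<open>auto simp: m_def\<close>)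
  then have "(h \<circ> g) ` insert a A = insert (Max B) (g ` A)"
    using h(4) by (auto simp: image_iff)
  also have "\<dots> = B" using g(3) B by blast
  finally show ?case
    using g h by (intro bexI[of _ "h \<circ> g"]) (auto simp: bij_comp strict_mono_def)
qed

lemma aut_image_Min_Max:
  fixes A B :: "real set"
  assumes g: "strict_mono g" "g ` A = B" and A: "finite A" "A \<noteq> {}"
  shows "g (Min A) = Min B" "g (Max A) = Max B"
  using mono_Min_commute[of g A] mono_Max_commute[of g A] g A strict_mono_mono by auto

inductive interval :: "real set \<Rightarrow> bool" where
  left: "interval {..<a}"
| right: "interval {a<..}"
| middle: "a < b \<Longrightarrow> interval {a<..<b}"

lemma frontier_interval:
  fixes a b :: real
  shows "frontier {..<a} = {a}" "frontier {a<..} = {a}" "a < b \<Longrightarrow> frontier {a<..<b} = {a, b}"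
proof -
  show "frontier {..<a} = {a}"
    unfolding frontier_def closure_lessThan interior_open[OF open_lessThan] by force
  show "frontier {a<..} = {a}"
    unfolding frontier_def closure_greaterThan interior_open[OF open_greaterThan] by force
  show "frontier {a<..<b} = {a, b}" if "a < b"
    using that by (auto simp: frontier_def)
qed

lemma interval_frontier:
  assumes "interval I"
  shows "finite (frontier I)" "frontier I \<inter> I = {}"
  using assms by (auto elim!: interval.cases simp: frontier_interval)

lemma interval_homogeneous:
  assumes I: "interval I" and S: "S \<subseteq> I" "finite S" and T: "T \<subseteq> I" "finite T"
    and card: "card S = card T"
  shows "\<exists>g\<in>pw_stab (frontier I). g ` S = T"
proof -
  let ?E = "frontier I"
  have E: "finite ?E" "?E \<inter> I = {}" using interval_frontier[OF I] by auto
  have "card (?E \<union> S) = card (?E \<union> T)"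
    using E S T card by (subst (1 2) card_Un_disjoint) auto
  then obtain g where g: "bij g" "strict_mono g" "g ` (?E \<union> S) = ?E \<union> T"
    using aut_finite_homogeneous[of "?E \<union> S" "?E \<union> T"] E S T by auto
  have fix_E: "g e = e" if "e \<in> ?E" for e
    using I
  proof cases
    case (left a)
    then have eq: "?E = {a}" by (simp add: frontier_interval)
    have "Max (?E \<union> S) = a" "Max (?E \<union> T) = a"
      using left S T by (auto intro!: Max_eqI simp: eq)
    then show ?thesis
      using that aut_image_Min_Max[OF g(2,3)] S T eq by auto
  next
    case (right a)
    then have eq: "?E = {a}" by (simp add: frontier_interval)
    have "Min (?E \<union> S) = a" "Min (?E \<union> T) = a"
      using right S T by (auto intro!: Min_eqI simp: eq)
    then show ?thesis
      using that aut_image_Min_Max[OF g(2,3)] S T eq by auto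
  next
    case (middle a b)
    then have eq: "?E = {a, b}" by (auto simp: frontier_interval)
    have "Min (?E \<union> S) = a" "Min (?E \<union> T) = a"
      using middle S T unfolding eq by (intro Min_eqI; force)+
    moreover have "Max (?E \<union> S) = b" "Max (?E \<union> T) = b"
      using middle S T unfolding eq by (intro Max_eqI; force)+
    ultimately show ?thesis
      using that aut_image_Min_Max[OF g(2,3)] S T eq by auto
  qed
  then have gE: "g ` ?E = ?E" by force
  have "g ` S = g ` ((?E \<union> S) - ?E)" using E S by (intro arg_cong[of _ _ "(`) g"]) blast
  also have "\<dots> = (?E \<union> T) - ?E"
    using g gE by (simp add: image_set_diff bij_is_inj)
  also have "\<dots> = T" using E T by blast
  finally show ?thesis using g fix_E by (auto simp: pw_stab_def)
qed

lemma config_finitary: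
  assumes I: "interval I"
  shows "ghat_set (config I n)" "finitary (config I n)"
proof -
  let ?E = "frontier I" and ?M = "config I n"
  have U: "subgroup (pw_stab ?E) autR" by (rule pw_stab_subgroup)
  have gI: "g ` I = I" if g: "g \<in> pw_stab ?E" for g
  proof -
    have le: "h x \<in> I" if x: "x \<in> I" and h: "h \<in> pw_stab ?E" for h x
    proof -
      have h: "strict_mono h" "\<And>e. e \<in> ?E \<Longrightarrow> h e = e" using h by (auto simp: pw_stab_def)
      show ?thesis
        using I
      proof cases
        case (left a)
        then have "h a = a" by (intro h) (simp add: frontier_interval)
        then show ?thesis using strict_monoD[OF h(1), of x a] x left by simp
      next
        case (right a)
        then have "h a = a" by (intro h) (simp add: frontier_interval)
        then show ?thesis using strict_monoD[OF h(1), of a x] x right by simp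
      next
        case (middle a b)
        then have "h a = a" "h b = b" by (auto intro!: h simp: frontier_interval)
        then show ?thesis
          using strict_monoD[OF h(1), of a x] strict_monoD[OF h(1), of x b] x middle by simp
      qed
    qed
    obtain h where h: "h \<in> pw_stab ?E" "g \<circ> h = id"
      using subgroup.m_inv_closed[OF U g] group.r_inv[OF group_autR, of g] subgroup.mem_carrier[OF U g]
      by (metis autR_simps(2,3))
    have "x \<in> g ` I" if "x \<in> I" for x
      using le[OF that h(1)] h(2) by (metis comp_apply id_apply image_eqI)
    then show ?thesis using le g by blast
  qed
  have cl: "g ` S \<in> pts ?M" if "g \<in> pw_stab ?E" "S \<in> pts ?M" for g S
  proof -
    have "inj_on g S" using that by (auto simp: pw_stab_def bij_def intro: inj_on_subset)
    then show ?thesis using that gI[of g] by (auto simp: config_def card_image)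
  qed
  have act: "group_action (gp ?M) (pts ?M) (act ?M)"
  proof (rule group_actionI)
    show "group (gp ?M)" using group_gp[OF U] by (simp add: config_def)
    show "act ?M g S \<in> pts ?M" if "g \<in> carrier (gp ?M)" "S \<in> pts ?M" for g S
      using cl[of g S] that by (simp add: config_def)
    show "act ?M (g \<otimes>\<^bsub>gp ?M\<^esub> h) S = act ?M g (act ?M h S)"
      if "g \<in> carrier (gp ?M)" "h \<in> carrier (gp ?M)" "S \<in> pts ?M" for g h S
      using cl[of h S] that by (simp add: config_def image_comp)
  qed (auto simp: config_def)
  have "openin aut_topology (stabilizer (gp ?M) (act ?M) S)" if S: "S \<in> pts ?M" for S
  proof -
    have "subgroup (stabilizer (gp ?M) (act ?M) S) autR"
      using group_action.stabilizer_subgroup[OF act S] group.incl_subgroup[OF group_autR U]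
      by (simp add: config_def)
    moreover have "pw_stab (?E \<union> S) \<subseteq> stabilizer (gp ?M) (act ?M) S"
      using S by (auto simp: stabilizer_def config_def pw_stab_def image_iff) 
    moreover have "finite (?E \<union> S)" using S interval_frontier[OF I] by (simp add: config_def)
    ultimately show ?thesis using openin_subgroup_iff by blast
  qed
  moreover have "open_subgroup (pw_stab ?E)"
    using U interval_frontier[OF I] open_subgroup_iff by blast
  ultimately show "ghat_set ?M" using act by (simp add: ghat_set_def) (simp add: config_def)
  have "orbit (gp ?M) (act ?M) S = pts ?M" if S: "S \<in> pts ?M" for S
  proof
    show "orbit (gp ?M) (act ?M) S \<subseteq> pts ?M"
      using cl[OF _ S] S by (auto simp: orbit_def config_def)
    show "pts ?M \<subseteq> orbit (gp ?M) (act ?M) S"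
    proof
      fix T assume "T \<in> pts ?M"
      then obtain g where "g \<in> pw_stab ?E" "g ` S = T"
        using interval_homogeneous[OF I, of S T] S by (auto simp: config_def)
      then show "T \<in> orbit (gp ?M) (act ?M) S" using S by (auto simp: orbit_def config_def)
    qed
  qed
  then have "orbits (gp ?M) (pts ?M) (act ?M) \<subseteq> {pts ?M}" by (auto simp: orbits_def)
  then show "finitary ?M" unfolding finitary_def by (rule finite_subset) simp
qed

text \<open>Polynomials over the integers in commuting variables indexed by \<^typ>\<open>fin_ghat\<close>.\<close>

type_synonym free_ring = "(fin_ghat \<Rightarrow>\<^sub>0 nat) \<Rightarrow>\<^sub>0 int"

definition gen :: "fin_ghat \<Rightarrow> free_ring" where
  "gen A = Poly_Mapping.single (Poly_Mapping.single A 1) 1"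

text \<open>Since \<^typ>\<open>fin_ghat\<close> is not literally closed under coproducts, conjugates and fibers, the
  last three relations speak of any representative isomorphic to the construction.\<close>

inductive_set theta_relations :: "free_ring set" where
  iso: "ghat_iso (Rep_fin_ghat A) (Rep_fin_ghat B) \<Longrightarrow> gen A - gen B \<in> theta_relations"
| singleton: "pts (Rep_fin_ghat A) = {x} \<Longrightarrow> gen A - 1 \<in> theta_relations"
| coprod: "ghat_iso (Rep_fin_ghat C) (coprod (Rep_fin_ghat A) (Rep_fin_ghat B)) \<Longrightarrow>
    gen C - (gen A + gen B) \<in> theta_relations"
| conj: "g \<in> carrier autR \<Longrightarrow> ghat_iso (Rep_fin_ghat B) (conj_ghat (Rep_fin_ghat A) g) \<Longrightarrow>
    gen A - gen B \<in> theta_relations"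
| fiber: "gdef (Rep_fin_ghat A) = U \<Longrightarrow> gdef (Rep_fin_ghat B) = U \<Longrightarrow>
    transitive_ghat (Rep_fin_ghat A) \<Longrightarrow> transitive_ghat (Rep_fin_ghat B) \<Longrightarrow>
    equivariant U (Rep_fin_ghat A) (Rep_fin_ghat B) f \<Longrightarrow> y \<in> pts (Rep_fin_ghat B) \<Longrightarrow>
    ghat_iso (Rep_fin_ghat F) (fiber (Rep_fin_ghat A) (Rep_fin_ghat B) f y) \<Longrightarrow>
    gen A - gen F * gen B \<in> theta_relations"

definition theta_ideal :: "free_ring set" where
  "theta_ideal = Idl\<^bsub>ring_of_type_algebra\<^esub> theta_relations"

definition Theta :: "free_ring set ring" where
  "Theta = ring_of_type_algebra Quot theta_ideal"

text \<open>The class \<open>[X]\<close>; meaningful if \<open>X\<close> is a finitary \<open>ghat_set\<close>, in particular for the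
  configuration spaces by \<open>config_finitary\<close>.\<close>

definition theta_class :: "real set ghat \<Rightarrow> free_ring set" where
  "theta_class M = theta_ideal +>\<^bsub>ring_of_type_algebra\<^esub> gen (Abs_fin_ghat M)"

definition is_mu :: "int \<Rightarrow> int \<Rightarrow> (free_ring set \<Rightarrow> int) \<Rightarrow> bool" where
  "is_mu \<epsilon> \<delta> \<mu> \<longleftrightarrow> \<mu> \<in> ring_hom Theta \<Z> \<and>
     (\<forall>n a b. a < b \<longrightarrow> \<mu> (theta_class (config {a<..<b} n)) = (-1) ^ n) \<and>
     (\<forall>n a. \<mu> (theta_class (config {..<a} n)) = \<epsilon> ^ n) \<and>
     (\<forall>n a. \<mu> (theta_class (config {a<..} n)) = \<delta> ^ n)"

lemma cring_Theta: "cring Theta"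
proof -
  interpret R: cring "ring_of_type_algebra :: free_ring ring"
    by (rule cring_from_type_algebra)
  have "ideal theta_ideal (ring_of_type_algebra :: free_ring ring)"
    unfolding theta_ideal_def
    by (rule R.genideal_ideal) (simp add: ring_of_type_algebra_def)
  then show ?thesis
    unfolding Theta_def by (rule ideal.quotient_is_cring) (rule R.is_cring)
qed

end

theory Submission
  imports Defs
begin

text \<open>Write \<open>G(A)\<close> for \<^term>\<open>pw_stab A\<close> with \<open>A\<close> finite. The argument rests on a description of all finitary
sets: every open subgroup of \<open>G\<close> is some \<open>G(A)\<close> (\<open>open_subgroup_eq_pw_stab\<close>). So in a smooth
\<open>G(A)\<close>-set every point \<open>x\<close> has a \<^emph>\<open>support\<close>, the finite set \<open>B \<supseteq> A\<close> whose pointwise stabilizer is the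
stabilizer of \<open>x\<close>, and the orbit of \<open>x\<close> is \<open>G(A)/G(B)\<close>, realised below as the set of all images \<open>g ` B\<close>.

\<^bold>\<open>Existence.\<close> For nonempty \<open>A\<close>, give the orbit \<open>G(A)/G(B)\<close> the weight \<open>(-1)\<close> to the power \<open>card (B - A)\<close>,
replaced by \<open>0\<close> if \<open>\<epsilon> = 0\<close> and \<open>B\<close> has a point to the left of \<open>A\<close>, or if \<open>\<delta> = 0\<close> and \<open>B\<close> has a point to the
right of \<open>A\<close>. The sum of the weights of the \<open>G(A)\<close>-orbits is a kind of Euler characteristic. The
weight is multiplicative along \<open>A \<subseteq> C \<subseteq> B\<close> (\<open>weight_chain\<close>), and it is additive when an interval is cut
at a point: a middle interval satisfies \<open>-1 = (-1) + 1 + (-1)\<close>, an end interval \<open>\<epsilon> = \<epsilon> + 1 + (-1)\<close>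
(\<open>weight_split_point\<close>). Together with the decomposition of an orbit sum along an equivariant map
(\<open>orbit_sum_fubini\<close>) these two facts show that the sum does not depend on \<open>A\<close>
(\<open>euler_independent\<close>) and is multiplicative for fibrations (\<open>euler_fibration\<close>). Hence it kills all
relations of \<open>\<Theta>(G)\<close> and defines the required homomorphism.

\<^bold>\<open>Uniqueness and the isomorphism.\<close> The fibration relation reduces the class of \<open>G(A)/G(B)\<close> to classes
with \<open>B - A\<close> a single point, that is, to classes of intervals, and there are only three of those up to
conjugation: \<open>m\<close>, \<open>l\<close>, \<open>r\<close> for middle, left and right intervals. Cutting a middle interval at a point
gives \<open>m = m + 1 + m\<close>, so \<open>m = -1\<close>. Computing the class of the pairs in a left interval once by
projecting to the larger and once to the smaller point gives \<open>l * l = l * m = -l\<close>, and likewise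
\<open>r * r = -r\<close>. So \<open>\<Theta>(G)\<close> is spanned over the integers by \<open>1\<close>, \<open>l\<close>, \<open>r\<close>, \<open>l * r\<close>
(\<open>all_spanned\<close>), and as \<open>\<mu>\<close> takes the values \<open>1\<close>, \<open>\<epsilon>\<close>, \<open>\<delta>\<close>, \<open>\<epsilon> * \<delta>\<close> on them, the four homomorphisms are
determined, and together they are given by a matrix that is invertible over the integers.\<close>

section \<open>Order automorphisms fixing a finite set\<close>

lemma pw_stabD:
  assumes "g \<in> pw_stab A"
  shows "bij g" "strict_mono g" "a \<in> A \<Longrightarrow> g a = a"
  using assms by (auto simp: pw_stab_def)

lemma pw_stab_empty: "pw_stab {} = carrier autR"
  by (auto simp: pw_stab_def)

lemma pw_stab_Un: "pw_stab (A \<union> B) = pw_stab A \<inter> pw_stab B"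
  by (auto simp: pw_stab_def)

lemma pw_stab_antimono: "A \<subseteq> B \<Longrightarrow> pw_stab B \<subseteq> pw_stab A"
  by (auto simp: pw_stab_def)

lemma id_pw_stab [simp]: "id \<in> pw_stab A" "(\<lambda>x. x) \<in> pw_stab A"
  by (auto simp: pw_stab_def strict_mono_def bij_id[unfolded id_def])

lemma comp_pw_stab: "g \<in> pw_stab A \<Longrightarrow> h \<in> pw_stab A \<Longrightarrow> g \<circ> h \<in> pw_stab A"
  by (auto simp: pw_stab_def bij_comp strict_mono_def)

lemma inv_pw_stab: "g \<in> pw_stab A \<Longrightarrow> inv_into UNIV g \<in> pw_stab A"
  by (auto simp: pw_stab_def bij_imp_bij_inv strict_mono_inv_real bij_is_inj inv_f_eq)

lemma pw_stab_inv_comp [simp]: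
  assumes "g \<in> pw_stab A"
  shows "inv_into UNIV g \<circ> g = id" "g \<circ> inv_into UNIV g = id"
    "inv_into UNIV g (g x) = x" "g (inv_into UNIV g x) = x"
  using pw_stabD(1)[OF assms] by (auto simp: bij_is_inj bij_is_surj surj_f_inv_f fun_eq_iff)

lemma m_inv_autR: "g \<in> pw_stab A \<Longrightarrow> m_inv autR g = inv_into UNIV g"
  by (rule group.inv_equality[OF group_autR])
     (use inv_pw_stab[of g A] in \<open>auto simp: pw_stab_def bij_is_inj\<close>)

text \<open>A finite subset of a linear order has exactly one increasing enumeration; the induction removes the
largest element.\<close>

lemma strict_mono_image_unique:
  fixes f g :: "real \<Rightarrow> real"
  assumes "finite S" "strict_mono_on S f" "strict_mono_on S g" "f ` S = g ` S" "s \<in> S"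
  shows "f s = g s"
  using assms
proof (induction S arbitrary: s rule: finite_linorder_max_induct)
  case (insert b S)
  have lt: "f s < f b" "g s < g b" if "s \<in> S" for s
    using insert.hyps(2) strict_mono_onD[OF insert.prems(1), of s b]
      strict_mono_onD[OF insert.prems(2), of s b] that by auto
  have b: "f b = g b"
  proof -
    have "f b \<in> g ` insert b S" "g b \<in> f ` insert b S" using insert.prems by auto
    then show ?thesis using lt by force
  qed
  have "f ` S = f ` insert b S - {f b}" "g ` S = g ` insert b S - {g b}" using lt by fastforce+
  then have img: "f ` S = g ` S" using insert.prems(3) b by metis
  have "f s = g s" if "s \<in> S" for s
  proof (rule insert.IH)
    show "strict_mono_on S f" "strict_mono_on S g"
      using insert.prems(1,2) by (auto intro!: strict_mono_onI dest: strict_mono_onD)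
  qed (use img that in auto)
  then show ?case using b insert.prems by auto
qed simp

text \<open>The image and the domain have equally many elements, so some automorphism maps one onto the other,
and by uniqueness of increasing bijections it can only do so in the prescribed way.\<close>

lemma aut_extend:
  fixes f :: "real \<Rightarrow> real"
  assumes "finite S" "strict_mono_on S f"
  shows "\<exists>g\<in>pw_stab {}. \<forall>s\<in>S. g s = f s"
proof -
  have "inj_on f S" using assms(2) by (rule strict_mono_on_imp_inj_on)
  then have "card S = card (f ` S)" by (simp add: card_image)
  then obtain g where g: "bij g" "strict_mono g" "g ` S = f ` S"
    using aut_finite_homogeneous[of S "f ` S"] assms(1) by auto
  then have "strict_mono_on S g" by (auto simp: strict_mono_on_def strict_mono_def)
  then have "g s = f s" if "s \<in> S" for s
    using strict_mono_image_unique[OF assms(1) _ assms(2) g(3) that] by blast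
  moreover have "g \<in> pw_stab {}" using g by (simp add: pw_stab_def)
  ultimately show ?thesis by blast
qed

lemma pw_stab_extend:
  fixes f :: "real \<Rightarrow> real"
  assumes "finite S" "strict_mono_on S f" "A \<subseteq> S" "\<And>a. a \<in> A \<Longrightarrow> f a = a"
  obtains g where "g \<in> pw_stab A" "\<And>s. s \<in> S \<Longrightarrow> g s = f s"
  using aut_extend[OF assms(1,2)] assms(3,4) by (fastforce simp: pw_stab_def)

lemma pw_stab_move:
  assumes "finite A" "u \<notin> A" "t \<notin> A" "\<And>a. a \<in> A \<Longrightarrow> a < u \<longleftrightarrow> a < t"
  shows "\<exists>g\<in>pw_stab A. g u = t"
proof -
  have sm: "strict_mono_on (insert u A) (id(u := t))"
    unfolding strict_mono_on_def using assms
    by (auto simp: not_less) (metis linorder_less_linear order_less_asym)+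
  obtain g where g: "g \<in> pw_stab A" "\<And>s. s \<in> insert u A \<Longrightarrow> g s = (id(u := t)) s"
  proof (rule pw_stab_extend[OF _ sm])
    show "(id(u := t)) x = x" if "x \<in> A" for x using that assms(2) by auto
  qed (use assms(1) in auto)
  from g(2)[of u] have "g u = t" by simp
  then show ?thesis using g(1) by blast
qed

lemma pw_stab_less_iff: "g \<in> pw_stab A \<Longrightarrow> a \<in> A \<Longrightarrow> a < g x \<longleftrightarrow> a < x"
  "g \<in> pw_stab A \<Longrightarrow> a \<in> A \<Longrightarrow> g x < a \<longleftrightarrow> x < a"
  "g \<in> pw_stab A \<Longrightarrow> a \<in> A \<Longrightarrow> g x = a \<longleftrightarrow> x = a"
  using strict_mono_less[of g a x] strict_mono_less[of g x a] strict_mono_eq[of g x a]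
  by (auto simp: pw_stab_def)

text \<open>The orbits of \<open>G(A)\<close> on the line outside \<open>A\<close> are the components of the complement of \<open>A\<close>. Saying which
points of \<open>A\<close> lie to the left names the component without case distinction on its kind.\<close>

lemma pw_stab_orbit_point:
  assumes "finite A" "u \<notin> A"
  shows "(\<exists>g\<in>pw_stab A. g u = t) \<longleftrightarrow> t \<notin> A \<and> (\<forall>a\<in>A. a < u \<longleftrightarrow> a < t)"
proof
  assume "\<exists>g\<in>pw_stab A. g u = t"
  then obtain g where g: "g \<in> pw_stab A" "g u = t" by blast
  then show "t \<notin> A \<and> (\<forall>a\<in>A. a < u \<longleftrightarrow> a < t)"
    using pw_stab_less_iff[OF g(1)] assms(2) by metis
qed (use pw_stab_move[OF assms, of t] in blast)

lemma exists_between_finite: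
  fixes b :: real
  assumes "finite S"
  shows "\<exists>u<b. \<forall>s\<in>S. s < b \<longrightarrow> s < u" "\<exists>u>b. \<forall>s\<in>S. b < s \<longrightarrow> u < s"
proof -
  define m where "m = Max (insert (b - 1) {s\<in>S. s < b})"
  have "m < b" "\<forall>s\<in>S. s < b \<longrightarrow> s \<le> m" using assms by (auto simp: m_def)
  moreover obtain u where "m < u" "u < b" using \<open>m < b\<close> dense by blast
  ultimately show "\<exists>u<b. \<forall>s\<in>S. s < b \<longrightarrow> s < u" by (intro exI[of _ u]) force
  define m where "m = Min (insert (b + 1) {s\<in>S. b < s})"
  have "b < m" "\<forall>s\<in>S. b < s \<longrightarrow> m \<le> s" using assms by (auto simp: m_def)
  moreover obtain u where "b < u" "u < m" using \<open>b < m\<close> dense by blast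
  ultimately show "\<exists>u>b. \<forall>s\<in>S. b < s \<longrightarrow> u < s" by (intro exI[of _ u]) force
qed

text \<open>A point outside the finite set \<open>B\<close> can be moved by \<open>G(B)\<close>, so \<open>G(B)\<close> determines \<open>B\<close>.\<close>

lemma pw_stab_subset_iff:
  assumes "finite B"
  shows "pw_stab B \<subseteq> pw_stab A \<longleftrightarrow> A \<subseteq> B"
proof
  assume L: "pw_stab B \<subseteq> pw_stab A"
  show "A \<subseteq> B"
  proof
    fix a assume a: "a \<in> A"
    show "a \<in> B"
    proof (rule ccontr)
      assume nB: "a \<notin> B"
      obtain u where u: "u < a" "\<forall>s\<in>B. s < a \<longrightarrow> s < u" using exists_between_finite(1)[OF assms] by blast
      have "\<exists>g\<in>pw_stab B. g a = u"
        by (rule pw_stab_move) (use assms nB u in force)+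
      then show False using L u a by (auto simp: pw_stab_def)
    qed
  qed
qed (simp add: pw_stab_antimono)

lemma pw_stab_eq_iff: "finite A \<Longrightarrow> finite B \<Longrightarrow> pw_stab A = pw_stab B \<longleftrightarrow> A = B"
  using pw_stab_subset_iff[of A B] pw_stab_subset_iff[of B A] by blast

lemma strict_mono_finite_fix:
  fixes g :: "real \<Rightarrow> real"
  assumes "strict_mono g" "finite B" "g ` B = B" "b \<in> B"
  shows "g b = b"
  using strict_mono_image_unique[of B g id b] assms by (auto simp: strict_mono_on_def strict_mono_def)

lemma pw_stab_conj_iff:
  assumes "g \<in> pw_stab {}"
  shows "g \<circ> h \<circ> inv_into UNIV g \<in> pw_stab (g ` A) \<longleftrightarrow> h \<in> pw_stab A"
proof -
  have *: "g \<circ> h \<circ> inv_into UNIV g \<in> pw_stab (g ` A)" if "g \<in> pw_stab {}" "h \<in> pw_stab A" for g h A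
  proof -
    have "g \<circ> h \<circ> inv_into UNIV g \<in> pw_stab {}"
      using that pw_stab_antimono[of "{}" A] by (intro comp_pw_stab inv_pw_stab) auto
    then show ?thesis using that by (auto simp: pw_stab_def bij_is_inj)
  qed
  have inv: "inv_into UNIV (inv_into UNIV g) = g" "inv_into UNIV g ` g ` A = A"
    using assms by (auto simp: pw_stabD(1) inv_inv_eq image_image)
  have "h = inv_into UNIV g \<circ> (g \<circ> h \<circ> inv_into UNIV g) \<circ> g"
    using assms by (auto simp: fun_eq_iff)
  then show ?thesis
    using *[OF assms] *[OF inv_pw_stab[OF assms], of "g \<circ> h \<circ> inv_into UNIV g" "g ` A"] inv by auto
qed

lemma pw_stab_image:
  assumes "g \<in> pw_stab {}"
  shows "pw_stab (g ` A) = (\<lambda>h. g \<circ> h \<circ> inv_into UNIV g) ` pw_stab A"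
proof -
  have "h \<in> (\<lambda>h. g \<circ> h \<circ> inv_into UNIV g) ` pw_stab A" if "h \<in> pw_stab (g ` A)" for h
  proof -
    have eq: "h = g \<circ> (inv_into UNIV g \<circ> h \<circ> g) \<circ> inv_into UNIV g"
      using assms by (auto simp: fun_eq_iff)
    have "g \<circ> (inv_into UNIV g \<circ> h \<circ> g) \<circ> inv_into UNIV g \<in> pw_stab (g ` A)"
      using that eq by simp
    then have "inv_into UNIV g \<circ> h \<circ> g \<in> pw_stab A" using pw_stab_conj_iff[OF assms] by blast
    then show ?thesis using eq by blast
  qed
  then show ?thesis using pw_stab_conj_iff[OF assms] by blast
qed


section \<open>Open subgroups\<close>

text \<open>The heart of the classification of open subgroups: if \<open>V\<close> contains \<open>G(B)\<close> and \<open>G(C)\<close> and \<open>b\<close> lies in \<open>B\<close>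
but not in \<open>C\<close>, then \<open>V\<close> can already move \<open>b\<close> within its component of the complement of \<open>B - {b}\<close> as
freely as \<open>G(B - {b})\<close> does. Elements of \<open>G(C)\<close> push \<open>b\<close> slightly to either side, and from there elements
of \<open>G(B)\<close> carry it to any point of that side.\<close>

lemma pw_stab_remove:
  assumes V: "subgroup V autR" and B: "finite B" "pw_stab B \<subseteq> V" and C: "finite C" "pw_stab C \<subseteq> V"
    and b: "b \<in> B" "b \<notin> C"
  shows "pw_stab (B - {b}) \<subseteq> V"
proof
  fix h assume h: "h \<in> pw_stab (B - {b})"
  have "\<exists>k\<in>V \<inter> pw_stab (B - {b}). k b = h b"
  proof (cases "h b = b")
    case True
    then show ?thesis using subgroup.one_closed[OF V] by (intro bexI[of _ id]) auto
  next
    case False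
    let ?S = "(B \<union> C) - {b}"
    \<comment> \<open>\<open>u\<close> is so close to \<open>b\<close> that no point of \<open>B \<union> C\<close> other than \<open>b\<close> separates them, and on the same side as \<open>h b\<close>\<close>
    obtain u where u: "u \<notin> ?S" "u \<noteq> b" "\<forall>s\<in>?S. s < b \<longleftrightarrow> s < u" "u < b \<longleftrightarrow> h b < b"
    proof (cases "h b < b")
      case True
      obtain u where u: "u < b" "\<And>s. s \<in> ?S \<Longrightarrow> s < b \<Longrightarrow> s < u"
        using exists_between_finite(1)[of ?S b] B C by blast
      show ?thesis
      proof (rule that[of u])
        show "u \<notin> ?S" using u(2)[of u] u(1) by blast
        show "\<forall>s\<in>?S. s < b \<longleftrightarrow> s < u" using u less_trans by blast
      qed (use u True in auto)
    next
      case F: False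
      obtain u where u: "u > b" "\<And>s. s \<in> ?S \<Longrightarrow> b < s \<Longrightarrow> u < s"
        using exists_between_finite(2)[of ?S b] B C by blast
      show ?thesis
      proof (rule that[of u])
        show "u \<notin> ?S" using u(2)[of u] u(1) by blast
        show "\<forall>s\<in>?S. s < b \<longleftrightarrow> s < u"
        proof
          fix s assume s: "s \<in> ?S"
          then have "s \<noteq> b" by blast
          then show "s < b \<longleftrightarrow> s < u" using u(1) u(2)[OF s] by linarith
        qed
      qed (use u F False in auto)
    qed
    obtain k1 where k1: "k1 \<in> pw_stab ?S" "k1 b = u"
      using pw_stab_move[of ?S b u] u B C by blast
    have hb: "h b \<notin> B" "\<And>s. s \<in> B \<Longrightarrow> s < h b \<longleftrightarrow> s < u"
      using False h u b pw_stab_less_iff[OF h, of _ b] by (auto; force)+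
    obtain k2 where k2: "k2 \<in> pw_stab B" "k2 u = h b"
      using pw_stab_move[of B u "h b"] B hb u by auto
    have "k1 \<in> V" using k1 C b pw_stab_antimono[of C ?S] by auto
    moreover have "k2 \<in> V" using k2 B by auto
    moreover have "k1 \<in> pw_stab (B - {b})" "k2 \<in> pw_stab (B - {b})"
      using k1 k2 pw_stab_antimono[of "B - {b}" ?S] pw_stab_antimono[of "B - {b}" B] by auto
    ultimately show ?thesis
      using k1 k2 subgroup.m_closed[OF V, of k2 k1] by (intro bexI[of _ "k2 \<circ> k1"]) (auto intro: comp_pw_stab)
  qed
  then obtain k where k: "k \<in> V" "k \<in> pw_stab (B - {b})" "k b = h b" by blast
  have "inv_into UNIV k \<circ> h \<in> pw_stab (B - {b})" using k h by (intro comp_pw_stab inv_pw_stab)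
  moreover have "(inv_into UNIV k \<circ> h) b = b" using k by (metis comp_apply pw_stab_inv_comp(3))
  ultimately have "inv_into UNIV k \<circ> h \<in> pw_stab B" by (auto simp: pw_stab_def)
  then have "k \<circ> (inv_into UNIV k \<circ> h) \<in> V"
    using subgroup.m_closed[OF V k(1)] B by auto
  moreover have "k \<circ> (inv_into UNIV k \<circ> h) = h" using k by (auto simp: fun_eq_iff)
  ultimately show "h \<in> V" by simp
qed

text \<open>Choose \<open>B\<close> of least cardinality with \<open>G(B) \<subseteq> V\<close>. An element \<open>g\<close> of \<open>V\<close> that moves \<open>B\<close> would give
\<open>G(g ` B) \<subseteq> V\<close> and a point of \<open>B\<close> outside \<open>g ` B\<close>, which could then be dropped from \<open>B\<close>. So \<open>V\<close>
preserves \<open>B\<close>, hence fixes it pointwise.\<close>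

lemma open_subgroup_eq_pw_stab:
  assumes V: "subgroup V autR" and ex: "\<exists>B. finite B \<and> pw_stab B \<subseteq> V"
  shows "\<exists>B. finite B \<and> V = pw_stab B"
proof -
  obtain B where B: "finite B" "pw_stab B \<subseteq> V"
    and min: "\<And>C. finite C \<Longrightarrow> pw_stab C \<subseteq> V \<Longrightarrow> card B \<le> card C"
    using ex_has_least_nat[of "\<lambda>B. finite B \<and> pw_stab B \<subseteq> V" _ card] ex by metis
  have "g \<in> pw_stab B" if g: "g \<in> V" for g
  proof -
    have gG: "g \<in> pw_stab {}" using subgroup.subset[OF V] g by (auto simp: pw_stab_empty)
    have "g ` B = B"
    proof (rule ccontr)
      assume "g ` B \<noteq> B"
      have "card (g ` B) = card B"
        using gG by (intro card_image) (auto simp: pw_stab_def bij_def intro: inj_on_subset)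
      then have "\<not> B \<subseteq> g ` B" using \<open>g ` B \<noteq> B\<close> B card_subset_eq[of "g ` B" B] by auto
      then obtain b where b: "b \<in> B" "b \<notin> g ` B" by blast
      have "inv_into UNIV g \<in> V"
        using subgroup.m_inv_closed[OF V g] m_inv_autR[OF gG] by simp
      then have "g \<circ> h \<circ> inv_into UNIV g \<in> V" if "h \<in> pw_stab B" for h
        using subgroup.m_closed[OF V] g that B by (metis autR_simps(2) subsetD)
      then have "pw_stab (g ` B) \<subseteq> V" using pw_stab_image[OF gG] by auto
      then have "pw_stab (B - {b}) \<subseteq> V" using pw_stab_remove[OF V B _ _ b] B by simp
      then show False using min[of "B - {b}"] B b
        by (metis card_Diff1_less finite_Diff not_less)
    qed
    then show ?thesis using strict_mono_finite_fix[of g B] B gG by (auto simp: pw_stab_def)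
  qed
  then show ?thesis using B by blast
qed


section \<open>Smooth actions and supports\<close>

text \<open>Unlike for \<^locale>\<open>group_action\<close>, the functions \<open>a g\<close> need not be extensional, so that one and the same \<open>a\<close>
serves for all invariant subsets of \<open>E\<close> and all smaller groups.\<close>

locale pw_action =
  fixes A :: "real set" and a :: "(real \<Rightarrow> real) \<Rightarrow> 'x \<Rightarrow> 'x" and E :: "'x set"
  assumes closed: "g \<in> pw_stab A \<Longrightarrow> x \<in> E \<Longrightarrow> a g x \<in> E"
    and one: "x \<in> E \<Longrightarrow> a id x = x"
    and comp: "g \<in> pw_stab A \<Longrightarrow> h \<in> pw_stab A \<Longrightarrow> x \<in> E \<Longrightarrow> a (g \<circ> h) x = a g (a h x)"
begin

lemma inv_act [simp]:
  assumes "g \<in> pw_stab A" "x \<in> E"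
  shows "a (inv_into UNIV g) (a g x) = x" "a g (a (inv_into UNIV g) x) = x"
  using assms comp[of "inv_into UNIV g" g x] comp[of g "inv_into UNIV g" x] inv_pw_stab[of g A] one
  by auto

definition orb :: "'x \<Rightarrow> 'x set" where
  "orb x = (\<lambda>g. a g x) ` pw_stab A"

lemma orb_refl: "x \<in> E \<Longrightarrow> x \<in> orb x"
  unfolding orb_def using one[of x] by (metis id_pw_stab(1) imageI)

lemma orb_act: "g \<in> pw_stab A \<Longrightarrow> x \<in> E \<Longrightarrow> orb (a g x) = orb x"
proof -
  have *: "orb (a g x) \<subseteq> orb x" if "g \<in> pw_stab A" "x \<in> E" for g x
    using that comp[of _ g x] comp_pw_stab[of _ A g] by (force simp: orb_def)
  assume g: "g \<in> pw_stab A" "x \<in> E"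
  then have "orb x \<subseteq> orb (a g x)"
    using *[of "inv_into UNIV g" "a g x"] closed inv_pw_stab by simp
  then show ?thesis using * g by blast
qed

lemma orb_eq:
  assumes "x \<in> E" "y \<in> orb x"
  shows "orb y = orb x"
proof -
  obtain g where "g \<in> pw_stab A" "y = a g x" using assms(2) by (auto simp: orb_def)
  then show ?thesis using orb_act assms(1) by simp
qed

lemma act_in_orb:
  assumes "x \<in> E" "y \<in> orb x" "g \<in> pw_stab A"
  shows "a g y \<in> orb x"
proof -
  obtain h where "h \<in> pw_stab A" "y = a h x" using assms(2) by (auto simp: orb_def)
  then have "a g y = a (g \<circ> h) x" "g \<circ> h \<in> pw_stab A"
    using comp[of g h x] assms by (auto intro: comp_pw_stab)
  then show ?thesis by (simp add: orb_def)
qed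

lemma orb_subset: "x \<in> E \<Longrightarrow> orb x \<subseteq> E"
  using closed by (auto simp: orb_def)

lemma subaction: "Y \<subseteq> E \<Longrightarrow> (\<And>g y. g \<in> pw_stab B \<Longrightarrow> y \<in> Y \<Longrightarrow> a g y \<in> Y) \<Longrightarrow> A \<subseteq> B \<Longrightarrow> pw_action B a Y"
  using pw_stab_antimono[of A B] one comp by unfold_locales blast+

end

text \<open>Kept outside the locales because the orbits for several groups \<open>A\<close> and several sets are compared.\<close>

definition orbs :: "real set \<Rightarrow> ((real \<Rightarrow> real) \<Rightarrow> 'x \<Rightarrow> 'x) \<Rightarrow> 'x set \<Rightarrow> 'x set set" where
  "orbs A a E = (\<lambda>x. (\<lambda>g. a g x) ` pw_stab A) ` E"

locale smooth_action = pw_action +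
  assumes finite_A: "finite A"
    and smooth: "x \<in> E \<Longrightarrow> \<exists>B. finite B \<and> A \<subseteq> B \<and> (\<forall>g\<in>pw_stab B. a g x = x)"

definition support :: "real set \<Rightarrow> ((real \<Rightarrow> real) \<Rightarrow> 'x \<Rightarrow> 'x) \<Rightarrow> 'x \<Rightarrow> real set" where
  "support A a x = (THE B. finite B \<and> {g \<in> pw_stab A. a g x = x} = pw_stab B)"

lemma support_eqI: "finite B \<Longrightarrow> {g \<in> pw_stab A. a g x = x} = pw_stab B \<Longrightarrow> support A a x = B"
  unfolding support_def by (rule the_equality) (auto simp: pw_stab_eq_iff)

context smooth_action
begin

lemma stab_subgroup:
  assumes x: "x \<in> E"
  shows "subgroup {g \<in> pw_stab A. a g x = x} autR"
proof -
  interpret group autR by (rule group_autR)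
  show ?thesis
  proof (rule subgroupI)
    show "{g \<in> pw_stab A. a g x = x} \<subseteq> carrier autR" by (auto simp: pw_stab_def)
    show "{g \<in> pw_stab A. a g x = x} \<noteq> {}" using one[OF x] id_pw_stab(1) by blast
    fix g assume g: "g \<in> {g \<in> pw_stab A. a g x = x}"
    then have "a (inv_into UNIV g) x = x" using inv_act(1)[of g x] x by simp
    then show "m_inv autR g \<in> {g \<in> pw_stab A. a g x = x}"
      using g inv_pw_stab[of g A] m_inv_autR[of g A] by simp
    fix h assume h: "h \<in> {g \<in> pw_stab A. a g x = x}"
    then show "g \<otimes>\<^bsub>autR\<^esub> h \<in> {g \<in> pw_stab A. a g x = x}"
      using g comp[of g h x] x comp_pw_stab[of g A h] by simp
  qed
qed

lemma support_ex: "x \<in> E \<Longrightarrow> \<exists>B. finite B \<and> {g \<in> pw_stab A. a g x = x} = pw_stab B"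
proof -
  assume x: "x \<in> E"
  then obtain B where B: "finite B" "A \<subseteq> B" "\<forall>g\<in>pw_stab B. a g x = x" using smooth by blast
  then have "pw_stab B \<subseteq> {g \<in> pw_stab A. a g x = x}" using pw_stab_antimono[of A B] by blast
  then show ?thesis using open_subgroup_eq_pw_stab[OF stab_subgroup[OF x]] B by blast
qed

lemma
  assumes "x \<in> E"
  shows finite_supp: "finite (support A a x)"
    and stab_eq: "{g \<in> pw_stab A. a g x = x} = pw_stab (support A a x)"
  using support_ex[OF assms] support_eqI[of _ A a x] by auto

lemma support_fixes: "x \<in> E \<Longrightarrow> g \<in> pw_stab (support A a x) \<Longrightarrow> a g x = x"
  using stab_eq by blast

lemma support_supset: "x \<in> E \<Longrightarrow> A \<subseteq> support A a x"
  using stab_eq[of x] finite_supp[of x] pw_stab_subset_iff by blast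

lemma restrict_smooth:
  assumes "Y \<subseteq> E" "\<And>g y. g \<in> pw_stab B \<Longrightarrow> y \<in> Y \<Longrightarrow> a g y \<in> Y" "A \<subseteq> B" "finite B"
  shows "smooth_action B a Y"
proof -
  interpret Y: pw_action B a Y using subaction assms by blast
  show ?thesis
  proof
    fix y assume y: "y \<in> Y"
    then obtain C where C: "finite C" "A \<subseteq> C" "\<forall>g\<in>pw_stab C. a g y = y"
      using smooth[of y] assms(1) by auto
    then show "\<exists>C. finite C \<and> B \<subseteq> C \<and> (\<forall>g\<in>pw_stab C. a g y = y)"
      using assms(4) by (intro exI[of _ "B \<union> C"]) (simp add: pw_stab_Un)
  qed fact
qed

lemma orb_smooth: "x \<in> E \<Longrightarrow> smooth_action A a (orb x)"
  by (rule restrict_smooth) (use finite_A orb_subset act_in_orb in auto)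

lemma support_restrict:
  assumes "x \<in> E" "A \<subseteq> B" "finite B"
  shows "support B a x = B \<union> support A a x"
proof (rule support_eqI)
  show "finite (B \<union> support A a x)" using assms finite_supp by blast
  have "{g \<in> pw_stab B. a g x = x} = pw_stab B \<inter> {g \<in> pw_stab A. a g x = x}"
    using pw_stab_antimono[OF assms(2)] by blast
  then show "{g \<in> pw_stab B. a g x = x} = pw_stab (B \<union> support A a x)"
    using stab_eq[OF assms(1)] by (simp add: pw_stab_Un)
qed

text \<open>Stabilizers of points in one orbit are conjugate, and conjugation by \<open>g\<close> turns \<open>G(B)\<close> into \<open>G(g ` B)\<close>.\<close>

lemma support_act:
  assumes "x \<in> E" "g \<in> pw_stab A"
  shows "support A a (a g x) = g ` support A a x"
proof (rule support_eqI)
  show "finite (g ` support A a x)" using assms finite_supp by blast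
  have g: "g \<in> pw_stab {}" using assms(2) pw_stab_antimono[of "{}" A] by blast
  have "h \<in> pw_stab A \<and> a h (a g x) = a g x \<longleftrightarrow>
      inv_into UNIV g \<circ> h \<circ> g \<in> pw_stab A \<and> a (inv_into UNIV g \<circ> h \<circ> g) x = x" for h
  proof -
    have eq: "h = g \<circ> (inv_into UNIV g \<circ> h \<circ> g) \<circ> inv_into UNIV g"
      using assms by (auto simp: fun_eq_iff)
    have 1: "h \<in> pw_stab A \<longleftrightarrow> inv_into UNIV g \<circ> h \<circ> g \<in> pw_stab A"
      using comp_pw_stab inv_pw_stab assms(2) eq by metis
    have "a (inv_into UNIV g \<circ> h \<circ> g) x = a (inv_into UNIV g) (a h (a g x))" if h: "h \<in> pw_stab A"
      using h assms inv_pw_stab[OF assms(2)] by (simp add: comp comp_pw_stab closed)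
    then have "a h (a g x) = a g x \<longleftrightarrow> a (inv_into UNIV g \<circ> h \<circ> g) x = x" if h: "h \<in> pw_stab A"
      using h assms closed inv_act by metis
    then show ?thesis using 1 by blast
  qed
  then have "h \<in> pw_stab A \<and> a h (a g x) = a g x \<longleftrightarrow> inv_into UNIV g \<circ> h \<circ> g \<in> pw_stab (support A a x)" for h
    using stab_eq[OF assms(1)] by blast
  moreover have "inv_into UNIV g \<circ> h \<circ> g \<in> pw_stab (support A a x) \<longleftrightarrow> h \<in> pw_stab (g ` support A a x)" for h
  proof -
    have "g \<circ> (inv_into UNIV g \<circ> h \<circ> g) \<circ> inv_into UNIV g = h"
      using assms by (auto simp: fun_eq_iff)
    then show ?thesis using pw_stab_conj_iff[OF g, of "inv_into UNIV g \<circ> h \<circ> g"] by simp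
  qed
  ultimately show "{h \<in> pw_stab A. a h (a g x) = a g x} = pw_stab (g ` support A a x)" by blast
qed

lemma act_eq_iff:
  assumes "x \<in> E" "g \<in> pw_stab A" "h \<in> pw_stab A"
  shows "a g x = a h x \<longleftrightarrow> (\<forall>b\<in>support A a x. g b = h b)"
proof -
  let ?k = "inv_into UNIV h \<circ> g"
  have k: "?k \<in> pw_stab A" using assms by (intro comp_pw_stab inv_pw_stab)
  have "a g x = a h x \<longleftrightarrow> a ?k x = x"
    using assms inv_pw_stab[of h A] comp[of "inv_into UNIV h" g x] closed inv_act by metis
  also have "\<dots> \<longleftrightarrow> ?k \<in> pw_stab (support A a x)" using stab_eq[OF assms(1)] k by blast
  also have "\<dots> \<longleftrightarrow> (\<forall>b\<in>support A a x. ?k b = b)" using k by (auto simp: pw_stab_def)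
  also have "\<dots> \<longleftrightarrow> (\<forall>b\<in>support A a x. g b = h b)"
    using pw_stab_inv_comp(3,4)[OF assms(3)] by (metis comp_apply)
  finally show ?thesis .
qed

text \<open>Translates \<open>g x\<close> and \<open>h x\<close> are conjugate under the smaller group \<open>G(B)\<close> as soon as each point of the
support of \<open>x\<close> is sent by \<open>g\<close> and \<open>h\<close> to the same position relative to \<open>B\<close>: the partial map fixing \<open>B\<close> and
sending \<open>g b\<close> to \<open>h b\<close> is then increasing and extends to an automorphism. There are finitely many such
relative positions; they are recorded in \<open>code\<close>.\<close>

lemma finite_orbs_orb:
  assumes x: "x \<in> E" and B: "A \<subseteq> B" "finite B"
  shows "finite (orbs B a (orb x))"
proof -
  let ?S = "support A a x"
  define code where "code g = (\<lambda>b\<in>?S. ({c \<in> B. c < g b}, {c \<in> B. c = g b}))" for g :: "real \<Rightarrow> real"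
  define o' where "o' g = (\<lambda>k. a k (a g x)) ` pw_stab B" for g
  have code: "code ` pw_stab A \<subseteq> PiE ?S (\<lambda>_. Pow B \<times> Pow B)" by (auto simp: code_def)
  have fin: "finite (code ` pw_stab A)"
    by (rule finite_subset[OF code]) (use x B finite_supp in \<open>intro finite_PiE; simp\<close>)
  have "o' g = o' h" if g: "g \<in> pw_stab A" and h: "h \<in> pw_stab A" and eq: "code g = code h" for g h
  proof -
    have c: "c < g b \<longleftrightarrow> c < h b" "c = g b \<longleftrightarrow> c = h b" if "b \<in> ?S" "c \<in> B" for b c
    proof -
      have "code g b = code h b" using eq by simp
      then have "{c \<in> B. c < g b} = {c \<in> B. c < h b}" "{c \<in> B. c = g b} = {c \<in> B. c = h b}"
        using that by (auto simp: code_def)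
      then show "c < g b \<longleftrightarrow> c < h b" "c = g b \<longleftrightarrow> c = h b" using that by blast+
    qed
    define f where "f z = (if z \<in> B then z else h (inv_into UNIV g z))" for z
    have fg: "f (g b) = h b" if "b \<in> ?S" for b
      using c(2)[OF that, of "g b"] g by (auto simp: f_def)
    have "strict_mono_on (B \<union> g ` ?S) f"
    proof (rule strict_mono_onI)
      fix y z assume yz: "y \<in> B \<union> g ` ?S" "z \<in> B \<union> g ` ?S" "y < z"
      have mono: "g b < g b' \<longleftrightarrow> h b < h b'" for b b'
        using g h by (simp add: pw_stabD(2) strict_mono_less)
      have fB: "f z = z" if "z \<in> B" for z using that by (simp add: f_def)
      from yz(1,2) show "f y < f z"
      proof (elim UnE imageE)
        fix b b' assume "y = g b" "b \<in> ?S" "z = g b'" "b' \<in> ?S"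
        then show ?thesis using yz(3) fg mono by simp
      next
        fix b assume y: "y \<in> B" and z: "z = g b" "b \<in> ?S"
        then show ?thesis using yz(3) fg fB c(1)[OF z(2) y] by simp
      next
        fix b assume z: "z \<in> B" and y: "y = g b" "b \<in> ?S"
        have "\<not> z < h b" "z \<noteq> h b" using c[OF y(2) z] yz(3) y by auto
        then show ?thesis using y z fg fB by simp
      qed (use yz fB in simp)
    qed
    with x B finite_supp obtain k where k: "k \<in> pw_stab B" "\<And>s. s \<in> B \<union> g ` ?S \<Longrightarrow> k s = f s"
      by (elim pw_stab_extend[where A=B, rotated]) (auto simp: f_def)
    have kA: "k \<in> pw_stab A" using k B pw_stab_antimono by blast
    have "a (k \<circ> g) x = a h x"
      using k fg by (subst act_eq_iff) (auto intro: comp_pw_stab kA g h x)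
    then have kx: "a k (a g x) = a h x" using comp[OF kA g x] by simp
    have "pw_action B a E" using subaction[of E B] closed B pw_stab_antimono[of A B] by blast
    then interpret B: pw_action B a E .
    have "B.orb (a h x) = B.orb (a g x)" using B.orb_act[OF k(1), of "a g x"] kx closed[OF g x] by simp
    then show ?thesis by (simp add: o'_def B.orb_def)
  qed
  then have "\<exists>F. \<forall>g\<in>pw_stab A. o' g = F (code g)"
    by (intro exI[of _ "\<lambda>c. o' (SOME h. h \<in> pw_stab A \<and> code h = c)"])
       (metis (mono_tags, lifting) someI_ex)
  then obtain F where "\<And>g. g \<in> pw_stab A \<Longrightarrow> o' g = F (code g)" by blast
  then have "orbs B a (orb x) \<subseteq> F ` code ` pw_stab A"
    by (auto simp: orbs_def orb_def o'_def)
  then show ?thesis using fin finite_surj by blast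
qed

lemma finite_orbs_refine:
  assumes "finite (orbs A a E)" and B: "A \<subseteq> B" "finite B"
  shows "finite (orbs B a E)"
proof -
  have "orbs B a E \<subseteq> (\<Union>P\<in>orbs A a E. orbs B a P)"
    unfolding orbs_def using orb_refl by (force simp: orb_def)
  moreover have "finite (orbs B a P)" if "P \<in> orbs A a E" for P
    using that finite_orbs_orb[OF _ B] by (auto simp: orbs_def orb_def)
  ultimately show ?thesis using assms(1) by (meson finite_UN finite_subset)
qed

end


section \<open>Sums over orbits\<close>

text \<open>Only used for functions that are constant on orbits, where the choice of the representative does not
matter.\<close>

definition orbit_sum :: "real set \<Rightarrow> ((real \<Rightarrow> real) \<Rightarrow> 'x \<Rightarrow> 'x) \<Rightarrow> 'x set \<Rightarrow> ('x \<Rightarrow> int) \<Rightarrow> int" where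
  "orbit_sum A a E F = (\<Sum>P\<in>orbs A a E. F (SOME x. x \<in> P))"

definition invariant_fun :: "real set \<Rightarrow> ((real \<Rightarrow> real) \<Rightarrow> 'x \<Rightarrow> 'x) \<Rightarrow> 'x set \<Rightarrow> ('x \<Rightarrow> int) \<Rightarrow> bool" where
  "invariant_fun A a E F \<longleftrightarrow> (\<forall>g\<in>pw_stab A. \<forall>x\<in>E. F (a g x) = F x)"

context pw_action
begin

lemma orbs_eq: "orbs A a E = orb ` E"
  by (simp add: orbs_def orb_def)

lemma some_in_orb:
  assumes "P \<in> orbs A a E"
  shows "(SOME x. x \<in> P) \<in> P" "(SOME x. x \<in> P) \<in> E" "P = orb (SOME x. x \<in> P)"
proof -
  obtain y where y: "y \<in> E" "P = orb y" using assms orbs_eq by auto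
  then show 1: "(SOME x. x \<in> P) \<in> P" using orb_refl by (metis someI)
  show "(SOME x. x \<in> P) \<in> E" "P = orb (SOME x. x \<in> P)"
    using 1 orb_eq[of y] orb_subset[of y] y by auto
qed

lemma invariant_some:
  assumes "invariant_fun A a E F" "P \<in> orbs A a E" "x \<in> P"
  shows "F (SOME x. x \<in> P) = F x"
proof -
  obtain y where y: "y \<in> E" "P = orb y" using assms orbs_eq by auto
  have "F z = F y" if "z \<in> P" for z using that y assms(1) by (auto simp: orb_def invariant_fun_def)
  then show ?thesis using some_in_orb(1)[OF assms(2)] assms(3) by metis
qed

lemma orbit_sum_cong: "(\<And>x. x \<in> E \<Longrightarrow> F x = F' x) \<Longrightarrow> orbit_sum A a E F = orbit_sum A a E F'"
  unfolding orbit_sum_def by (intro sum.cong) (auto dest: some_in_orb)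

lemma orbit_sum_transitive:
  assumes "x \<in> E" "E = orb x" "invariant_fun A a E F"
  shows "orbit_sum A a E F = F x"
proof -
  have "orb y = E" if "y \<in> E" for y using orb_eq[OF assms(1), of y] assms(2) that by blast
  then have "orbs A a E = {E}"
    unfolding orbs_eq using assms(1) by blast
  then show ?thesis
    using invariant_some[OF assms(3), of E x] assms(1) by (simp add: orbit_sum_def)
qed

end

lemma orbit_sum_cmult: "orbit_sum A a E (\<lambda>x. c * F x) = c * orbit_sum A a E F"
  "orbit_sum A a E (\<lambda>x. F x * c) = orbit_sum A a E F * c"
  by (simp_all add: orbit_sum_def sum_distrib_left sum_distrib_right)

lemma orbit_sum_UN:
  assumes act: "\<And>i. i \<in> I \<Longrightarrow> pw_action A a (E i)" and "finite I"
    and fin: "\<And>i. i \<in> I \<Longrightarrow> finite (orbs A a (E i))"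
    and disj: "\<And>i j. i \<in> I \<Longrightarrow> j \<in> I \<Longrightarrow> i \<noteq> j \<Longrightarrow> E i \<inter> E j = {}"
  shows "orbit_sum A a (\<Union>i\<in>I. E i) F = (\<Sum>i\<in>I. orbit_sum A a (E i) F)"
proof -
  have "orbs A a (\<Union>i\<in>I. E i) = (\<Union>i\<in>I. orbs A a (E i))" by (auto simp: orbs_def)
  moreover have "orbs A a (E i) \<inter> orbs A a (E j) = {}" if "i \<in> I" "j \<in> I" "i \<noteq> j" for i j
  proof -
    interpret i: pw_action A a "E i" by (rule act) fact
    interpret j: pw_action A a "E j" by (rule act) fact
    show ?thesis
    proof (rule ccontr)
      assume "orbs A a (E i) \<inter> orbs A a (E j) \<noteq> {}"
      then obtain P where "P \<in> orbs A a (E i)" "P \<in> orbs A a (E j)" by blast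
      then show False using i.some_in_orb(2) j.some_in_orb(2) disj[OF that] by blast
    qed
  qed
  ultimately show ?thesis
    unfolding orbit_sum_def using assms by (simp add: sum.UNION_disjoint)
qed

lemma orbit_sum_Un:
  assumes "pw_action A a E" "pw_action A a Y" "finite (orbs A a E)" "finite (orbs A a Y)" "E \<inter> Y = {}"
  shows "orbit_sum A a (E \<union> Y) F = orbit_sum A a E F + orbit_sum A a Y F"
proof -
  have "orbit_sum A a (\<Union>b\<in>UNIV. if b then E else Y) F = (\<Sum>b\<in>UNIV. orbit_sum A a (if b then E else Y) F)"
    by (rule orbit_sum_UN) (use assms in auto)
  then show ?thesis by (simp add: UNIV_bool Un_commute)
qed

lemma orbs_transport:
  assumes f: "\<And>g x. g \<in> pw_stab A \<Longrightarrow> x \<in> E \<Longrightarrow> f (a g x) = b g (f x)"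
  shows "orbs A b (f ` E) = (`) f ` orbs A a E"
  using f by (simp add: orbs_def image_image)

lemma orbit_sum_transport:
  assumes act: "pw_action A a E" and bij: "bij_betw f E Y"
    and f: "\<And>g x. g \<in> pw_stab A \<Longrightarrow> x \<in> E \<Longrightarrow> f (a g x) = b g (f x)"
    and F: "invariant_fun A a E F" "\<And>x. x \<in> E \<Longrightarrow> F' (f x) = F x"
  shows "orbit_sum A b Y F' = orbit_sum A a E F"
proof -
  interpret pw_action A a E by fact
  have Y: "Y = f ` E" using bij by (simp add: bij_betw_def)
  have inj: "inj_on ((`) f) (orbs A a E)"
  proof (rule inj_onI)
    fix P Q assume "P \<in> orbs A a E" "Q \<in> orbs A a E" "f ` P = f ` Q"
    moreover have "P \<subseteq> E" "Q \<subseteq> E" using calculation orb_subset by (auto simp: orbs_eq)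
    ultimately show "P = Q" using bij inj_on_image_eq_iff[of f E P Q] by (auto simp: bij_betw_def)
  qed
  have "F' (SOME y. y \<in> f ` P) = F (SOME x. x \<in> P)" if P: "P \<in> orbs A a E" for P
  proof -
    have "(SOME y. y \<in> f ` P) \<in> f ` P" by (rule someI[of _ "f (SOME x. x \<in> P)"]) (use some_in_orb[OF P] in blast)
    then obtain x where x: "x \<in> P" "(SOME y. y \<in> f ` P) = f x" by blast
    moreover have "x \<in> E" using P x orb_subset by (auto simp: orbs_eq)
    ultimately show ?thesis using F(2) invariant_some[OF F(1) P x(1)] by simp
  qed
  moreover have "orbs A b (f ` E) = (`) f ` orbs A a E" by (rule orbs_transport) (rule f)
  ultimately show ?thesis
    unfolding orbit_sum_def Y by (simp add: sum.reindex[OF inj])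
qed

text \<open>The orbits over a given orbit of \<open>Y\<close> correspond to the orbits of the stabilizer of a point \<open>y\<close> on the
fibre over \<open>y\<close>: an orbit corresponds to its intersection with the fibre. Here \<open>t y\<close> is a finite set
that describes this stabilizer.\<close>

lemma orbit_sum_fubini:
  assumes E: "pw_action A a E" and Y: "pw_action A b Y"
    and finX: "finite (orbs A a E)" and finY: "finite (orbs A b Y)"
    and f: "\<And>x. x \<in> E \<Longrightarrow> f x \<in> Y" "\<And>g x. g \<in> pw_stab A \<Longrightarrow> x \<in> E \<Longrightarrow> f (a g x) = b g (f x)"
    and t: "\<And>y. y \<in> Y \<Longrightarrow> {g \<in> pw_stab A. b g y = y} = pw_stab (t y)"
    and F: "invariant_fun A a E F"
  shows "orbit_sum A a E F = orbit_sum A b Y (\<lambda>y. orbit_sum (t y) a {x \<in> E. f x = y} F)"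
proof -
  interpret E: pw_action A a E by fact
  interpret Y: pw_action A b Y by fact
  have forb: "f x \<in> Y.orb y \<longleftrightarrow> (\<exists>x'\<in>E.orb x. f x' = y)" if x: "x \<in> E" and y: "y \<in> Y" for x y
  proof
    assume "f x \<in> Y.orb y"
    then have "y \<in> Y.orb (f x)" using Y.orb_eq[OF y] Y.orb_refl[OF y] by blast
    then show "\<exists>x'\<in>E.orb x. f x' = y" using x f by (auto simp: Y.orb_def E.orb_def)
  next
    assume "\<exists>x'\<in>E.orb x. f x' = y"
    then have "y \<in> Y.orb (f x)" using x f by (auto simp: Y.orb_def E.orb_def)
    then show "f x \<in> Y.orb y" using Y.orb_eq[of "f x" y] Y.orb_refl[of "f x"] f x by blast
  qed
  define above where "above Q = {P \<in> orbs A a E. \<exists>x\<in>P. f x \<in> Q}" for Q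
  have f_orb: "f x' \<in> Y.orb (f x)" if "x \<in> E" "x' \<in> E.orb x" for x x'
    using that f by (auto simp: Y.orb_def E.orb_def)
  have "P \<in> above (Y.orb (f (SOME x. x \<in> P)))" if "P \<in> orbs A a E" for P
    using E.some_in_orb[OF that] Y.orb_refl f(1) that by (auto simp: above_def)
  then have eq: "orbs A a E = (\<Union>Q\<in>orbs A b Y. above Q)"
    using E.some_in_orb(2) f(1) by (fastforce simp: above_def Y.orbs_eq)
  have disj: "above Q \<inter> above Q' = {}" if Q: "Q \<in> orbs A b Y" "Q' \<in> orbs A b Y" "Q \<noteq> Q'" for Q Q'
  proof (rule ccontr)
    assume "above Q \<inter> above Q' \<noteq> {}"
    then obtain x x1 x2 where x: "x \<in> E" "x1 \<in> E.orb x" "x2 \<in> E.orb x" "f x1 \<in> Q" "f x2 \<in> Q'"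
      by (auto simp: above_def E.orbs_eq)
    then have "Y.orb (f x1) = Y.orb (f x)" "Y.orb (f x2) = Y.orb (f x)"
      using f_orb Y.orb_eq f(1) by blast+
    moreover have "Q = Y.orb (f x1)" "Q' = Y.orb (f x2)"
      using Q(1,2) x(4,5) Y.orb_eq unfolding Y.orbs_eq by blast+
    ultimately show False using Q(3) by blast
  qed
  have "orbit_sum A a E F = (\<Sum>Q\<in>orbs A b Y. \<Sum>P\<in>above Q. F (SOME x. x \<in> P))"
    unfolding orbit_sum_def
    by (subst eq, rule sum.UNION_disjoint) (use finX finY disj in \<open>auto simp: above_def\<close>)
  also have "\<dots> = orbit_sum A b Y (\<lambda>y. orbit_sum (t y) a {x \<in> E. f x = y} F)"
    unfolding orbit_sum_def[of A b]
  proof (rule sum.cong[OF refl])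
    fix Q assume Q: "Q \<in> orbs A b Y"
    define y where "y = (SOME y. y \<in> Q)"
    have y: "y \<in> Y" "Q = Y.orb y" using Y.some_in_orb[OF Q] by (auto simp: y_def)
    let ?Z = "{x \<in> E. f x = y}"
    have ty: "pw_stab (t y) \<subseteq> pw_stab A" using t[OF y(1)] by blast
    interpret Z: pw_action "t y" a ?Z
    proof
      fix g h x assume g: "g \<in> pw_stab (t y)" and x: "x \<in> ?Z"
      then have "g \<in> pw_stab A" "b g y = y" using t[OF y(1)] by blast+
      then show "a g x \<in> ?Z" using x E.closed f by auto
      show "a (g \<circ> h) x = a g (a h x)" if "h \<in> pw_stab (t y)"
        using E.comp g that x ty by blast
    qed (use E.one in auto)
    have Zorb: "Z.orb x = E.orb x \<inter> ?Z" if x: "x \<in> ?Z" for x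
    proof
      show "Z.orb x \<subseteq> E.orb x \<inter> ?Z" using Z.orb_subset[OF x] ty by (auto simp: Z.orb_def E.orb_def)
      show "E.orb x \<inter> ?Z \<subseteq> Z.orb x"
      proof
        fix x' assume x': "x' \<in> E.orb x \<inter> ?Z"
        then obtain g where g: "g \<in> pw_stab A" "x' = a g x" by (auto simp: E.orb_def)
        then have "b g y = y" using f x x' by auto
        then show "x' \<in> Z.orb x" using g t[OF y(1)] by (auto simp: Z.orb_def)
      qed
    qed
    have above: "above Q = E.orb ` ?Z"
    proof
      show "above Q \<subseteq> E.orb ` ?Z"
      proof
        fix P assume "P \<in> above Q"
        then obtain x x1 where x: "x \<in> E" "P = E.orb x" "x1 \<in> P" "f x1 \<in> Y.orb y"
          by (auto simp: above_def E.orbs_eq y(2))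
        then have x1: "x1 \<in> E" "E.orb x1 = P" using E.orb_subset[OF x(1)] E.orb_eq[OF x(1)] by blast+
        then obtain x2 where "x2 \<in> P" "f x2 = y" using forb[OF x1(1) y(1)] x by blast
        then show "P \<in> E.orb ` ?Z" using x E.orb_subset E.orb_eq by blast
      qed
      show "E.orb ` ?Z \<subseteq> above Q"
        unfolding above_def E.orbs_eq y(2) using E.orb_refl Y.orb_refl y by blast
    qed
    have inj: "inj_on (\<lambda>P. P \<inter> ?Z) (above Q)"
    proof (rule inj_onI)
      fix P P' assume "P \<in> above Q" "P' \<in> above Q" and eq: "P \<inter> ?Z = P' \<inter> ?Z"
      then obtain x x' where x: "x \<in> ?Z" "P = E.orb x" and x': "x' \<in> ?Z" "P' = E.orb x'"
        unfolding above by blast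
      have "x \<in> E.orb x'" using eq x x' E.orb_refl by blast
      then show "P = P'" using x x' E.orb_eq by blast
    qed
    have img: "(\<lambda>P. P \<inter> ?Z) ` above Q = orbs (t y) a ?Z"
      unfolding above Z.orbs_eq image_image using Zorb by (intro image_cong) auto
    have val: "F (SOME x. x \<in> P) = F (SOME x. x \<in> P \<inter> ?Z)" if "P \<in> above Q" for P
    proof -
      obtain x where x: "x \<in> ?Z" "P = E.orb x" using \<open>P \<in> above Q\<close> above by blast
      then have "(SOME x. x \<in> P \<inter> ?Z) \<in> P \<inter> ?Z" using E.orb_refl by (metis (mono_tags, lifting) IntI someI mem_Collect_eq)
      then show ?thesis using E.invariant_some[OF F, of P] that by (auto simp: above_def)
    qed
    have "orbit_sum (t y) a ?Z F = (\<Sum>P\<in>above Q. F (SOME x. x \<in> P \<inter> ?Z))"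
      unfolding orbit_sum_def img[symmetric] sum.reindex[OF inj] o_def ..
    also have "\<dots> = (\<Sum>P\<in>above Q. F (SOME x. x \<in> P))"
      by (rule sum.cong[OF refl]) (rule val[symmetric])
    finally have "(\<Sum>P\<in>above Q. F (SOME x. x \<in> P)) = orbit_sum (t y) a ?Z F" ..
    then show "(\<Sum>P\<in>above Q. F (SOME x. x \<in> P)) = orbit_sum (t (SOME y. y \<in> Q)) a {x \<in> E. f x = (SOME y. y \<in> Q)} F"
      by (simp add: y_def)
  qed
  finally show ?thesis .
qed


section \<open>Weights of coset spaces\<close>

text \<open>The value of the future homomorphism on \<open>G(A)/G(B)\<close> for nonempty \<open>A \<subseteq> B\<close>. The two exceptional conditions
say that some point of \<open>B\<close> lies in the left, respectively right, interval of the complement of \<open>A\<close>.\<close>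

definition weight :: "int \<Rightarrow> int \<Rightarrow> real set \<Rightarrow> real set \<Rightarrow> int" where
  "weight \<epsilon> \<delta> A B = (if \<epsilon> = 0 \<and> (\<exists>b\<in>B. \<forall>a\<in>A. b < a) \<or> \<delta> = 0 \<and> (\<exists>b\<in>B. \<forall>a\<in>A. a < b) then 0
     else (-1) ^ card (B - A))"

lemma weight_refl: "A \<noteq> {} \<Longrightarrow> weight \<epsilon> \<delta> A A = 1"
  unfolding weight_def by auto

text \<open>If \<open>B\<close> has a point to the left of \<open>A\<close>, then either \<open>C\<close> has one too, or that point lies to the left
of \<open>C\<close>. So exactly the zero cases match, and otherwise cardinalities add up.\<close>

lemma weight_chain:
  assumes "finite B" "A \<subseteq> C" "C \<subseteq> B"
  shows "weight \<epsilon> \<delta> A B = weight \<epsilon> \<delta> A C * weight \<epsilon> \<delta> C B"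
proof -
  have l: "(\<exists>b\<in>B. \<forall>a\<in>A. b < a) \<longleftrightarrow> (\<exists>b\<in>C. \<forall>a\<in>A. b < a) \<or> (\<exists>b\<in>B. \<forall>a\<in>C. b < a)"
    using assms(2,3) by (meson le_less_trans not_less subsetD)
  have r: "(\<exists>b\<in>B. \<forall>a\<in>A. a < b) \<longleftrightarrow> (\<exists>b\<in>C. \<forall>a\<in>A. a < b) \<or> (\<exists>b\<in>B. \<forall>a\<in>C. a < b)"
    using assms(2,3) by (meson less_le_trans not_less subsetD)
  have card: "card (B - A) = card (C - A) + card (B - C)"
  proof -
    have "B - A = (C - A) \<union> (B - C)" using assms by blast
    moreover have "finite C" using assms finite_subset by blast
    moreover have "(C - A) \<inter> (B - C) = {}" by blast
    moreover have "finite (C - A)" "finite (B - C)" using \<open>finite C\<close> assms by auto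
    ultimately show ?thesis using card_Un_disjoint[of "C - A" "B - C"] by metis
  qed
  have if_or: "(if p \<and> (p1 \<or> p2) \<or> q \<and> (q1 \<or> q2) then 0 else x * y) =
      (if p \<and> p1 \<or> q \<and> q1 then 0 else x) * (if p \<and> p2 \<or> q \<and> q2 then 0 else y)"
    for p p1 p2 q q1 q2 and x y :: int by auto
  show ?thesis unfolding weight_def l r card power_add by (rule if_or)
qed

lemma weight_image:
  assumes "g \<in> pw_stab C"
  shows "weight \<epsilon> \<delta> (g ` A) (g ` B) = weight \<epsilon> \<delta> A B"
proof -
  have "g ` B - g ` A = g ` (B - A)" using pw_stabD(1)[OF assms] by (simp add: image_set_diff bij_is_inj)
  moreover have "card (g ` (B - A)) = card (B - A)"
    using pw_stabD(1)[OF assms] by (intro card_image) (auto simp: bij_def intro: inj_on_subset)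
  ultimately show ?thesis
    using strict_mono_less[OF pw_stabD(2)[OF assms]] by (simp add: weight_def)
qed

lemma weight_insert:
  assumes "b \<notin> A"
  shows "weight \<epsilon> \<delta> A (insert b A) =
    (if \<epsilon> = 0 \<and> (\<forall>a\<in>A. b < a) \<or> \<delta> = 0 \<and> (\<forall>a\<in>A. a < b) then 0 else -1)"
proof -
  have "insert b A - A = {b}" using assms by blast
  moreover have "(\<exists>x\<in>insert b A. \<forall>a\<in>A. x < a) \<longleftrightarrow> (\<forall>a\<in>A. b < a)"
    "(\<exists>x\<in>insert b A. \<forall>a\<in>A. a < x) \<longleftrightarrow> (\<forall>a\<in>A. a < b)" by auto
  ultimately show ?thesis unfolding weight_def by simp
qed


section \<open>Cutting an interval at a point\<close>

text \<open>The interval of the complement of \<open>A\<close> that contains \<open>b\<close>, for \<open>b\<close> outside \<open>A\<close>.\<close>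

definition cell :: "real set \<Rightarrow> real \<Rightarrow> real set" where
  "cell A b = (\<lambda>g. g b) ` pw_stab A"

lemma mem_cell: "finite A \<Longrightarrow> b \<notin> A \<Longrightarrow> t \<in> cell A b \<longleftrightarrow> t \<notin> A \<and> (\<forall>a\<in>A. a < b \<longleftrightarrow> a < t)"
  using pw_stab_orbit_point[of A b t] by (auto simp: cell_def)

lemma self_cell: "b \<in> cell A b"
  unfolding cell_def by (rule image_eqI[of _ _ id]) auto

lemma point_stab: "{g \<in> pw_stab A. g y = y} = pw_stab (insert y A)"
  by (auto simp: pw_stab_def)

lemma cell_smooth:
  assumes "finite A"
  shows "smooth_action A (\<lambda>g. g) (cell A b)"
proof
  fix g x assume "g \<in> pw_stab A" "x \<in> cell A b"
  then obtain h where "h \<in> pw_stab A" "x = h b" by (auto simp: cell_def)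
  then show "g x \<in> cell A b"
    unfolding cell_def using comp_pw_stab[OF \<open>g \<in> pw_stab A\<close>] by (intro image_eqI[of _ _ "g \<circ> h"]) auto
next
  fix x show "\<exists>B. finite B \<and> A \<subseteq> B \<and> (\<forall>g\<in>pw_stab B. g x = x)"
    using assms by (intro exI[of _ "insert x A"]) (auto simp: pw_stab_def)
qed (use assms in auto)

lemma orbit_sum_cell_one:
  assumes A: "finite A" and b: "b \<notin> A"
    and F: "invariant_fun A (\<lambda>g. g) (cell A b) F"
  shows "orbit_sum A (\<lambda>g. g) (cell A b) F = F b"
proof -
  interpret smooth_action A "\<lambda>g. g" "cell A b" by (rule cell_smooth) fact
  show ?thesis
    by (rule orbit_sum_transitive) (use F self_cell in \<open>auto simp: orb_def cell_def\<close>)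
qed

lemma weight_point_invariant: "invariant_fun A (\<lambda>g. g) S (\<lambda>y. weight \<epsilon> \<delta> A (insert y A))"
  unfolding invariant_fun_def
proof (intro ballI)
  fix g y assume g: "g \<in> pw_stab A"
  then have "g ` A = A" by (force simp: pw_stab_def)
  then show "weight \<epsilon> \<delta> A (insert (g y) A) = weight \<epsilon> \<delta> A (insert y A)"
    using weight_image[OF g, of \<epsilon> \<delta> A "insert y A"] by simp
qed

text \<open>One more fixed point \<open>c\<close> either does not meet the interval of \<open>b\<close>, and then nothing changes, or it cuts
the interval into two intervals and the point \<open>c\<close> itself. In the second case the weights add up because
\<open>-1 = (-1) + 1 + (-1)\<close> for an interval of weight \<open>-1\<close> and \<open>0 = 0 + 1 + (-1)\<close> for an end interval of weight \<open>0\<close>: of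
its two pieces one is an end interval of the same side and the other a middle interval.\<close>

lemma weight_split_point:
  assumes A: "finite A" "A \<noteq> {}" and b: "b \<notin> A" and c: "c \<notin> A"
  shows "orbit_sum (insert c A) (\<lambda>g. g) (cell A b) (\<lambda>y. weight \<epsilon> \<delta> (insert c A) (insert y (insert c A)))
    = weight \<epsilon> \<delta> A (insert b A)"
proof (cases "c \<in> cell A b")
  case False
  have *: "(a < b \<longleftrightarrow> a < t) \<longrightarrow> (c < b \<longleftrightarrow> c < t)" if "a \<in> A" "(a < b) \<noteq> (a < c)" for a t
    using that c by (metis less_trans linorder_neqE_linordered_idom)
  obtain a0 where a0: "a0 \<in> A" "(a0 < b) \<noteq> (a0 < c)" using False mem_cell[OF A(1) b] c by blast
  have nb: "b \<notin> insert c A" using b a0 by auto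
  have cell_eq: "cell A b = cell (insert c A) b"
  proof (rule Set.set_eqI)
    fix t
    have "c \<noteq> t" if "a0 < b \<longleftrightarrow> a0 < t" using a0 that by auto
    then show "t \<in> cell A b \<longleftrightarrow> t \<in> cell (insert c A) b"
      using *[OF a0, of t] a0(1) A by (subst (1 2) mem_cell) (use b nb in auto)
  qed
  have "orbit_sum (insert c A) (\<lambda>g. g) (cell A b) (\<lambda>y. weight \<epsilon> \<delta> (insert c A) (insert y (insert c A)))
      = weight \<epsilon> \<delta> (insert c A) (insert b (insert c A))"
    unfolding cell_eq by (rule orbit_sum_cell_one) (use A nb weight_point_invariant in auto)
  also have "\<dots> = weight \<epsilon> \<delta> A (insert b A)"
  proof -
    have "b < c" if "\<forall>a\<in>A. b < a" using that a0 by force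
    moreover have "c < b" if "\<forall>a\<in>A. a < b" using that a0 by force
    ultimately show ?thesis using weight_insert[OF nb] weight_insert[OF b] by auto
  qed
  finally show ?thesis .
next
  case True
  let ?C = "insert c A" and ?F = "\<lambda>y. weight \<epsilon> \<delta> (insert c A) (insert y (insert c A))"
  have cb: "a < b \<longleftrightarrow> a < c" if "a \<in> A" for a using True that mem_cell[OF A(1) b] by blast
  \<comment> \<open>representatives \<open>u\<close> and \<open>v\<close> of the pieces on the two sides of \<open>c\<close>\<close>
  obtain u where u: "u < c" "\<And>s. s \<in> A \<Longrightarrow> s < c \<Longrightarrow> s < u" using exists_between_finite(1)[OF A(1)] by blast
  obtain v where v: "c < v" "\<And>s. s \<in> A \<Longrightarrow> c < s \<Longrightarrow> v < s" using exists_between_finite(2)[OF A(1)] by blast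
  have uA: "u \<notin> ?C" using u by auto
  have vA: "v \<notin> ?C" using v by auto
  have ord: "a < u \<longleftrightarrow> a < c" "u < a \<longleftrightarrow> c < a" "a < v \<longleftrightarrow> a < c" "v < a \<longleftrightarrow> c < a" if "a \<in> A" for a
    using u(1) u(2)[OF that] v(1) v(2)[OF that] that c by (metis less_trans not_less_iff_gr_or_eq)+
  have ct: "t \<in> cell A b \<longleftrightarrow> t \<notin> A \<and> (\<forall>a\<in>A. a < c \<longleftrightarrow> a < t)" for t
    using mem_cell[OF A(1) b, of t] cb by simp
  have cu: "t \<in> cell ?C u \<longleftrightarrow> t \<in> cell A b \<and> t < c" for t
  proof -
    have "(\<forall>a\<in>A. a < u \<longleftrightarrow> a < t) \<longleftrightarrow> (\<forall>a\<in>A. a < c \<longleftrightarrow> a < t)" using ord(1) by blast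
    then have "t \<in> cell ?C u \<longleftrightarrow> t \<notin> ?C \<and> \<not> c < t \<and> (\<forall>a\<in>A. a < c \<longleftrightarrow> a < t)"
      using mem_cell[of ?C u t] uA A(1) u(1) by simp
    then show ?thesis using ct[of t] by (auto simp: not_less)
  qed
  have cv: "t \<in> cell ?C v \<longleftrightarrow> t \<in> cell A b \<and> c < t" for t
  proof -
    have "(\<forall>a\<in>A. a < v \<longleftrightarrow> a < t) \<longleftrightarrow> (\<forall>a\<in>A. a < c \<longleftrightarrow> a < t)" using ord(3) by blast
    then have "t \<in> cell ?C v \<longleftrightarrow> t \<notin> ?C \<and> c < t \<and> (\<forall>a\<in>A. a < c \<longleftrightarrow> a < t)"
      using mem_cell[of ?C v t] vA A(1) v(1) by simp
    then show ?thesis using ct[of t] by auto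
  qed
  have un: "cell A b = {c} \<union> (cell ?C u \<union> cell ?C v)" using cu cv True by force
  interpret u: smooth_action ?C "\<lambda>g. g" "cell ?C u" by (rule cell_smooth) (use A in simp)
  interpret v: smooth_action ?C "\<lambda>g. g" "cell ?C v" by (rule cell_smooth) (use A in simp)
  have c_eq: "cell ?C c = {c}" using self_cell[of c ?C] by (auto simp: cell_def pw_stab_def)
  interpret c: smooth_action ?C "\<lambda>g. g" "{c}" using cell_smooth[of ?C c] A c_eq by simp
  have fin: "finite (orbs ?C (\<lambda>g. g) (cell ?C w))" for w
    using smooth_action.finite_orbs_orb[OF cell_smooth self_cell[of w ?C] subset_refl] A
      pw_action.orb_def[OF smooth_action.axioms(1)[OF cell_smooth[of ?C w]]]
    by (simp add: cell_def)
  have "orbit_sum ?C (\<lambda>g. g) (cell A b) ?F = orbit_sum ?C (\<lambda>g. g) {c} ?F +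
      (orbit_sum ?C (\<lambda>g. g) (cell ?C u) ?F + orbit_sum ?C (\<lambda>g. g) (cell ?C v) ?F)"
  proof -
    have "orbit_sum ?C (\<lambda>g. g) (cell ?C u \<union> cell ?C v) ?F =
        orbit_sum ?C (\<lambda>g. g) (cell ?C u) ?F + orbit_sum ?C (\<lambda>g. g) (cell ?C v) ?F"
      by (rule orbit_sum_Un) (use cu cv fin u.pw_action_axioms v.pw_action_axioms in auto)
    moreover have "pw_action ?C (\<lambda>g. g) (cell ?C u \<union> cell ?C v)"
      by unfold_locales (use u.closed v.closed in auto)
    moreover have "finite (orbs ?C (\<lambda>g. g) (cell ?C u \<union> cell ?C v))"
      using fin by (simp add: orbs_def image_Un)
    moreover have "finite (orbs ?C (\<lambda>g. g) {c})" by (simp add: orbs_def)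
    ultimately show ?thesis unfolding un
      by (subst orbit_sum_Un) (use cu cv c.pw_action_axioms in auto)
  qed
  also have "orbit_sum ?C (\<lambda>g. g) {c} ?F = 1"
    using c.orbit_sum_transitive[of c ?F] weight_point_invariant[of ?C "{c}"] weight_refl[of ?C] c_eq
    by (auto simp: c.orb_def cell_def)
  also have "orbit_sum ?C (\<lambda>g. g) (cell ?C u) ?F = ?F u"
    by (rule orbit_sum_cell_one) (use A uA weight_point_invariant in auto)
  also have "orbit_sum ?C (\<lambda>g. g) (cell ?C v) ?F = ?F v"
    by (rule orbit_sum_cell_one) (use A vA weight_point_invariant in auto)
  also have "1 + (?F u + ?F v) = weight \<epsilon> \<delta> A (insert b A)"
  proof -
    have l: "(\<forall>a\<in>A. b < a) \<longleftrightarrow> (\<forall>a\<in>A. c < a)" using cb b c by (metis linorder_cases less_asym)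
    have r: "(\<forall>a\<in>A. a < b) \<longleftrightarrow> (\<forall>a\<in>A. a < c)" using cb by blast
    have lr: "\<not> ((\<forall>a\<in>A. c < a) \<and> (\<forall>a\<in>A. a < c))" using A(2) by force
    have C: "(\<forall>a\<in>?C. u < a) \<longleftrightarrow> (\<forall>a\<in>A. c < a)" "\<not> (\<forall>a\<in>?C. a < u)"
      "(\<forall>a\<in>?C. a < v) \<longleftrightarrow> (\<forall>a\<in>A. a < c)" "\<not> (\<forall>a\<in>?C. v < a)"
      using ord u(1) v(1) by auto
    have cases: "1 + ((if p \<and> p1 \<or> q \<and> False then 0 else - 1) + (if p \<and> False \<or> q \<and> q1 then 0 else - 1)) =
        (if p \<and> p1 \<or> q \<and> q1 then 0 else - 1 :: int)" if "\<not> (p1 \<and> q1)" for p p1 q q1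
      using that by auto
    show ?thesis
      unfolding weight_insert[OF uA] weight_insert[OF vA] weight_insert[OF b] l r
      using cases[OF lr, of "\<epsilon> = 0" "\<delta> = 0"] C by (simp only: simp_thms)
  qed
  finally show ?thesis .
qed


section \<open>The Euler characteristic of a smooth action\<close>

definition euler :: "int \<Rightarrow> int \<Rightarrow> real set \<Rightarrow> ((real \<Rightarrow> real) \<Rightarrow> 'x \<Rightarrow> 'x) \<Rightarrow> 'x set \<Rightarrow> int" where
  "euler \<epsilon> \<delta> A a E = orbit_sum A a E (\<lambda>x. weight \<epsilon> \<delta> A (support A a x))"

context smooth_action
begin

lemma weight_supp_invariant: "invariant_fun A a E (\<lambda>x. weight \<epsilon> \<delta> A (support A a x))"
  unfolding invariant_fun_def
proof (intro ballI)
  fix g x assume g: "g \<in> pw_stab A" and x: "x \<in> E"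
  then have "g ` A = A" by (force simp: pw_stab_def)
  then show "weight \<epsilon> \<delta> A (support A a (a g x)) = weight \<epsilon> \<delta> A (support A a x)"
    using weight_image[OF g, of \<epsilon> \<delta> A "support A a x"] support_act[OF x g] by simp
qed

lemma euler_transitive: "x \<in> E \<Longrightarrow> E = orb x \<Longrightarrow> euler \<epsilon> \<delta> A a E = weight \<epsilon> \<delta> A (support A a x)"
  unfolding euler_def by (rule orbit_sum_transitive) (use weight_supp_invariant in auto)

lemma refine_smooth: "A \<subseteq> B \<Longrightarrow> finite B \<Longrightarrow> smooth_action B a E"
  by (rule restrict_smooth) (use closed pw_stab_antimono[of A B] in auto)

end

text \<open>Independence of \<open>A\<close> for one orbit and one additional point \<open>c\<close>, by induction on the number of points of
the support outside \<open>A\<close>. Such a point \<open>b\<close> defines an equivariant map of the orbit onto the interval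
of \<open>b\<close>, sending \<open>g x0\<close> to \<open>g b\<close>. On the fibres, where \<open>b\<close> is fixed as well, the induction hypothesis
applies; the base of this map is the interval, where the claim is the splitting rule for a single interval.\<close>

lemma euler_transitive_insert:
  assumes "smooth_action A a E" "A \<noteq> {}" "x0 \<in> E" "E = (\<lambda>g. a g x0) ` pw_stab A"
  shows "euler \<epsilon> \<delta> (insert c A) a E = weight \<epsilon> \<delta> A (support A a x0)"
  using assms
proof (induction "card (support A a x0 - A)" arbitrary: A E x0 rule: less_induct)
  case less
  interpret smooth_action A a E by fact
  let ?B = "support A a x0" and ?C = "insert c A"
  note x0 = less.prems(3) and A = less.prems(2) and trans = less.prems(4)
  have B: "finite ?B" "A \<subseteq> ?B" using finite_supp support_supset x0 by auto
  interpret C: smooth_action ?C a E by (rule refine_smooth) (use finite_A in auto)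
  have suppC: "support ?C a x = ?C \<union> support A a x" if "x \<in> E" for x
    by (rule support_restrict) (use that finite_A in auto)
  consider "c \<in> A" | "?B = A" | b where "c \<notin> A" "b \<in> ?B" "b \<notin> A" using B by blast
  then show ?case
  proof cases
    case 1
    then show ?thesis using euler_transitive[OF x0] trans by (simp add: insert_absorb orb_def)
  next
    case 2
    have "a g x0 = x0" if "g \<in> pw_stab A" for g using support_fixes[OF x0] 2 that by simp
    then have "E = {x0}" using trans by (auto intro: id_pw_stab(1))
    moreover have "C.orb x0 = {x0}"
      using C.support_fixes[OF x0] suppC[OF x0] 2 C.orb_refl[OF x0] by (auto simp: C.orb_def insert_absorb)
    ultimately show ?thesis
      using C.euler_transitive[OF x0] suppC[OF x0] 2 A weight_refl[of ?C] weight_refl[of A] by (simp add: Un_absorb2)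
  next
    case 3
    then have b: "b \<in> ?B" "b \<notin> A" and c: "c \<notin> A" by auto
    \<comment> \<open>well defined because elements with the same effect on \<open>x0\<close> agree on its support, which contains \<open>b\<close>\<close>
    define f where "f x = (SOME g. g \<in> pw_stab A \<and> a g x0 = x) b" for x
    have f: "f (a g x0) = g b" if g: "g \<in> pw_stab A" for g
    proof -
      define h where "h = (SOME h. h \<in> pw_stab A \<and> a h x0 = a g x0)"
      have "h \<in> pw_stab A \<and> a h x0 = a g x0" unfolding h_def by (rule someI[of _ g]) (use g in simp)
      then have "h b = g b" using act_eq_iff[OF x0, of h g] g b by blast
      then show ?thesis by (simp add: f_def h_def)
    qed
    have f_act: "f (a g x) = g (f x)" if g: "g \<in> pw_stab A" and x: "x \<in> E" for g x
    proof -
      obtain h where h: "h \<in> pw_stab A" "x = a h x0" using x trans by blast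
      then have "f (a g x) = f (a (g \<circ> h) x0)" using comp[OF g h(1) x0] by simp
      then show ?thesis using f[of "g \<circ> h"] f[OF h(1)] h g by (simp add: comp_pw_stab)
    qed
    have f_cell: "f x \<in> cell A b" if x: "x \<in> E" for x
      using x f trans by (auto simp: cell_def)
    have f_supp: "f x \<in> support A a x" if x: "x \<in> E" for x
    proof -
      obtain h where h: "h \<in> pw_stab A" "x = a h x0" using x trans by blast
      then show ?thesis using f[OF h(1)] support_act[OF x0 h(1)] b by simp
    qed
    interpret cell: smooth_action A "\<lambda>g. g" "cell A b" by (rule cell_smooth) (rule finite_A)
    have CA: "pw_stab ?C \<subseteq> pw_stab A" by (rule pw_stab_antimono) blast
    let ?F = "\<lambda>x. weight \<epsilon> \<delta> ?C (support ?C a x)"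
    have "euler \<epsilon> \<delta> ?C a E = orbit_sum ?C (\<lambda>g. g) (cell A b)
        (\<lambda>y. orbit_sum (insert y ?C) a {x \<in> E. f x = y} ?F)"
      unfolding euler_def
    proof (rule orbit_sum_fubini)
      show "pw_action ?C a E" by (rule C.pw_action_axioms)
      show "pw_action ?C (\<lambda>g. g) (cell A b)"
        by (rule cell.subaction) (use cell.closed CA in auto)
      show "finite (orbs ?C a E)"
        using finite_orbs_orb[OF x0, of ?C] finite_A trans by (auto simp: orb_def)
      show "finite (orbs ?C (\<lambda>g. g) (cell A b))"
        using cell.finite_orbs_orb[OF self_cell, of ?C] finite_A by (auto simp: cell.orb_def cell_def)
      show "f (a g x) = g (f x)" if "g \<in> pw_stab ?C" "x \<in> E" for g x using f_act CA that by blast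
      show "invariant_fun ?C a E ?F" by (rule C.weight_supp_invariant)
    qed (use f_cell point_stab in auto)
    also have "\<dots> = orbit_sum ?C (\<lambda>g. g) (cell A b) (\<lambda>y. weight \<epsilon> \<delta> ?C (insert y ?C) * weight \<epsilon> \<delta> (insert b A) ?B)"
    proof (rule pw_action.orbit_sum_cong)
      show "pw_action ?C (\<lambda>g. g) (cell A b)"
        by (rule cell.subaction) (use cell.closed CA in auto)
      fix y assume y: "y \<in> cell A b"
      then obtain h where h: "h \<in> pw_stab A" "y = h b" by (auto simp: cell_def)
      let ?x1 = "a h x0" and ?E = "{x \<in> E. f x = y}"
      have x1: "?x1 \<in> ?E" using h closed x0 f by auto
      have yA: "pw_stab (insert y A) \<subseteq> pw_stab A" by (rule pw_stab_antimono) blast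
      interpret y: smooth_action "insert y A" a ?E
      proof (rule restrict_smooth)
        fix g x assume g: "g \<in> pw_stab (insert y A)" and x: "x \<in> ?E"
        then have "g \<in> pw_stab A" "g y = y" using yA by (auto simp: pw_stab_def)
        then show "a g x \<in> ?E" using x closed f_act by auto
      qed (use finite_A in auto)
      have tr: "?E = (\<lambda>g. a g ?x1) ` pw_stab (insert y A)"
      proof
        show "(\<lambda>g. a g ?x1) ` pw_stab (insert y A) \<subseteq> ?E" using y.closed x1 by blast
        show "?E \<subseteq> (\<lambda>g. a g ?x1) ` pw_stab (insert y A)"
        proof
          fix x assume x: "x \<in> ?E"
          then have "x \<in> orb ?x1" using orb_act[OF h(1) x0] trans by (auto simp: orb_def)
          then obtain g where g: "g \<in> pw_stab A" "x = a g ?x1" by (auto simp: orb_def)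
          then have "g y = y" using f_act[OF g(1), of ?x1] x x1 by auto
          then have "g \<in> pw_stab (insert y A)" using g(1) by (auto simp: pw_stab_def)
          then show "x \<in> (\<lambda>g. a g ?x1) ` pw_stab (insert y A)" using g by blast
        qed
      qed
      have suppy: "support (insert y A) a x = support A a x" if "x \<in> ?E" for x
      proof -
        have "support (insert y A) a x = insert y A \<union> support A a x"
          by (rule support_restrict) (use that finite_A in auto)
        then show ?thesis using support_supset[of x] f_supp[of x] that by auto
      qed
      have gA: "h ` A = A" using h by (force simp: pw_stab_def)
      have hB: "support A a ?x1 = h ` ?B" using support_act x0 h by blast
      have "support (insert y A) a ?x1 - insert y A = h ` (?B - insert b A)"
        using suppy[OF x1] hB gA h pw_stabD(1)[OF h(1)] by (simp add: image_set_diff bij_is_inj)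
      then have "card (support (insert y A) a ?x1 - insert y A) \<le> card (?B - insert b A)"
        using B by (simp add: card_image_le)
      also have "\<dots> < card (?B - A)" using b B by (intro psubset_card_mono) auto
      finally have "euler \<epsilon> \<delta> (insert c (insert y A)) a ?E = weight \<epsilon> \<delta> (insert y A) (support (insert y A) a ?x1)"
        by (rule less.hyps) (use y.smooth_action_axioms x1 tr in auto)
      also have "\<dots> = weight \<epsilon> \<delta> (h ` insert b A) (h ` ?B)" using suppy[OF x1] hB gA h by simp
      also have "\<dots> = weight \<epsilon> \<delta> (insert b A) ?B" by (rule weight_image[OF h(1)])
      finally have IH: "euler \<epsilon> \<delta> (insert y ?C) a ?E = weight \<epsilon> \<delta> (insert b A) ?B"
        by (simp add: insert_commute)
      have Fx: "?F x = weight \<epsilon> \<delta> ?C (insert y ?C) * weight \<epsilon> \<delta> (insert y ?C) (support (insert y ?C) a x)" if x: "x \<in> ?E" for x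
      proof -
        have "support (insert y ?C) a x = support ?C a x"
        proof -
          have "support (insert y ?C) a x = insert y ?C \<union> support A a x"
            by (rule support_restrict) (use x finite_A in auto)
          then show ?thesis using suppC[of x] f_supp[of x] x by auto
        qed
        moreover have "finite (support ?C a x)" "insert y ?C \<subseteq> support ?C a x"
          using suppC[of x] x finite_A f_supp[of x] finite_supp[of x] by auto
        ultimately show ?thesis using weight_chain[of "support ?C a x" ?C "insert y ?C" \<epsilon> \<delta>] by simp blast
      qed
      have "smooth_action (insert y ?C) a ?E" by (rule y.refine_smooth) (use finite_A in auto)
      then have "orbit_sum (insert y ?C) a ?E ?F =
          orbit_sum (insert y ?C) a ?E (\<lambda>x. weight \<epsilon> \<delta> ?C (insert y ?C) * weight \<epsilon> \<delta> (insert y ?C) (support (insert y ?C) a x))"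
        using Fx by (intro pw_action.orbit_sum_cong) (auto simp: smooth_action_def)
      then show "orbit_sum (insert y ?C) a ?E ?F = weight \<epsilon> \<delta> ?C (insert y ?C) * weight \<epsilon> \<delta> (insert b A) ?B"
        using IH by (simp add: orbit_sum_cmult euler_def)
    qed
    also have "\<dots> = weight \<epsilon> \<delta> A (insert b A) * weight \<epsilon> \<delta> (insert b A) ?B"
      unfolding orbit_sum_cmult(2) using weight_split_point[OF finite_A A b(2) c] by simp
    also have "\<dots> = weight \<epsilon> \<delta> A ?B" using weight_chain[OF B(1) subset_insertI, of b A \<epsilon> \<delta>] B b by simp
    finally show ?thesis .
  qed
qed

context smooth_action
begin

lemma E_eq_UN_orbs: "E = \<Union> (orbs A a E)"
  using orb_refl orb_subset by (auto simp: orbs_eq)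

lemma orbs_disjoint: "P \<in> orbs A a E \<Longrightarrow> Q \<in> orbs A a E \<Longrightarrow> P \<noteq> Q \<Longrightarrow> P \<inter> Q = {}"
proof (rule ccontr)
  assume PQ: "P \<in> orbs A a E" "Q \<in> orbs A a E" "P \<noteq> Q" and "P \<inter> Q \<noteq> {}"
  then obtain x y z where "x \<in> E" "P = orb x" "y \<in> E" "Q = orb y" "z \<in> orb x" "z \<in> orb y"
    by (auto simp: orbs_eq)
  then show False using orb_eq[of x z] orb_eq[of y z] PQ(3) by simp
qed

lemma euler_insert:
  assumes fin: "finite (orbs A a E)" and A: "A \<noteq> {}"
  shows "euler \<epsilon> \<delta> (insert c A) a E = euler \<epsilon> \<delta> A a E"
proof -
  let ?F = "\<lambda>x. weight \<epsilon> \<delta> (insert c A) (support (insert c A) a x)"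
  have orb: "smooth_action A a P" "smooth_action (insert c A) a P" "finite (orbs (insert c A) a P)"
    "orbit_sum (insert c A) a P ?F = weight \<epsilon> \<delta> A (support A a (SOME x. x \<in> P))"
    if P: "P \<in> orbs A a E" for P
  proof -
    define x where "x = (SOME x. x \<in> P)"
    have x: "x \<in> P" "x \<in> E" "P = orb x" using some_in_orb[OF P] by (auto simp: x_def)
    show s: "smooth_action A a P" using orb_smooth x by simp
    then show "smooth_action (insert c A) a P"
      by (rule smooth_action.refine_smooth) (use finite_A in auto)
    show "finite (orbs (insert c A) a P)" using finite_orbs_orb[OF x(2)] x(3) finite_A by auto
    show "orbit_sum (insert c A) a P ?F = weight \<epsilon> \<delta> A (support A a (SOME x. x \<in> P))"
      using euler_transitive_insert[OF s A x(1)] x unfolding euler_def x_def[symmetric] by (simp add: orb_def)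
  qed
  have "euler \<epsilon> \<delta> (insert c A) a E = orbit_sum (insert c A) a (\<Union>P\<in>orbs A a E. P) ?F"
    unfolding euler_def using E_eq_UN_orbs by simp
  also have "\<dots> = (\<Sum>P\<in>orbs A a E. orbit_sum (insert c A) a P ?F)"
    by (rule orbit_sum_UN) (use orb fin orbs_disjoint in \<open>auto simp: smooth_action_def\<close>)
  also have "\<dots> = euler \<epsilon> \<delta> A a E" unfolding euler_def orbit_sum_def[of A] using orb(4) by simp
  finally show ?thesis .
qed

text \<open>Enlarging \<open>A\<close> point by point. For empty \<open>A\<close> this fails: with \<open>\<epsilon> = \<delta> = 0\<close> the whole line has weight \<open>0\<close> over
the empty set, while cutting it at a point gives \<open>0 + 1 + 0\<close>.\<close>

lemma euler_supset:
  assumes fin: "finite (orbs A a E)" and A: "A \<noteq> {}" and D: "finite D" "A \<subseteq> D"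
  shows "euler \<epsilon> \<delta> D a E = euler \<epsilon> \<delta> A a E"
proof -
  have "euler \<epsilon> \<delta> (F \<union> A) a E = euler \<epsilon> \<delta> A a E" if "finite F" for F
    using that
  proof (induction F)
    case (insert c F)
    interpret F: smooth_action "F \<union> A" a E by (rule refine_smooth) (use insert finite_A in auto)
    have "finite (orbs (F \<union> A) a E)" by (rule finite_orbs_refine) (use fin insert finite_A in auto)
    then show ?case using F.euler_insert[of \<epsilon> \<delta> c] insert A by simp
  qed simp
  from this[OF D(1)] show ?thesis using D by (simp add: Un_absorb2)
qed

text \<open>Here \<open>A\<close> may be empty; the two nonempty sets are compared with their union.\<close>

lemma euler_independent:
  assumes fin: "finite (orbs A a E)"
    and C: "finite C" "A \<subseteq> C" "C \<noteq> {}" and D: "finite D" "A \<subseteq> D" "D \<noteq> {}"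
  shows "euler \<epsilon> \<delta> C a E = euler \<epsilon> \<delta> D a E"
proof -
  have "euler \<epsilon> \<delta> (C \<union> D) a E = euler \<epsilon> \<delta> B a E"
    if B: "finite B" "A \<subseteq> B" "B \<noteq> {}" "B \<subseteq> C \<union> D" for B
  proof -
    interpret B: smooth_action B a E by (rule refine_smooth) (use B in auto)
    show ?thesis by (rule B.euler_supset) (use B C D finite_orbs_refine[OF fin] in auto)
  qed
  from this[of C] this[of D] show ?thesis using C D by simp
qed

text \<open>Covers isomorphisms (\<open>g\<close> the identity) and conjugation at once: an isomorphism onto a twisted action
carries \<open>G(A)\<close>-orbits to \<open>G(g ` A)\<close>-orbits and supports to their images, and the weight is invariant.\<close>

lemma euler_transport:
  assumes g: "g \<in> pw_stab {}" and bij: "bij_betw \<phi> E Y"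
    and \<phi>: "\<And>k x. k \<in> pw_stab A \<Longrightarrow> x \<in> E \<Longrightarrow> \<phi> (a k x) = b (g \<circ> k \<circ> inv_into UNIV g) (\<phi> x)"
  shows "euler \<epsilon> \<delta> (g ` A) b Y = euler \<epsilon> \<delta> A a E"
proof -
  have support: "support (g ` A) b (\<phi> x) = g ` support A a x" if x: "x \<in> E" for x
  proof (rule support_eqI)
    show "finite (g ` support A a x)" using x finite_supp by blast
    have "b (g \<circ> k \<circ> inv_into UNIV g) (\<phi> x) = \<phi> x \<longleftrightarrow> a k x = x" if "k \<in> pw_stab A" for k
      using \<phi>[OF that x] bij closed[OF that x] x by (metis bij_betw_def inj_on_eq_iff)
    then have "{h \<in> pw_stab (g ` A). b h (\<phi> x) = \<phi> x} =
        (\<lambda>k. g \<circ> k \<circ> inv_into UNIV g) ` {k \<in> pw_stab A. a k x = x}"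
      unfolding pw_stab_image[OF g] by auto
    then show "{h \<in> pw_stab (g ` A). b h (\<phi> x) = \<phi> x} = pw_stab (g ` support A a x)"
      unfolding stab_eq[OF x] pw_stab_image[OF g] .
  qed
  let ?b = "\<lambda>k. b (g \<circ> k \<circ> inv_into UNIV g)"
  have "orbs (g ` A) b Y = orbs A ?b Y"
    unfolding orbs_def pw_stab_image[OF g] image_image ..
  then have "euler \<epsilon> \<delta> (g ` A) b Y = orbit_sum A ?b Y (\<lambda>y. weight \<epsilon> \<delta> (g ` A) (support (g ` A) b y))"
    by (simp add: euler_def orbit_sum_def)
  also have "\<dots> = euler \<epsilon> \<delta> A a E"
    unfolding euler_def
    by (rule orbit_sum_transport[OF pw_action_axioms bij])
       (use \<phi> weight_supp_invariant support weight_image[OF g] in auto)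
  finally show ?thesis .
qed

end

lemma euler_Un:
  assumes "smooth_action A a E" "smooth_action A a Y" "finite (orbs A a E)" "finite (orbs A a Y)" "E \<inter> Y = {}"
  shows "euler \<epsilon> \<delta> A a (E \<union> Y) = euler \<epsilon> \<delta> A a E + euler \<epsilon> \<delta> A a Y"
  unfolding euler_def by (rule orbit_sum_Un) (use assms in \<open>auto simp: smooth_action_def\<close>)

text \<open>The orbit sum over the total set is grouped along \<open>f\<close>. By multiplicativity of the weight each summand is
the weight of a point \<open>z\<close> of the base times the Euler characteristic of the fibre over \<open>z\<close>. All fibres
have the same Euler characteristic, since the base is a single orbit of the larger group \<open>G(A)\<close>; the
Euler characteristics themselves are computed with the nonempty set \<open>C\<close>.\<close>

lemma euler_fibration:
  assumes E: "smooth_action A a E" and Y: "smooth_action A b Y"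
    and tE: "x0 \<in> E" "E = (\<lambda>g. a g x0) ` pw_stab A"
    and tY: "y \<in> Y" "Y = (\<lambda>g. b g y) ` pw_stab A"
    and f: "\<And>x. x \<in> E \<Longrightarrow> f x \<in> Y" "\<And>g x. g \<in> pw_stab A \<Longrightarrow> x \<in> E \<Longrightarrow> f (a g x) = b g (f x)"
    and C: "finite C" "A \<subseteq> C" "C \<noteq> {}" and D: "finite D" "support A b y \<subseteq> D" "D \<noteq> {}"
  shows "euler \<epsilon> \<delta> C a E = euler \<epsilon> \<delta> D a {x \<in> E. f x = y} * euler \<epsilon> \<delta> C b Y"
proof -
  interpret E: smooth_action A a E by fact
  interpret Y: smooth_action A b Y by fact
  interpret EC: smooth_action C a E by (rule E.refine_smooth) (use C in auto)
  interpret YC: smooth_action C b Y by (rule Y.refine_smooth) (use C in auto)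
  have CA: "pw_stab C \<subseteq> pw_stab A" by (rule pw_stab_antimono) (rule C)
  let ?F = "\<lambda>x. weight \<epsilon> \<delta> C (support C a x)" and ?t = "support C b" and ?m = "euler \<epsilon> \<delta> D a {x \<in> E. f x = y}"
  have finE: "finite (orbs B a E)" if "A \<subseteq> B" "finite B" for B
    using E.finite_orbs_orb[OF tE(1) that] tE(2) by (simp add: E.orb_def)
  have finY: "finite (orbs B b Y)" if "A \<subseteq> B" "finite B" for B
    using Y.finite_orbs_orb[OF tY(1) that] tY(2) by (simp add: Y.orb_def)
  have fib: "smooth_action (support A b z) a {x \<in> E. f x = z}" if z: "z \<in> Y" for z
  proof (rule E.restrict_smooth)
    fix g x assume g: "g \<in> pw_stab (support A b z)" and x: "x \<in> {x \<in> E. f x = z}"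
    then have "g \<in> pw_stab A" "b g z = z" using Y.stab_eq[OF z] by auto
    then show "a g x \<in> {x \<in> E. f x = z}" using x E.closed f by auto
  qed (use Y.support_supset Y.finite_supp z in auto)
  have finfib: "finite (orbs (support A b z) a {x \<in> E. f x = z})" if z: "z \<in> Y" for z
  proof -
    have "P = {x \<in> E. f x = z}" if P: "P \<in> orbs (support A b z) a {x \<in> E. f x = z}" for P
    proof -
      interpret z: smooth_action "support A b z" a "{x \<in> E. f x = z}" by (rule fib) fact
      obtain x where x: "x \<in> E" "f x = z" "P = z.orb x" using P by (auto simp: z.orbs_eq)
      have "x' \<in> z.orb x" if x': "x' \<in> E" "f x' = z" for x'
      proof -
        have "x' \<in> E.orb x" using E.orb_eq[OF tE(1), of x] tE(2) x(1) x' by (simp add: E.orb_def)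
        then obtain g where g: "g \<in> pw_stab A" "x' = a g x" by (auto simp: E.orb_def)
        then have "b g z = z" using f(2)[OF g(1) x(1)] x x' by simp
        then have "g \<in> pw_stab (support A b z)" using Y.stab_eq[OF z] g by blast
        then show ?thesis using g by (auto simp: z.orb_def)
      qed
      then show ?thesis using z.orb_subset[of x] x by blast
    qed
    then have "orbs (support A b z) a {x \<in> E. f x = z} \<subseteq> {{x \<in> E. f x = z}}" by blast
    then show ?thesis by (rule finite_subset) simp
  qed
  \<comment> \<open>an element \<open>h\<close> moving \<open>y\<close> to \<open>z\<close> carries one fibre to the other\<close>
  have fib_mu: "euler \<epsilon> \<delta> (?t z) a {x \<in> E. f x = z} = ?m" if z: "z \<in> Y" for z
  proof -
    obtain h where h: "h \<in> pw_stab A" "z = b h y" using z tY(2) by blast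
    have h0: "h \<in> pw_stab {}" using h pw_stab_antimono[of "{}" A] by blast
    interpret y: smooth_action "support A b y" a "{x \<in> E. f x = y}" by (rule fib) (rule tY)
    interpret D: smooth_action D a "{x \<in> E. f x = y}" by (rule y.refine_smooth) (use D in auto)
    interpret z: smooth_action "support A b z" a "{x \<in> E. f x = z}" by (rule fib) fact
    have DA: "pw_stab D \<subseteq> pw_stab A"
      using D Y.support_supset[OF tY(1)] by (intro pw_stab_antimono) blast
    have "euler \<epsilon> \<delta> (h ` D) a {x \<in> E. f x = z} = ?m"
    proof (rule D.euler_transport[OF h0])
      show "bij_betw (a h) {x \<in> E. f x = y} {x \<in> E. f x = z}"
      proof (rule bij_betw_byWitness[where f' = "a (inv_into UNIV h)"])
        have "b (inv_into UNIV h) z = y" using h Y.inv_act(1)[OF h(1) tY(1)] by simp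
        then show "a (inv_into UNIV h) ` {x \<in> E. f x = z} \<subseteq> {x \<in> E. f x = y}"
          using f E.closed inv_pw_stab[OF h(1)] by auto
        show "a h ` {x \<in> E. f x = y} \<subseteq> {x \<in> E. f x = z}" using f E.closed h by auto
      qed (use h E.inv_act in auto)
      fix k x assume k: "k \<in> pw_stab D" and x: "x \<in> {x \<in> E. f x = y}"
      have kA: "k \<in> pw_stab A" using k DA by blast
      have "a (h \<circ> k \<circ> inv_into UNIV h) (a h x) = a ((h \<circ> k \<circ> inv_into UNIV h) \<circ> h) x"
        using x h kA by (intro E.comp[symmetric] comp_pw_stab inv_pw_stab) auto
      also have "(h \<circ> k \<circ> inv_into UNIV h) \<circ> h = h \<circ> k" using h by (auto simp: fun_eq_iff)
      also have "a (h \<circ> k) x = a h (a k x)" using E.comp h kA x by blast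
      finally show "a h (a k x) = a (h \<circ> k \<circ> inv_into UNIV h) (a h x)" by (rule sym)
    qed
    moreover have "euler \<epsilon> \<delta> (h ` D) a {x \<in> E. f x = z} = euler \<epsilon> \<delta> (?t z) a {x \<in> E. f x = z}"
    proof (rule z.euler_independent[OF finfib[OF z]])
      show "support A b z \<subseteq> h ` D" using Y.support_act[OF tY(1) h(1)] h D by auto
      show "support A b z \<subseteq> ?t z" "finite (?t z)" "?t z \<noteq> {}"
        using Y.support_restrict[OF z C(2,1)] C Y.finite_supp[OF z] by auto
    qed (use D in auto)
    ultimately show ?thesis by simp
  qed
  have "euler \<epsilon> \<delta> C a E = orbit_sum C b Y (\<lambda>z. orbit_sum (?t z) a {x \<in> E. f x = z} ?F)"
    unfolding euler_def
    by (rule orbit_sum_fubini)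
       (use EC.pw_action_axioms YC.pw_action_axioms finE finY C f CA YC.stab_eq EC.weight_supp_invariant in auto)
  also have "\<dots> = orbit_sum C b Y (\<lambda>z. ?m * weight \<epsilon> \<delta> C (support C b z))"
  proof (rule YC.orbit_sum_cong)
    fix z assume z: "z \<in> Y"
    interpret z: smooth_action "support A b z" a "{x \<in> E. f x = z}" by (rule fib) fact
    have t: "?t z = C \<union> support A b z" using Y.support_restrict[OF z C(2,1)] .
    have t': "finite (?t z)" "C \<subseteq> ?t z" using YC.finite_supp YC.support_supset z by auto
    interpret tz: smooth_action "?t z" a "{x \<in> E. f x = z}" by (rule z.refine_smooth) (use t t' in auto)
    have "?F x = weight \<epsilon> \<delta> C (?t z) * weight \<epsilon> \<delta> (?t z) (support (?t z) a x)" if x: "x \<in> E" "f x = z" for x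
    proof -
      have "pw_stab (support C a x) \<subseteq> pw_stab (?t z)"
        using EC.stab_eq[OF x(1)] YC.stab_eq[OF z] f(2) x CA by force
      then have sub: "?t z \<subseteq> support C a x"
        using pw_stab_subset_iff[OF EC.finite_supp[OF x(1)]] by blast
      then have "support (?t z) a x = support C a x"
        using EC.support_restrict[OF x(1) t'(2,1)] by blast
      then show ?thesis using weight_chain[OF EC.finite_supp[OF x(1)] t'(2) sub] by simp
    qed
    then have "orbit_sum (?t z) a {x \<in> E. f x = z} ?F =
        orbit_sum (?t z) a {x \<in> E. f x = z} (\<lambda>x. weight \<epsilon> \<delta> C (?t z) * weight \<epsilon> \<delta> (?t z) (support (?t z) a x))"
      by (intro tz.orbit_sum_cong) auto
    also have "\<dots> = weight \<epsilon> \<delta> C (?t z) * euler \<epsilon> \<delta> (?t z) a {x \<in> E. f x = z}"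
      by (simp add: orbit_sum_cmult euler_def)
    finally show "orbit_sum (?t z) a {x \<in> E. f x = z} ?F = ?m * weight \<epsilon> \<delta> C (?t z)"
      using fib_mu[OF z] by simp
  qed
  also have "\<dots> = ?m * euler \<epsilon> \<delta> C b Y" by (simp add: orbit_sum_cmult euler_def)
  finally show ?thesis .
qed


section \<open>Invariance under the defining relations\<close>

lemma ghat_set_smooth:
  assumes M: "ghat_set M"
  shows "\<exists>A. finite A \<and> gdef M = pw_stab A \<and> smooth_action A (act M) (pts M)"
proof -
  interpret group_action "gp M" "pts M" "act M" using M by (simp add: ghat_set_def)
  have U: "open_subgroup (gdef M)" using M by (simp add: ghat_set_def)
  then obtain A where A: "finite A" "gdef M = pw_stab A"
    using open_subgroup_eq_pw_stab[of "gdef M"] by (auto simp: open_subgroup_iff)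
  have "smooth_action A (act M) (pts M)"
  proof
    fix x assume x: "x \<in> pts M"
    show "act M g x \<in> pts M" if "g \<in> pw_stab A" for g using element_image[of g x] that x A by simp
    have "act M \<one>\<^bsub>gp M\<^esub> x = x" using id_eq_one x by (metis restrict_apply')
    then show "act M id x = x" by simp
    show "act M (g \<circ> h) x = act M g (act M h x)" if "g \<in> pw_stab A" "h \<in> pw_stab A" for g h
      using composition_rule[of x g h] that x A by simp
    have "subgroup (stabilizer (gp M) (act M) x) autR"
      using group.incl_subgroup[OF group_autR _ stabilizer_subgroup[OF x]] U by (simp add: open_subgroup_iff)
    then obtain B where B: "finite B" "pw_stab B \<subseteq> stabilizer (gp M) (act M) x"
      using M x openin_subgroup_iff[of "stabilizer (gp M) (act M) x"] by (auto simp: ghat_set_def)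
    then show "\<exists>B. finite B \<and> A \<subseteq> B \<and> (\<forall>g\<in>pw_stab B. act M g x = x)"
      using A by (intro exI[of _ "A \<union> B"]) (auto simp: pw_stab_Un stabilizer_def)
  qed (rule A)
  then show ?thesis using A by blast
qed

lemma orbits_eq_orbs: "gdef M = pw_stab A \<Longrightarrow> orbits (gp M) (pts M) (act M) = orbs A (act M) (pts M)"
  by (auto simp: orbits_def orbit_def orbs_def)

text \<open>The condition defining the type of generators, on sets of points of arbitrary type.\<close>

definition finitary_ghat :: "'x ghat \<Rightarrow> bool" where
  "finitary_ghat M \<longleftrightarrow> ghat_set M \<and> finitary M"

lemma finitary_ghat_refine:
  assumes "finitary_ghat M" "finite A" "pw_stab A \<subseteq> gdef M"
  shows "smooth_action A (act M) (pts M)" "finite (orbs A (act M) (pts M))"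
proof -
  obtain B where B: "finite B" "gdef M = pw_stab B" "smooth_action B (act M) (pts M)"
    using assms(1) ghat_set_smooth by (auto simp: finitary_ghat_def)
  have BA: "B \<subseteq> A" using assms(2,3) B(2) pw_stab_subset_iff by simp
  show "smooth_action A (act M) (pts M)" by (rule smooth_action.refine_smooth[OF B(3) BA assms(2)])
  have "finite (orbs B (act M) (pts M))"
    using assms(1) orbits_eq_orbs[OF B(2)] by (simp add: finitary_ghat_def finitary_def)
  then show "finite (orbs A (act M) (pts M))"
    by (rule smooth_action.finite_orbs_refine[OF B(3) _ BA assms(2)])
qed

text \<open>Any choice will do by \<open>euler_ghat_eq\<close>; nonemptiness is needed for the weights.\<close>

definition base_points :: "'x ghat \<Rightarrow> real set" where
  "base_points M = (SOME A. finite A \<and> A \<noteq> {} \<and> pw_stab A \<subseteq> gdef M)"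

lemma open_subgroup_base_points: "open_subgroup V \<Longrightarrow> \<exists>A. finite A \<and> A \<noteq> {} \<and> pw_stab A \<subseteq> V"
proof -
  assume "open_subgroup V"
  then obtain A where "finite A" "pw_stab A \<subseteq> V" by (auto simp: open_subgroup_iff)
  then show ?thesis using pw_stab_antimono[of A "insert 0 A"] by (intro exI[of _ "insert 0 A"]) auto
qed

lemma base_points: "finitary_ghat M \<Longrightarrow> finite (base_points M) \<and> base_points M \<noteq> {} \<and> pw_stab (base_points M) \<subseteq> gdef M"
  unfolding base_points_def by (rule someI_ex) (rule open_subgroup_base_points, simp add: finitary_ghat_def ghat_set_def)

definition euler_ghat :: "int \<Rightarrow> int \<Rightarrow> 'x ghat \<Rightarrow> int" where
  "euler_ghat \<epsilon> \<delta> M = euler \<epsilon> \<delta> (base_points M) (act M) (pts M)"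

lemma euler_ghat_eq:
  assumes "finitary_ghat M" "finite D" "D \<noteq> {}" "pw_stab D \<subseteq> gdef M"
  shows "euler \<epsilon> \<delta> D (act M) (pts M) = euler_ghat \<epsilon> \<delta> M"
proof -
  obtain B where B: "finite B" "gdef M = pw_stab B" "smooth_action B (act M) (pts M)"
    using assms(1) ghat_set_smooth by (auto simp: finitary_ghat_def)
  have "finite (orbs B (act M) (pts M))" using finitary_ghat_refine(2)[OF assms(1) B(1)] B(2) by simp
  then show ?thesis unfolding euler_ghat_def
    by (rule smooth_action.euler_independent[OF B(3)])
       (use assms base_points[OF assms(1)] B(2) pw_stab_subset_iff in auto)
qed

lemma euler_ghat_transport:
  assumes M: "finitary_ghat M" and g: "g \<in> pw_stab {}" and D: "finite D" "D \<noteq> {}" "pw_stab D \<subseteq> gdef M"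
    and bij: "bij_betw \<phi> (pts M) Y"
    and \<phi>: "\<And>k x. k \<in> pw_stab D \<Longrightarrow> x \<in> pts M \<Longrightarrow> \<phi> (act M k x) = b (g \<circ> k \<circ> inv_into UNIV g) (\<phi> x)"
  shows "euler_ghat \<epsilon> \<delta> M = euler \<epsilon> \<delta> (g ` D) b Y"
proof -
  interpret smooth_action D "act M" "pts M" by (rule finitary_ghat_refine) (use M D in auto)
  show ?thesis using euler_transport[OF g bij \<phi>] euler_ghat_eq[OF M D] by simp
qed

lemma euler_ghat_cong:
  assumes M: "finitary_ghat M" and D: "finite D" "D \<noteq> {}" "pw_stab D \<subseteq> gdef M"
    and bij: "bij_betw \<phi> (pts M) Y"
    and \<phi>: "\<And>k x. k \<in> pw_stab D \<Longrightarrow> x \<in> pts M \<Longrightarrow> \<phi> (act M k x) = b k (\<phi> x)"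
  shows "euler_ghat \<epsilon> \<delta> M = euler \<epsilon> \<delta> D b Y"
proof -
  have "id \<in> pw_stab {}" by simp
  from euler_ghat_transport[OF M this D bij, where b=b] \<phi> show ?thesis by (simp add: inv_id)
qed

lemma ghat_isoE:
  assumes "ghat_iso M N"
  obtains f D where "bij_betw f (pts M) (pts N)" "finite D" "D \<noteq> {}"
    "pw_stab D \<subseteq> gdef M" "pw_stab D \<subseteq> gdef N"
    "\<And>k x. k \<in> pw_stab D \<Longrightarrow> x \<in> pts M \<Longrightarrow> f (act M k x) = act N k (f x)"
proof -
  obtain f V where f: "bij_betw f (pts M) (pts N)" "open_subgroup V" "V \<subseteq> gdef M" "V \<subseteq> gdef N" "equivariant V M N f"
    using assms by (auto simp: ghat_iso_def ghat_map_def)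
  obtain D where D: "finite D" "D \<noteq> {}" "pw_stab D \<subseteq> V" using open_subgroup_base_points[OF f(2)] by blast
  show ?thesis
    by (rule that[of f D]) (use f D in \<open>auto simp: equivariant_def\<close>)
qed

lemma euler_ghat_iso:
  assumes "finitary_ghat M" "finitary_ghat N" "ghat_iso M N"
  shows "euler_ghat \<epsilon> \<delta> M = euler_ghat \<epsilon> \<delta> N"
  using assms(3)
proof (rule ghat_isoE)
  fix f D assume "bij_betw f (pts M) (pts N)" "finite D" "D \<noteq> {}"
    "pw_stab D \<subseteq> gdef M" "pw_stab D \<subseteq> gdef N"
    "\<And>k x. k \<in> pw_stab D \<Longrightarrow> x \<in> pts M \<Longrightarrow> f (act M k x) = act N k (f x)"
  then show ?thesis
    using euler_ghat_cong[OF assms(1), of D f "pts N" "act N"] euler_ghat_eq[OF assms(2), of D] by simp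
qed

lemma euler_ghat_singleton:
  assumes M: "finitary_ghat M" and x: "pts M = {x}"
  shows "euler_ghat \<epsilon> \<delta> M = 1"
proof -
  let ?D = "base_points M"
  note D = base_points[OF M]
  interpret smooth_action ?D "act M" "pts M" by (rule finitary_ghat_refine) (use M D in auto)
  have "{g \<in> pw_stab ?D. act M g x = x} = pw_stab ?D" using closed x by auto
  then have "support ?D (act M) x = ?D" using D by (intro support_eqI) auto
  moreover have "orb x = {x}" using orb_refl orb_subset x by blast
  ultimately show ?thesis using euler_transitive[of x] x weight_refl D by (simp add: euler_ghat_def)
qed

text \<open>An isomorphism onto a coproduct splits the set into the two invariant preimages of the summands.\<close>

lemma euler_ghat_coprod:
  assumes C: "finitary_ghat C" and M: "finitary_ghat M" and N: "finitary_ghat N" and iso: "ghat_iso C (coprod M N)"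
  shows "euler_ghat \<epsilon> \<delta> C = euler_ghat \<epsilon> \<delta> M + euler_ghat \<epsilon> \<delta> N"
  using iso
proof (rule ghat_isoE)
  fix f D
  assume "bij_betw f (pts C) (pts (coprod M N))" and D: "finite D" "D \<noteq> {}" "pw_stab D \<subseteq> gdef C"
    and "pw_stab D \<subseteq> gdef (coprod M N)"
    and "\<And>k x. k \<in> pw_stab D \<Longrightarrow> x \<in> pts C \<Longrightarrow> f (act C k x) = act (coprod M N) k (f x)"
  then have f: "bij_betw f (pts C) (pts M <+> pts N)" and DM: "pw_stab D \<subseteq> gdef M" and DN: "pw_stab D \<subseteq> gdef N"
    and eq: "\<And>k x. k \<in> pw_stab D \<Longrightarrow> x \<in> pts C \<Longrightarrow> f (act C k x) = map_sum (act M k) (act N k) (f x)"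
  proof -
    show "f (act C k x) = map_sum (act M k) (act N k) (f x)" if "k \<in> pw_stab D" "x \<in> pts C" for k x
    proof -
      have "f x \<in> pts M <+> pts N"
        using \<open>bij_betw f (pts C) (pts (coprod M N))\<close> that(2) by (auto simp: bij_betw_def coprod_def)
      then show ?thesis
        using \<open>\<And>k x. k \<in> pw_stab D \<Longrightarrow> x \<in> pts C \<Longrightarrow> f (act C k x) = act (coprod M N) k (f x)\<close>[OF that]
        by (simp add: coprod_def)
    qed
  qed (simp_all add: coprod_def)
  interpret C: smooth_action D "act C" "pts C" by (rule finitary_ghat_refine) (use C D in auto)
  have fC: "f x \<in> pts M <+> pts N" if "x \<in> pts C" for x using f that by (auto simp: bij_betw_def)
  define EM where "EM = {x \<in> pts C. \<exists>z. f x = Inl z}"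
  define EN where "EN = {x \<in> pts C. \<exists>z. f x = Inr z}"
  interpret EM: smooth_action D "act C" EM
    by (rule C.restrict_smooth) (use D eq C.closed in \<open>auto simp: EM_def\<close>)
  interpret EN: smooth_action D "act C" EN
    by (rule C.restrict_smooth) (use D eq C.closed in \<open>auto simp: EN_def\<close>)
  have un: "pts C = EM \<union> EN" "EM \<inter> EN = {}" using fC by (auto simp: EM_def EN_def)
  have fin: "finite (orbs D (act C) (pts C))" by (rule finitary_ghat_refine) (use C D in auto)
  have "euler \<epsilon> \<delta> D (act C) (pts C) = euler \<epsilon> \<delta> D (act C) EM + euler \<epsilon> \<delta> D (act C) EN"
    unfolding un(1)
    by (rule euler_Un) (use fin EM.smooth_action_axioms EN.smooth_action_axioms un(2) in
        \<open>auto simp: orbs_def un(1) image_Un\<close>)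
  moreover have "euler \<epsilon> \<delta> D (act M) (pts M) = euler \<epsilon> \<delta> D (act C) EM"
  proof -
    have bij: "bij_betw (projl \<circ> f) EM (pts M)"
    proof (rule bij_betwI')
      show "(projl \<circ> f) x = (projl \<circ> f) y \<longleftrightarrow> x = y" if "x \<in> EM" "y \<in> EM" for x y
        using that f by (auto simp: EM_def bij_betw_def inj_on_def)
      show "(projl \<circ> f) x \<in> pts M" if "x \<in> EM" for x
        using that fC[of x] by (auto simp: EM_def)
      show "\<exists>x\<in>EM. y = (projl \<circ> f) x" if "y \<in> pts M" for y
      proof -
        have "Inl y \<in> f ` pts C" using f that by (auto simp: bij_betw_def)
        then obtain x where "x \<in> pts C" "f x = Inl y" by force
        then show ?thesis by (intro bexI[of _ x]) (auto simp: EM_def)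
      qed
    qed
    have "euler \<epsilon> \<delta> (id ` D) (act M) (pts M) = euler \<epsilon> \<delta> D (act C) EM"
      by (rule EM.euler_transport[OF _ bij]) (use eq in \<open>auto simp: inv_id EM_def\<close>)
    then show ?thesis by simp
  qed
  moreover have "euler \<epsilon> \<delta> D (act N) (pts N) = euler \<epsilon> \<delta> D (act C) EN"
  proof -
    have bij: "bij_betw (projr \<circ> f) EN (pts N)"
    proof (rule bij_betwI')
      show "(projr \<circ> f) x = (projr \<circ> f) y \<longleftrightarrow> x = y" if "x \<in> EN" "y \<in> EN" for x y
        using that f by (auto simp: EN_def bij_betw_def inj_on_def)
      show "(projr \<circ> f) x \<in> pts N" if "x \<in> EN" for x
        using that fC[of x] by (auto simp: EN_def)
      show "\<exists>x\<in>EN. y = (projr \<circ> f) x" if "y \<in> pts N" for y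
      proof -
        have "Inr y \<in> f ` pts C" using f that by (auto simp: bij_betw_def)
        then obtain x where "x \<in> pts C" "f x = Inr y" by force
        then show ?thesis by (intro bexI[of _ x]) (auto simp: EN_def)
      qed
    qed
    have "euler \<epsilon> \<delta> (id ` D) (act N) (pts N) = euler \<epsilon> \<delta> D (act C) EN"
      by (rule EN.euler_transport[OF _ bij]) (use eq in \<open>auto simp: inv_id EN_def\<close>)
    then show ?thesis by simp
  qed
  ultimately show ?thesis
    using euler_ghat_eq[OF C D] euler_ghat_eq[OF M D(1,2) DM] euler_ghat_eq[OF N D(1,2) DN] by metis
qed

text \<open>Twisting by \<open>g\<close> replaces \<open>G(D)\<close> by a conjugate, so a set \<open>D\<close> of base points becomes its image under the
inverse of \<open>g\<close>.\<close>

lemma euler_ghat_conj: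
  assumes M: "finitary_ghat M" and N: "finitary_ghat N" and g: "g \<in> carrier autR" and iso: "ghat_iso N (conj_ghat M g)"
  shows "euler_ghat \<epsilon> \<delta> M = euler_ghat \<epsilon> \<delta> N"
  using iso
proof (rule ghat_isoE)
  fix f D
  let ?g' = "inv_into UNIV g"
  have g0: "g \<in> pw_stab {}" using g by (simp only: pw_stab_empty)
  then have g': "?g' \<in> pw_stab {}" by (rule inv_pw_stab)
  have minv: "m_inv autR g = ?g'" by (rule m_inv_autR) fact
  have inv_inv: "inv_into UNIV ?g' = g" using g0 pw_stabD(1) inv_inv_eq by blast
  assume "bij_betw f (pts N) (pts (conj_ghat M g))" and D: "finite D" "D \<noteq> {}" "pw_stab D \<subseteq> gdef N"
    and sub: "pw_stab D \<subseteq> gdef (conj_ghat M g)"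
    and "\<And>k x. k \<in> pw_stab D \<Longrightarrow> x \<in> pts N \<Longrightarrow> f (act N k x) = act (conj_ghat M g) k (f x)"
  then have f: "bij_betw f (pts N) (pts M)"
    and eq: "\<And>k x. k \<in> pw_stab D \<Longrightarrow> x \<in> pts N \<Longrightarrow> f (act N k x) = act M (?g' \<circ> k \<circ> inv_into UNIV ?g') (f x)"
    by (simp_all add: conj_ghat_def minv inv_inv)
  have "euler_ghat \<epsilon> \<delta> N = euler \<epsilon> \<delta> (?g' ` D) (act M) (pts M)"
    by (rule euler_ghat_transport[OF N g' D f eq])
  also have "\<dots> = euler_ghat \<epsilon> \<delta> M"
  proof (rule euler_ghat_eq[OF M])
    show "pw_stab (?g' ` D) \<subseteq> gdef M"
    proof
      fix k assume "k \<in> pw_stab (?g' ` D)"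
      then obtain h where h: "h \<in> pw_stab D" "k = ?g' \<circ> h \<circ> g"
        using pw_stab_image[OF g', of D] inv_inv by auto
      then obtain u where u: "u \<in> gdef M" "h = g \<circ> u \<circ> ?g'" using sub by (auto simp: conj_ghat_def minv)
      have "k = u" using h u g0 by (auto simp: fun_eq_iff)
      then show "k \<in> gdef M" using u by simp
    qed
  qed (use D in auto)
  finally show ?thesis by simp
qed

lemma transitive_ghat_orbit:
  assumes "transitive_ghat M" "gdef M = pw_stab A" "smooth_action A (act M) (pts M)" "x \<in> pts M"
  shows "pts M = (\<lambda>g. act M g x) ` pw_stab A"
proof -
  interpret smooth_action A "act M" "pts M" by fact
  interpret transitive_action "gp M" "pts M" "act M" using assms(1) by (simp add: transitive_ghat_def)
  show ?thesis using unique_orbit[OF assms(4)] closed assms(2,4) by (auto simp: image_iff)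
qed

text \<open>The common group of definition is some \<open>G(A)\<close> with \<open>A\<close> possibly empty; \<open>0\<close> is an arbitrary point
added to make it nonempty.\<close>

lemma euler_ghat_fiber:
  assumes M: "finitary_ghat M" and N: "finitary_ghat N" and F: "finitary_ghat F"
    and U: "gdef M = U" "gdef N = U" and t: "transitive_ghat M" "transitive_ghat N"
    and f: "equivariant U M N f" and y: "y \<in> pts N" and iso: "ghat_iso F (fiber M N f y)"
  shows "euler_ghat \<epsilon> \<delta> M = euler_ghat \<epsilon> \<delta> F * euler_ghat \<epsilon> \<delta> N"
  using iso
proof (rule ghat_isoE)
  fix \<phi> D
  obtain A where A: "finite A" "U = pw_stab A"
    using M ghat_set_smooth[of M] U by (auto simp: finitary_ghat_def)
  interpret M: smooth_action A "act M" "pts M" by (rule finitary_ghat_refine) (use M A U in auto)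
  interpret N: smooth_action A "act N" "pts N" by (rule finitary_ghat_refine) (use N A U in auto)
  let ?E = "{x \<in> pts M. f x = y}"
  assume "bij_betw \<phi> (pts F) (pts (fiber M N f y))" and D: "finite D" "D \<noteq> {}" "pw_stab D \<subseteq> gdef F"
    and "pw_stab D \<subseteq> gdef (fiber M N f y)"
    and eq: "\<And>k x. k \<in> pw_stab D \<Longrightarrow> x \<in> pts F \<Longrightarrow> \<phi> (act F k x) = act (fiber M N f y) k (\<phi> x)"
  then have \<phi>: "bij_betw \<phi> (pts F) ?E" and sub: "pw_stab D \<subseteq> {g \<in> pw_stab A. act N g y = y}"
    using U A by (simp_all add: fiber_def stabilizer_def)
  have eq': "\<phi> (act F k x) = act M k (\<phi> x)" if "k \<in> pw_stab D" "x \<in> pts F" for k x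
  proof -
    have "\<phi> x \<in> ?E" using \<phi> that(2) by (auto simp: bij_betw_def)
    then show ?thesis using eq[OF that] by (simp add: fiber_def)
  qed
  have support: "support A (act N) y \<subseteq> D" using sub N.stab_eq[OF y] pw_stab_subset_iff[OF D(1)] by simp
  obtain x0 where x0: "x0 \<in> pts M" using t(1) by (auto simp: transitive_ghat_def)
  let ?C = "insert 0 A"
  have C: "pw_stab ?C \<subseteq> pw_stab A" by (rule pw_stab_antimono) blast
  have "euler \<epsilon> \<delta> ?C (act M) (pts M) = euler \<epsilon> \<delta> D (act M) ?E * euler \<epsilon> \<delta> ?C (act N) (pts N)"
  proof (rule euler_fibration[OF M.smooth_action_axioms N.smooth_action_axioms x0 _ y])
    show "pts M = (\<lambda>g. act M g x0) ` pw_stab A"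
      by (rule transitive_ghat_orbit) (use t U A x0 M.smooth_action_axioms in auto)
    show "pts N = (\<lambda>g. act N g y) ` pw_stab A"
      by (rule transitive_ghat_orbit) (use t U A y N.smooth_action_axioms in auto)
  qed (use f A D support in \<open>auto simp: equivariant_def\<close>)
  moreover have "euler_ghat \<epsilon> \<delta> F = euler \<epsilon> \<delta> D (act M) ?E"
    by (rule euler_ghat_cong[OF F D \<phi> eq'])
  ultimately show ?thesis
    using euler_ghat_eq[OF M, of ?C] euler_ghat_eq[OF N, of ?C] A U C by simp
qed


section \<open>Configuration spaces\<close>

lemma config_finitary_ghat: "interval I \<Longrightarrow> finitary_ghat (config I n)"
  using config_finitary by (simp add: finitary_ghat_def)

text \<open>Identifies a configuration space of an interval with a coset space of \<open>G(A)\<close>, where \<open>A\<close> is the set of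
endpoints; its weight and its class can be read off from this.\<close>

lemma config_orbit:
  assumes I: "interval I" and S: "S \<subseteq> I" "finite S"
  defines "M \<equiv> config I (card S)"
  shows "S \<in> pts M" "pts M = (\<lambda>g. act M g S) ` pw_stab (frontier I)"
    "support (frontier I) (act M) S = frontier I \<union> S"
    "smooth_action (frontier I) (act M) (pts M)" "finite (orbs (frontier I) (act M) (pts M))"
proof -
  let ?A = "frontier I"
  have A: "finite ?A" using interval_frontier[OF I] by simp
  have gdef: "gdef M = pw_stab ?A" by (simp add: M_def config_def)
  show sm: "smooth_action ?A (act M) (pts M)" "finite (orbs ?A (act M) (pts M))"
    by (rule finitary_ghat_refine; use config_finitary_ghat[OF I] A gdef in \<open>simp add: M_def\<close>)+
  interpret smooth_action ?A "act M" "pts M" by (rule sm)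
  show SM: "S \<in> pts M" using S by (simp add: M_def config_def)
  have act: "act M g T = g ` T" if "T \<in> pts M" for g T using that by (simp add: M_def config_def)
  have "pts M \<subseteq> orb S"
  proof
    fix T assume T: "T \<in> pts M"
    then obtain g where "g \<in> pw_stab ?A" "g ` S = T"
      using interval_homogeneous[OF I, of S T] S by (auto simp: M_def config_def)
    then show "T \<in> orb S" using act[OF SM] by (auto simp: orb_def)
  qed
  then show "pts M = (\<lambda>g. act M g S) ` pw_stab ?A" using orb_subset[OF SM] by (auto simp: orb_def)
  show "support ?A (act M) S = ?A \<union> S"
  proof (rule support_eqI)
    have "g ` S = S \<longleftrightarrow> (\<forall>s\<in>S. g s = s)" if "g \<in> pw_stab ?A" for g
      using strict_mono_finite_fix[of g S] pw_stabD(2)[OF that] S(2) by force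
    then show "{g \<in> pw_stab ?A. act M g S = S} = pw_stab (?A \<union> S)"
      using act[OF SM] by (auto simp: pw_stab_def)
  qed (use A S in auto)
qed

lemma euler_config:
  assumes I: "interval I"
  obtains S where "S \<subseteq> I" "finite S" "card S = n"
    "euler_ghat \<epsilon> \<delta> (config I n) = weight \<epsilon> \<delta> (frontier I) (frontier I \<union> S)"
proof -
  let ?M = "config I n" and ?A = "frontier I"
  have A: "finite ?A" "?A \<noteq> {}"
    using interval_frontier[OF I] I by (auto elim!: interval.cases simp: frontier_interval)
  have "infinite I" using I by (auto elim!: interval.cases simp: infinite_Iio infinite_Ioi infinite_Ioo)
  then obtain S where S: "S \<subseteq> I" "finite S" "card S = n" using infinite_arbitrarily_large by blast
  note orbit = config_orbit[OF I S(1,2), unfolded S(3)]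
  interpret smooth_action ?A "act ?M" "pts ?M" by (rule orbit)
  have "euler \<epsilon> \<delta> ?A (act ?M) (pts ?M) = weight \<epsilon> \<delta> ?A (?A \<union> S)"
    using euler_transitive[OF orbit(1)] orbit(2,3) by (simp add: orb_def)
  then show ?thesis
    using that[OF S] euler_ghat_eq[OF config_finitary_ghat[OF I] A] by (simp add: config_def)
qed

lemma euler_config_middle: "a < b \<Longrightarrow> euler_ghat \<epsilon> \<delta> (config {a<..<b} n) = (-1) ^ n"
proof (rule euler_config[of "{a<..<b}" n \<epsilon> \<delta>])
  fix S assume ab: "a < b" and S: "S \<subseteq> {a<..<b}" "card S = n"
    and eq: "euler_ghat \<epsilon> \<delta> (config {a<..<b} n) = weight \<epsilon> \<delta> (frontier {a<..<b}) (frontier {a<..<b} \<union> S)"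
  have "{a, b} \<union> S - {a, b} = S" using S by auto
  moreover have "\<not> (\<exists>x\<in>{a, b} \<union> S. \<forall>c\<in>{a, b}. x < c)" "\<not> (\<exists>x\<in>{a, b} \<union> S. \<forall>c\<in>{a, b}. c < x)"
    using S ab by force+
  ultimately show ?thesis unfolding eq frontier_interval(3)[OF ab] weight_def using S(2) by simp
qed (rule interval.middle)

lemma euler_config_left:
  assumes "\<epsilon> \<in> {-1, 0}"
  shows "euler_ghat \<epsilon> \<delta> (config {..<a} n) = \<epsilon> ^ n"
proof (rule euler_config[of "{..<a}" n \<epsilon> \<delta>])
  fix S assume S: "S \<subseteq> {..<a}" "finite S" "card S = n"
    and eq: "euler_ghat \<epsilon> \<delta> (config {..<a} n) = weight \<epsilon> \<delta> (frontier {..<a}) (frontier {..<a} \<union> S)"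
  have "{a} \<union> S - {a} = S" using S by auto
  moreover have "(\<exists>x\<in>{a} \<union> S. \<forall>c\<in>{a}. x < c) \<longleftrightarrow> n \<noteq> 0"
    using S(1,2) by (auto simp flip: S(3))
  moreover have "\<not> (\<exists>x\<in>{a} \<union> S. \<forall>c\<in>{a}. c < x)" using S(1) by force
  ultimately show ?thesis unfolding eq frontier_interval(1) weight_def using S(3) assms by auto
qed (rule interval.left)

lemma euler_config_right:
  assumes "\<delta> \<in> {-1, 0}"
  shows "euler_ghat \<epsilon> \<delta> (config {a<..} n) = \<delta> ^ n"
proof (rule euler_config[of "{a<..}" n \<epsilon> \<delta>])
  fix S assume S: "S \<subseteq> {a<..}" "finite S" "card S = n"
    and eq: "euler_ghat \<epsilon> \<delta> (config {a<..} n) = weight \<epsilon> \<delta> (frontier {a<..}) (frontier {a<..} \<union> S)"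
  have "{a} \<union> S - {a} = S" using S by auto
  moreover have "(\<exists>x\<in>{a} \<union> S. \<forall>c\<in>{a}. c < x) \<longleftrightarrow> n \<noteq> 0"
    using S(1,2) by (auto simp flip: S(3))
  moreover have "\<not> (\<exists>x\<in>{a} \<union> S. \<forall>c\<in>{a}. x < c)" using S(1) by force
  ultimately show ?thesis unfolding eq frontier_interval(2) weight_def using S(3) assms by auto
qed (rule interval.right)


section \<open>Evaluation of polynomials\<close>

definition monomial_eval :: "('v \<Rightarrow> int) \<Rightarrow> ('v \<Rightarrow>\<^sub>0 nat) \<Rightarrow> int" where
  "monomial_eval \<phi> m = (\<Prod>v\<in>Poly_Mapping.keys m. \<phi> v ^ Poly_Mapping.lookup m v)"

definition poly_eval :: "('v \<Rightarrow> int) \<Rightarrow> (('v \<Rightarrow>\<^sub>0 nat) \<Rightarrow>\<^sub>0 int) \<Rightarrow> int" where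
  "poly_eval \<phi> p = (\<Sum>m\<in>Poly_Mapping.keys p. Poly_Mapping.lookup p m * monomial_eval \<phi> m)"

lemma monomial_eval_superset:
  "finite S \<Longrightarrow> Poly_Mapping.keys m \<subseteq> S \<Longrightarrow> monomial_eval \<phi> m = (\<Prod>v\<in>S. \<phi> v ^ Poly_Mapping.lookup m v)"
  unfolding monomial_eval_def by (rule prod.mono_neutral_left) (auto simp: in_keys_iff)

lemma monomial_eval_add: "monomial_eval \<phi> (m + n) = monomial_eval \<phi> m * monomial_eval \<phi> n"
proof -
  let ?S = "Poly_Mapping.keys m \<union> Poly_Mapping.keys n"
  show ?thesis
    using monomial_eval_superset[of ?S "m + n" \<phi>] monomial_eval_superset[of ?S m \<phi>] monomial_eval_superset[of ?S n \<phi>] keys_add[of m n]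
    by (simp add: lookup_add power_add prod.distrib)
qed

lemma poly_eval_superset:
  "finite S \<Longrightarrow> Poly_Mapping.keys p \<subseteq> S \<Longrightarrow> poly_eval \<phi> p = (\<Sum>m\<in>S. Poly_Mapping.lookup p m * monomial_eval \<phi> m)"
  unfolding poly_eval_def by (rule sum.mono_neutral_left) (auto simp: in_keys_iff)

lemma poly_eval_diff: "poly_eval \<phi> (p - q) = poly_eval \<phi> p - poly_eval \<phi> q"
proof -
  let ?S = "Poly_Mapping.keys p \<union> Poly_Mapping.keys q"
  show ?thesis
    using poly_eval_superset[of ?S "p - q" \<phi>] poly_eval_superset[of ?S p \<phi>] poly_eval_superset[of ?S q \<phi>] keys_diff[of p q]
    by (simp add: lookup_minus left_diff_distrib sum_subtractf)
qed

lemma poly_eval_zero [simp]: "poly_eval \<phi> 0 = 0"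
  by (simp add: poly_eval_def)

lemma poly_eval_add: "poly_eval \<phi> (p + q) = poly_eval \<phi> p + poly_eval \<phi> q"
  using poly_eval_diff[of \<phi> p "0 - q"] poly_eval_diff[of \<phi> 0 q] by simp

lemma poly_eval_monomial: "poly_eval \<phi> (frag_of m) = monomial_eval \<phi> m"
  by (simp add: poly_eval_def keys_frag_of)

lemma poly_eval_one [simp]: "poly_eval \<phi> 1 = 1"
  using poly_eval_monomial[of \<phi> 0] by (simp add: monomial_eval_def)

lemma poly_eval_gen: "poly_eval \<phi> (gen A) = \<phi> A"
  unfolding gen_def by (simp add: poly_eval_monomial monomial_eval_def)

lemma poly_eval_mult: "poly_eval \<phi> (p * q) = poly_eval \<phi> p * poly_eval \<phi> q"
proof -
  have mono: "poly_eval \<phi> (frag_of m * q) = monomial_eval \<phi> m * poly_eval \<phi> q" for m and q :: "('a \<Rightarrow>\<^sub>0 nat) \<Rightarrow>\<^sub>0 int"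
    using subset_UNIV[of "Poly_Mapping.keys q"]
  proof (induction q rule: frag_induction)
    case (one n)
    have "frag_of m * frag_of n = frag_of (m + n)" by (simp add: mult_single)
    then show ?case by (simp add: poly_eval_monomial monomial_eval_add)
  qed (simp_all add: poly_eval_diff right_diff_distrib)
  show ?thesis
    using subset_UNIV[of "Poly_Mapping.keys p"]
  proof (induction p rule: frag_induction)
    case (one n)
    then show ?case by (simp add: mono poly_eval_monomial)
  qed (simp_all add: poly_eval_diff left_diff_distrib)
qed

lemma finitary_ghat_Rep: "finitary_ghat (Rep_fin_ghat A)"
  using Rep_fin_ghat[of A] by (simp add: finitary_ghat_def)

lemma Rep_Abs: "finitary_ghat M \<Longrightarrow> Rep_fin_ghat (Abs_fin_ghat M) = M"
  by (rule Abs_fin_ghat_inverse) (simp add: finitary_ghat_def)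

text \<open>Each family of relations is one of the invariance properties of the Euler characteristic.\<close>

lemma poly_eval_relations:
  assumes "p \<in> theta_relations"
  shows "poly_eval (\<lambda>A. euler_ghat \<epsilon> \<delta> (Rep_fin_ghat A)) p = 0"
  using assms
proof cases
  case (iso A B)
  then show ?thesis using euler_ghat_iso[OF finitary_ghat_Rep finitary_ghat_Rep, of A B] by (simp add: poly_eval_diff poly_eval_gen)
next
  case (singleton A x)
  then show ?thesis using euler_ghat_singleton[OF finitary_ghat_Rep, of A] by (simp add: poly_eval_diff poly_eval_gen)
next
  case (coprod C A B)
  then show ?thesis using euler_ghat_coprod[OF finitary_ghat_Rep finitary_ghat_Rep finitary_ghat_Rep, of C A B]
    by (simp add: poly_eval_diff poly_eval_add poly_eval_gen)
next
  case (conj g B A)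
  then show ?thesis using euler_ghat_conj[OF finitary_ghat_Rep finitary_ghat_Rep, of g B A] by (simp add: poly_eval_diff poly_eval_gen)
next
  case (fiber A U B f y F)
  then show ?thesis
    using euler_ghat_fiber[OF finitary_ghat_Rep finitary_ghat_Rep finitary_ghat_Rep fiber(2-8)] by (simp add: poly_eval_diff poly_eval_mult poly_eval_gen)
qed


section \<open>The homomorphisms on the quotient ring\<close>

lemma ideal_theta: "ideal theta_ideal ring_of_type_algebra"
proof -
  interpret R: cring "ring_of_type_algebra :: free_ring ring" by (rule cring_from_type_algebra)
  show ?thesis unfolding theta_ideal_def
    by (rule R.genideal_ideal) (simp add: ring_of_type_algebra_def)
qed

lemma free_ring_simps [simp]:
  "carrier (ring_of_type_algebra :: free_ring ring) = UNIV"
  "x \<otimes>\<^bsub>ring_of_type_algebra\<^esub> y = x * (y :: free_ring)"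
  "x \<oplus>\<^bsub>ring_of_type_algebra\<^esub> y = x + (y :: free_ring)"
  "\<one>\<^bsub>ring_of_type_algebra\<^esub> = (1 :: free_ring)"
  "\<zero>\<^bsub>ring_of_type_algebra\<^esub> = (0 :: free_ring)"
  by (simp_all add: ring_of_type_algebra_def)

lemma free_ring_a_inv: "\<ominus>\<^bsub>ring_of_type_algebra\<^esub> x = - (x :: free_ring)"
proof -
  interpret R: cring "ring_of_type_algebra :: free_ring ring" by (rule cring_from_type_algebra)
  show ?thesis using R.minus_equality[of "- x" x] by simp
qed

text \<open>The quotient map; equations between its values are congruences modulo the relations, so calculations
in \<open>\<Theta>(G)\<close> are carried out with polynomials under this map.\<close>

definition Theta_cls :: "free_ring \<Rightarrow> free_ring set" where
  "Theta_cls p = theta_ideal +>\<^bsub>ring_of_type_algebra\<^esub> p"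

lemma theta_class_eq: "theta_class M = Theta_cls (gen (Abs_fin_ghat M))"
  by (simp add: theta_class_def Theta_cls_def)

lemma theta_ideal_closed:
  "0 \<in> theta_ideal" "p \<in> theta_ideal \<Longrightarrow> q \<in> theta_ideal \<Longrightarrow> p + q \<in> theta_ideal"
  "p \<in> theta_ideal \<Longrightarrow> r * p \<in> theta_ideal" "p \<in> theta_ideal \<Longrightarrow> - p \<in> theta_ideal"
proof -
  interpret I: ideal theta_ideal "ring_of_type_algebra :: free_ring ring" by (rule ideal_theta)
  show "0 \<in> theta_ideal" using additive_subgroup.zero_closed[OF I.additive_subgroup_axioms] by simp
  show "p + q \<in> theta_ideal" if "p \<in> theta_ideal" "q \<in> theta_ideal" using additive_subgroup.a_closed[OF I.additive_subgroup_axioms that] by simp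
  show *: "r * p \<in> theta_ideal" if "p \<in> theta_ideal" for r p using I.I_l_closed[OF that, of r] by simp
  show "- p \<in> theta_ideal" if "p \<in> theta_ideal" using *[OF that, of "-1"] by simp
qed

lemma mem_Theta_cls: "q \<in> Theta_cls p \<longleftrightarrow> q - p \<in> theta_ideal"
  unfolding Theta_cls_def a_r_coset_def' by (auto simp: algebra_simps) (metis add.commute diff_add_cancel)

lemma Theta_cls_eq_iff: "Theta_cls p = Theta_cls q \<longleftrightarrow> p - q \<in> theta_ideal"
proof
  assume "Theta_cls p = Theta_cls q"
  moreover have "p \<in> Theta_cls p" by (simp add: mem_Theta_cls theta_ideal_closed)
  ultimately show "p - q \<in> theta_ideal" using mem_Theta_cls by blast
next
  assume pq: "p - q \<in> theta_ideal"
  have "r - p \<in> theta_ideal \<longleftrightarrow> r - q \<in> theta_ideal" for r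
    using theta_ideal_closed(2)[OF _ pq, of "r - p"]
      theta_ideal_closed(2)[OF _ theta_ideal_closed(4)[OF pq], of "r - q"] by auto
  then show "Theta_cls p = Theta_cls q" by (auto simp: mem_Theta_cls)
qed

lemma Theta_simps:
  "carrier Theta = range Theta_cls" "Theta_cls p \<otimes>\<^bsub>Theta\<^esub> Theta_cls q = Theta_cls (p * q)" "Theta_cls p \<oplus>\<^bsub>Theta\<^esub> Theta_cls q = Theta_cls (p + q)"
  "\<one>\<^bsub>Theta\<^esub> = Theta_cls 1" "\<zero>\<^bsub>Theta\<^esub> = Theta_cls 0"
proof -
  interpret I: ideal theta_ideal "ring_of_type_algebra :: free_ring ring" by (rule ideal_theta)
  show "carrier Theta = range Theta_cls" by (auto simp: Theta_def FactRing_def A_RCOSETS_def' Theta_cls_def)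
  show "Theta_cls p \<otimes>\<^bsub>Theta\<^esub> Theta_cls q = Theta_cls (p * q)"
    using I.rcoset_mult_add[of p q] by (simp add: Theta_def FactRing_def Theta_cls_def)
  show "Theta_cls p \<oplus>\<^bsub>Theta\<^esub> Theta_cls q = Theta_cls (p + q)"
    using I.a_rcos_sum[of p q] by (simp add: Theta_def FactRing_def Theta_cls_def)
  show "\<one>\<^bsub>Theta\<^esub> = Theta_cls 1" by (simp add: Theta_def FactRing_def Theta_cls_def)
  show "\<zero>\<^bsub>Theta\<^esub> = Theta_cls 0"
    using mem_Theta_cls[of _ 0] by (auto simp: Theta_def FactRing_def)
qed

text \<open>Evaluation at Euler characteristics, on any representative of the coset. It is made undefined outside
the carrier so that it is the unique such function.\<close>

definition mu_hom :: "int \<Rightarrow> int \<Rightarrow> free_ring set \<Rightarrow> int" where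
  "mu_hom \<epsilon> \<delta> = restrict (\<lambda>c. poly_eval (\<lambda>A. euler_ghat \<epsilon> \<delta> (Rep_fin_ghat A)) (SOME p. c = Theta_cls p)) (carrier Theta)"

lemma mu_hom_Theta_cls: "mu_hom \<epsilon> \<delta> (Theta_cls p) = poly_eval (\<lambda>A. euler_ghat \<epsilon> \<delta> (Rep_fin_ghat A)) p"
proof -
  let ?e = "poly_eval (\<lambda>A. euler_ghat \<epsilon> \<delta> (Rep_fin_ghat A))"
  interpret R: cring "ring_of_type_algebra :: free_ring ring" by (rule cring_from_type_algebra)
  have "ideal {p. ?e p = 0} ring_of_type_algebra"
  proof (rule idealI)
    show "ring (ring_of_type_algebra :: free_ring ring)" by (rule R.ring_axioms)
    show "subgroup {p. ?e p = 0} (add_monoid ring_of_type_algebra)"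
    proof (rule group.subgroupI)
      show "Group.group (add_monoid (ring_of_type_algebra :: free_ring ring))" by (rule R.a_group)
      show "{p. ?e p = 0} \<noteq> {}" using poly_eval_zero by blast
      fix p assume "p \<in> {p. ?e p = 0}"
      then show "inv\<^bsub>add_monoid ring_of_type_algebra\<^esub> p \<in> {p. ?e p = 0}"
        using free_ring_a_inv[of p] poly_eval_diff[of _ 0 p] by (simp add: a_inv_def)
    qed (auto simp: poly_eval_add)
  qed (auto simp: poly_eval_mult)
  then have ker: "theta_ideal \<subseteq> {p. ?e p = 0}"
    unfolding theta_ideal_def by (rule R.genideal_minimal) (use poly_eval_relations in auto)
  define q where "q = (SOME q. Theta_cls p = Theta_cls q)"
  have "Theta_cls p = Theta_cls q" unfolding q_def by (rule someI) (rule refl)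
  then have "?e (p - q) = 0" using ker Theta_cls_eq_iff by blast
  then show ?thesis by (simp add: mu_hom_def Theta_simps q_def[symmetric] poly_eval_diff)
qed

lemma is_mu_mu_hom:
  assumes "\<epsilon> \<in> {-1, 0}" "\<delta> \<in> {-1, 0}"
  shows "is_mu \<epsilon> \<delta> (mu_hom \<epsilon> \<delta>)"
proof -
  have "mu_hom \<epsilon> \<delta> \<in> ring_hom Theta \<Z>"
    by (rule ring_hom_memI) (auto simp: Theta_simps mu_hom_Theta_cls poly_eval_mult poly_eval_add)
  moreover have "mu_hom \<epsilon> \<delta> (theta_class (config I n)) = euler_ghat \<epsilon> \<delta> (config I n)" if "interval I" for I n
    by (simp add: theta_class_eq mu_hom_Theta_cls poly_eval_gen Rep_Abs[OF config_finitary_ghat[OF that]])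
  ultimately show ?thesis unfolding is_mu_def
    using euler_config_middle euler_config_left[OF assms(1)] euler_config_right[OF assms(2)]
    by (auto intro!: interval.intros simp: interval.intros)
qed


section \<open>Classes of coset spaces\<close>

lemma relation_Theta_cls: "p - q \<in> theta_relations \<Longrightarrow> Theta_cls p = Theta_cls q"
proof -
  interpret R: cring "ring_of_type_algebra :: free_ring ring" by (rule cring_from_type_algebra)
  have "theta_relations \<subseteq> theta_ideal" unfolding theta_ideal_def by (rule R.genideal_self) simp
  then show "p - q \<in> theta_relations \<Longrightarrow> Theta_cls p = Theta_cls q" by (auto simp: Theta_cls_eq_iff)
qed

lemma Theta_cls_add_cong: "Theta_cls p = Theta_cls p' \<Longrightarrow> Theta_cls q = Theta_cls q' \<Longrightarrow> Theta_cls (p + q) = Theta_cls (p' + q')"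
  using Theta_simps(3)[of p q] Theta_simps(3)[of p' q'] by simp

lemma Theta_cls_mult_cong: "Theta_cls p = Theta_cls p' \<Longrightarrow> Theta_cls q = Theta_cls q' \<Longrightarrow> Theta_cls (p * q) = Theta_cls (p' * q')"
  using Theta_simps(2)[of p q] Theta_simps(2)[of p' q'] by simp

lemma ghat_isoI:
  assumes "bij_betw f (pts M) (pts N)" "finite D" "pw_stab D \<subseteq> gdef M" "pw_stab D \<subseteq> gdef N"
    "\<And>k x. k \<in> pw_stab D \<Longrightarrow> x \<in> pts M \<Longrightarrow> f (act M k x) = act N k (f x)"
  shows "ghat_iso M N"
proof -
  have "open_subgroup (pw_stab D)" using assms(2) pw_stab_subgroup open_subgroup_iff by blast
  then show ?thesis
    unfolding ghat_iso_def ghat_map_def equivariant_def using assms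
    by (intro exI[of _ f] conjI exI[of _ "pw_stab D"]) (auto simp: bij_betw_def)
qed

definition ghat_of :: "real set \<Rightarrow> ((real \<Rightarrow> real) \<Rightarrow> 'x \<Rightarrow> 'x) \<Rightarrow> 'x set \<Rightarrow> 'x ghat" where
  "ghat_of A a Y = \<lparr>gdef = pw_stab A, pts = Y, act = (\<lambda>g. restrict (a g) Y)\<rparr>"

lemma ghat_of_simps [simp]: "gdef (ghat_of A a Y) = pw_stab A" "pts (ghat_of A a Y) = Y" "y \<in> Y \<Longrightarrow> act (ghat_of A a Y) g y = a g y"
  by (simp_all add: ghat_of_def)

lemma finitary_ghat_of:
  assumes "smooth_action A a Y" "finite (orbs A a Y)"
  shows "finitary_ghat (ghat_of A a Y)"
proof -
  interpret smooth_action A a Y by fact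
  have "group_action (gp (ghat_of A a Y)) (pts (ghat_of A a Y)) (act (ghat_of A a Y))"
    by (rule group_actionI)
       (use group_gp[OF pw_stab_subgroup] closed one comp in \<open>auto simp: ghat_of_def\<close>)
  moreover have "openin aut_topology (stabilizer (gp (ghat_of A a Y)) (act (ghat_of A a Y)) y)" if y: "y \<in> Y" for y
  proof -
    have "stabilizer (gp (ghat_of A a Y)) (act (ghat_of A a Y)) y = pw_stab (support A a y)"
      using stab_eq[OF y] y by (auto simp: stabilizer_def)
    then show ?thesis using openin_subgroup_iff[OF pw_stab_subgroup] finite_supp[OF y] by auto
  qed
  moreover have "open_subgroup (pw_stab A)" using pw_stab_subgroup finite_A open_subgroup_iff by blast
  moreover have "orbs A (act (ghat_of A a Y)) Y = orbs A a Y" by (auto simp: orbs_def)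
  ultimately show ?thesis
    using assms(2) orbits_eq_orbs[of "ghat_of A a Y" A] by (simp add: finitary_ghat_def ghat_set_def finitary_def)
qed

abbreviation ghat_gen :: "real set ghat \<Rightarrow> free_ring" where
  "ghat_gen M \<equiv> gen (Abs_fin_ghat M)"

lemma Theta_cls_iso: "finitary_ghat M \<Longrightarrow> finitary_ghat N \<Longrightarrow> ghat_iso M N \<Longrightarrow> Theta_cls (ghat_gen M) = Theta_cls (ghat_gen N)"
  by (intro relation_Theta_cls theta_relations.iso) (simp add: Rep_Abs)

text \<open>The identity map is an isomorphism onto the same set with a smaller group of definition.\<close>

lemma Theta_cls_ghat_of:
  assumes M: "finitary_ghat M" and D: "finite D" "pw_stab D \<subseteq> gdef M"
  shows "Theta_cls (ghat_gen M) = Theta_cls (ghat_gen (ghat_of D (act M) (pts M)))"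
proof (rule Theta_cls_iso[OF M])
  show "finitary_ghat (ghat_of D (act M) (pts M))" by (rule finitary_ghat_of) (use finitary_ghat_refine[OF M D] in auto)
  show "ghat_iso M (ghat_of D (act M) (pts M))"
    by (rule ghat_isoI[where f="\<lambda>x. x" and D=D]) (use D in \<open>auto simp: bij_betw_def\<close>)
qed

lemma Theta_cls_Un:
  assumes E: "smooth_action A a (Y \<union> Z)" "finite (orbs A a (Y \<union> Z))" and disj: "Y \<inter> Z = {}"
    and inv: "\<And>g y. g \<in> pw_stab A \<Longrightarrow> y \<in> Y \<Longrightarrow> a g y \<in> Y" "\<And>g z. g \<in> pw_stab A \<Longrightarrow> z \<in> Z \<Longrightarrow> a g z \<in> Z"
  shows "Theta_cls (ghat_gen (ghat_of A a (Y \<union> Z))) = Theta_cls (ghat_gen (ghat_of A a Y) + ghat_gen (ghat_of A a Z))"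
proof -
  interpret smooth_action A a "Y \<union> Z" by fact
  have Y: "finitary_ghat (ghat_of A a Y)"
    by (rule finitary_ghat_of[OF restrict_smooth]) (use inv finite_A E(2) in \<open>auto simp: orbs_def image_Un\<close>)
  have Z: "finitary_ghat (ghat_of A a Z)"
    by (rule finitary_ghat_of[OF restrict_smooth]) (use inv finite_A E(2) in \<open>auto simp: orbs_def image_Un\<close>)
  let ?f = "\<lambda>x. if x \<in> Y then Inl x else Inr x"
  have "ghat_iso (ghat_of A a (Y \<union> Z)) (coprod (ghat_of A a Y) (ghat_of A a Z))"
  proof (rule ghat_isoI[where f="?f" and D=A])
    show "bij_betw ?f (pts (ghat_of A a (Y \<union> Z))) (pts (coprod (ghat_of A a Y) (ghat_of A a Z)))"
      using disj by (auto simp: bij_betw_def inj_on_def coprod_def)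
    fix k x assume k: "k \<in> pw_stab A" and x: "x \<in> pts (ghat_of A a (Y \<union> Z))"
    show "?f (act (ghat_of A a (Y \<union> Z)) k x) = act (coprod (ghat_of A a Y) (ghat_of A a Z)) k (?f x)"
    proof (cases "x \<in> Y")
      case True
      then show ?thesis using inv(1)[OF k True] by (simp add: coprod_def InlI)
    next
      case False
      then have "x \<in> Z" using x by simp
      moreover have "a k x \<notin> Y" using inv(2)[OF k \<open>x \<in> Z\<close>] disj by blast
      ultimately show ?thesis using False by (simp add: coprod_def InrI)
    qed
  qed (auto simp: coprod_def finite_A)
  then show ?thesis
    by (intro relation_Theta_cls theta_relations.coprod) (simp add: Rep_Abs finitary_ghat_of E Y Z)
qed

text \<open>A copy of \<open>G(A)/G(B)\<close> for \<open>A \<subseteq> B\<close>: an increasing map that preserves a finite set fixes it pointwise, so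
the stabilizer of the point \<open>B\<close> is \<open>G(B)\<close>. Its points have the type required of generators.\<close>

definition cosets :: "real set \<Rightarrow> real set \<Rightarrow> real set set" where
  "cosets A B = (\<lambda>g. g ` B) ` pw_stab A"

abbreviation coset_gen :: "real set \<Rightarrow> real set \<Rightarrow> free_ring" where
  "coset_gen A B \<equiv> ghat_gen (ghat_of A (`) (cosets A B))"

lemma image_eq_iff:
  assumes "finite B" "g \<in> pw_stab A" "h \<in> pw_stab A"
  shows "g ` B = h ` B \<longleftrightarrow> (\<forall>b\<in>B. g b = h b)"
proof
  assume eq: "g ` B = h ` B"
  have "strict_mono_on B g" "strict_mono_on B h"
    using pw_stabD(2)[OF assms(2)] pw_stabD(2)[OF assms(3)] by (auto simp: strict_mono_def intro!: strict_mono_onI)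
  then show "\<forall>b\<in>B. g b = h b" using strict_mono_image_unique[OF assms(1)] eq by blast
qed force

lemma cosets_self: "B \<in> cosets A B"
  unfolding cosets_def by (rule image_eqI[of _ _ id]) auto

lemma image_stab:
  assumes "finite B" "A \<subseteq> B"
  shows "{g \<in> pw_stab A. g ` B = B} = pw_stab B"
proof -
  have "g ` B = B \<longleftrightarrow> (\<forall>b\<in>B. g b = b)" if "g \<in> pw_stab A" for g
    using image_eq_iff[OF assms(1) that id_pw_stab(1)] by simp
  then show ?thesis using assms(2) by (auto simp: pw_stab_def)
qed

lemma cosets_smooth:
  assumes B: "finite B" "A \<subseteq> B"
  shows "smooth_action A (`) (cosets A B)" "finite (orbs A (`) (cosets A B))"
    "support A (`) B = B"
proof -
  show sm: "smooth_action A (`) (cosets A B)"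
  proof
    fix g S assume g: "g \<in> pw_stab A" and "S \<in> cosets A B"
    then obtain h where "h \<in> pw_stab A" "S = h ` B" by (auto simp: cosets_def)
    then show "g ` S \<in> cosets A B" unfolding cosets_def using comp_pw_stab[OF g]
      by (intro image_eqI[of _ _ "g \<circ> h"]) (auto simp: image_comp)
  next
    show "finite A" using B finite_subset by blast
    show "\<exists>C. finite C \<and> A \<subseteq> C \<and> (\<forall>g\<in>pw_stab C. g ` S = S)" if "S \<in> cosets A B" for S
      using that B \<open>finite A\<close> by (intro exI[of _ "A \<union> S"]) (force simp: cosets_def pw_stab_def)
  qed (auto simp: image_comp)
  interpret smooth_action A "(`)" "cosets A B" by fact
  have "orb B = cosets A B" by (simp add: orb_def cosets_def)
  then have "orbs A (`) (cosets A B) \<subseteq> {cosets A B}"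
    using orb_eq[OF cosets_self] by (auto simp: orbs_eq)
  then show "finite (orbs A (`) (cosets A B))" by (rule finite_subset) simp
  show "support A (`) B = B" by (rule support_eqI) (use B image_stab in auto)
qed

lemma cosets_valid: "finite B \<Longrightarrow> A \<subseteq> B \<Longrightarrow> finitary_ghat (ghat_of A (`) (cosets A B))"
  by (rule finitary_ghat_of) (use cosets_smooth in auto)

text \<open>A transitive \<open>G(A)\<close>-set is determined by the support \<open>B\<close> of any of its points; sending each point to its
support is an isomorphism onto the copy of \<open>G(A)/G(B)\<close>.\<close>

lemma Theta_cls_transitive:
  assumes E: "smooth_action A a E" and x: "x \<in> E" "E = (\<lambda>g. a g x) ` pw_stab A"
  shows "Theta_cls (ghat_gen (ghat_of A a E)) = Theta_cls (coset_gen A (support A a x))"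
proof (rule Theta_cls_iso)
  interpret smooth_action A a E by (rule E)
  let ?B = "support A a x"
  have B: "finite ?B" "A \<subseteq> ?B" using finite_supp support_supset x by auto
  have "orb x = E" using x(2) by (simp add: orb_def)
  then have "orbs A a E = {E}" using orb_eq[OF x(1)] x(1) by (auto simp: orbs_eq)
  then show "finitary_ghat (ghat_of A a E)" by (intro finitary_ghat_of smooth_action_axioms) simp
  show "finitary_ghat (ghat_of A (`) (cosets A ?B))" by (rule cosets_valid) fact+
  have \<phi>: "support A a (a g x) = g ` ?B" if "g \<in> pw_stab A" for g using support_act x that by blast
  show "ghat_iso (ghat_of A a E) (ghat_of A (`) (cosets A ?B))"
  proof (rule ghat_isoI[where f="support A a" and D=A])
    have "inj_on (support A a) E"
    proof (rule inj_onI)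
      fix y z assume "y \<in> E" "z \<in> E" and eq: "support A a y = support A a z"
      then obtain g h where gh: "g \<in> pw_stab A" "y = a g x" "h \<in> pw_stab A" "z = a h x" using x(2) by blast
      then have "g ` ?B = h ` ?B" using eq \<phi> by simp
      then show "y = z" using image_eq_iff[OF B(1) gh(1,3)] act_eq_iff[OF x(1) gh(1,3)] gh by simp
    qed
    moreover have "support A a ` E = cosets A ?B"
    proof -
      have "support A a ` E = (\<lambda>g. support A a (a g x)) ` pw_stab A" by (subst x(2)) (simp add: image_image)
      then show ?thesis using \<phi> by (auto simp: cosets_def)
    qed
    ultimately show "bij_betw (support A a) (pts (ghat_of A a E)) (pts (ghat_of A (`) (cosets A ?B)))"
      by (simp add: bij_betw_def)
    fix k y assume k: "k \<in> pw_stab A" and y: "y \<in> pts (ghat_of A a E)"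
    then have "support A a y \<in> cosets A ?B" using \<open>support A a ` E = _\<close> by auto
    then show "support A a (act (ghat_of A a E) k y) = act (ghat_of A (`) (cosets A ?B)) k (support A a y)"
      using k y support_act by simp
  qed (auto simp: finite_A)
qed

lemma coset_gen_refl:
  assumes "finite A"
  shows "Theta_cls (coset_gen A A) = Theta_cls 1"
proof (rule relation_Theta_cls, rule theta_relations.singleton)
  have "g ` A = A" if "g \<in> pw_stab A" for g using that by (force simp: pw_stab_def)
  then have "cosets A A \<subseteq> {A}" by (auto simp: cosets_def)
  then have "cosets A A = {A}" using cosets_self by blast
  then show "pts (Rep_fin_ghat (Abs_fin_ghat (ghat_of A (`) (cosets A A)))) = {A}"
    using Rep_Abs[OF cosets_valid[OF assms subset_refl]] by simp
qed

lemma coset_gen_conj: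
  assumes g: "g \<in> pw_stab {}" and B: "finite B" "A \<subseteq> B"
  shows "Theta_cls (coset_gen A B) = Theta_cls (coset_gen (g ` A) (g ` B))"
proof (rule relation_Theta_cls, rule theta_relations.conj)
  let ?M = "ghat_of A (`) (cosets A B)" and ?N = "ghat_of (g ` A) (`) (cosets (g ` A) (g ` B))"
  let ?g' = "inv_into UNIV g"
  have minv: "m_inv autR g = ?g'" by (rule m_inv_autR) fact
  show "g \<in> carrier autR" using g pw_stab_empty by blast
  have M: "finitary_ghat ?M" by (rule cosets_valid) fact+
  have N: "finitary_ghat ?N" by (rule cosets_valid) (use B in auto)
  have coset: "?g' ` ((g \<circ> u \<circ> ?g') ` (g ` B)) = u ` B" for u
    using g by (simp add: image_image)
  have "cosets (g ` A) (g ` B) = (\<lambda>u. (g \<circ> u \<circ> ?g') ` (g ` B)) ` pw_stab A"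
    unfolding cosets_def pw_stab_image[OF g] image_image ..
  then have bij: "bij_betw ((`) ?g') (cosets (g ` A) (g ` B)) (cosets A B)"
  proof (intro bij_betw_imageI)
    show "inj_on ((`) ?g') (cosets (g ` A) (g ` B))"
      using pw_stabD(1)[OF inv_pw_stab[OF g]] by (auto intro!: inj_onI simp: bij_def inj_image_eq_iff)
    assume "cosets (g ` A) (g ` B) = (\<lambda>u. (g \<circ> u \<circ> ?g') ` (g ` B)) ` pw_stab A"
    then have "(`) ?g' ` cosets (g ` A) (g ` B) = (\<lambda>u. ?g' ` ((g \<circ> u \<circ> ?g') ` (g ` B))) ` pw_stab A"
      by (simp only: image_image)
    then show "(`) ?g' ` cosets (g ` A) (g ` B) = cosets A B" by (simp only: coset cosets_def)
  qed
  have "ghat_iso ?N (conj_ghat ?M g)"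
  proof (rule ghat_isoI[where f="(`) ?g'" and D="g ` A"])
    show "bij_betw ((`) ?g') (pts ?N) (pts (conj_ghat ?M g))" using bij by (simp add: conj_ghat_def)
    show "finite (g ` A)" using B finite_subset by blast
    show "pw_stab (g ` A) \<subseteq> gdef (conj_ghat ?M g)"
      unfolding pw_stab_image[OF g] by (simp add: conj_ghat_def minv)
    fix k S assume S: "S \<in> pts ?N"
    then have "?g' ` S \<in> cosets A B" using bij by (auto simp: bij_betw_def)
    then show "?g' ` act ?N k S = act (conj_ghat ?M g) k (?g' ` S)"
      using S g by (simp add: conj_ghat_def minv image_image)
  qed simp
  then show "ghat_iso (Rep_fin_ghat (Abs_fin_ghat ?N)) (conj_ghat (Rep_fin_ghat (Abs_fin_ghat ?M)) g)"
    by (simp add: Rep_Abs M N)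
qed

text \<open>The fibration relation for the projection of \<open>G(A)/G(B)\<close> onto \<open>G(A)/G(C)\<close>, sending \<open>g ` B\<close> to \<open>g ` C\<close>. Its
fibre over the base point is \<open>G(C)/G(B)\<close>, on the nose.\<close>

lemma coset_gen_chain:
  assumes B: "finite B" "A \<subseteq> C" "C \<subseteq> B"
  shows "Theta_cls (coset_gen A B) = Theta_cls (coset_gen C B * coset_gen A C)"
proof -
  let ?M = "ghat_of A (`) (cosets A B)" and ?N = "ghat_of A (`) (cosets A C)" and ?F = "ghat_of C (`) (cosets C B)"
  have C: "finite C" using B finite_subset by blast
  have M: "finitary_ghat ?M" by (rule cosets_valid) (use B in auto)
  have N: "finitary_ghat ?N" by (rule cosets_valid) (use B C in auto)
  have F: "finitary_ghat ?F" by (rule cosets_valid) (use B in auto)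
  define f where "f S = (SOME g. g \<in> pw_stab A \<and> g ` B = S) ` C" for S
  have f: "f (g ` B) = g ` C" if g: "g \<in> pw_stab A" for g
  proof -
    define h where "h = (SOME h. h \<in> pw_stab A \<and> h ` B = g ` B)"
    have h: "h \<in> pw_stab A \<and> h ` B = g ` B" unfolding h_def by (rule someI[of _ g]) (use g in simp)
    then have "\<forall>b\<in>B. h b = g b" using image_eq_iff[OF B(1)] g by blast
    then have "h ` C = g ` C" using B(3) by (intro image_cong) auto
    then show ?thesis by (simp add: f_def h_def)
  qed
  have trans: "transitive_ghat (ghat_of A (`) (cosets A D))" if D: "finite D" "A \<subseteq> D" for D
  proof -
    have v: "finitary_ghat (ghat_of A (`) (cosets A D))" by (rule cosets_valid) fact+
    interpret smooth_action A "(`)" "cosets A D" by (rule cosets_smooth) fact+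
    have orbD: "orb D = cosets A D" by (simp add: orb_def cosets_def)
    have "\<exists>g\<in>pw_stab A. g ` S = T" if "S \<in> cosets A D" "T \<in> cosets A D" for S T
    proof -
      have "T \<in> orb S" using orb_eq[OF cosets_self, of S] orbD that by blast
      then show ?thesis by (auto simp: orb_def)
    qed
    then show ?thesis
      using v cosets_self[of D A]
      by (auto simp: transitive_ghat_def transitive_action_def transitive_action_axioms_def finitary_ghat_def ghat_set_def)
  qed
  have fib: "{S \<in> cosets A B. f S = C} = cosets C B"
  proof
    show "cosets C B \<subseteq> {S \<in> cosets A B. f S = C}"
    proof
      fix S assume "S \<in> cosets C B"
      then obtain g where g: "g \<in> pw_stab C" "S = g ` B" by (auto simp: cosets_def)
      then have gA: "g \<in> pw_stab A" using pw_stab_antimono[OF B(2)] by blast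
      have "g ` C = C" using image_stab[OF C B(2)] g(1) by blast
      then show "S \<in> {S \<in> cosets A B. f S = C}" using f[OF gA] g gA by (auto simp: cosets_def)
    qed
    show "{S \<in> cosets A B. f S = C} \<subseteq> cosets C B"
    proof
      fix S assume "S \<in> {S \<in> cosets A B. f S = C}"
      then obtain g where g: "g \<in> pw_stab A" "S = g ` B" "g ` C = C" using f by (auto simp: cosets_def)
      then have "g \<in> pw_stab C" using image_stab[OF C B(2)] by blast
      then show "S \<in> cosets C B" using g by (auto simp: cosets_def)
    qed
  qed
  have iso: "ghat_iso ?F (fiber ?M ?N f C)"
  proof (rule ghat_isoI[where f="\<lambda>S. S" and D=C])
    show "bij_betw (\<lambda>S. S) (pts ?F) (pts (fiber ?M ?N f C))"
      by (simp add: fiber_def fib bij_betw_def)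
    show "pw_stab C \<subseteq> gdef (fiber ?M ?N f C)"
      using image_stab[OF C B(2)] cosets_self[of C A] by (auto simp: fiber_def stabilizer_def)
    fix k S assume S: "S \<in> pts ?F"
    then have "S \<in> cosets A B" "f S = C" using fib by auto
    then show "act ?F k S = act (fiber ?M ?N f C) k S" using S by (simp add: fiber_def)
  qed (use C in auto)
  have "equivariant (pw_stab A) ?M ?N f"
    unfolding equivariant_def
  proof (intro conjI ballI)
    show "f \<in> pts ?M \<rightarrow> pts ?N" using f by (auto simp: cosets_def)
    fix g S assume g: "g \<in> pw_stab A" and S: "S \<in> pts ?M"
    then obtain h where h: "h \<in> pw_stab A" "S = h ` B" by (auto simp: cosets_def)
    then have "f (g ` S) = (g \<circ> h) ` C" using f[OF comp_pw_stab[OF g h(1)]] by (simp add: image_comp)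
    then show "f (act ?M g S) = act ?N g (f S)"
      using S f[OF h(1)] h by (auto simp: image_comp cosets_def)
  qed
  then show ?thesis
    by (intro relation_Theta_cls theta_relations.fiber[where U="pw_stab A" and f=f and y=C])
       (use trans[of B] trans[of C] B C iso cosets_self[of C A] in \<open>auto simp: Rep_Abs M N F\<close>)
qed

text \<open>An interval \<open>J\<close> of the complement of \<open>A\<close>, encoded by the sets \<open>insert t D\<close> with \<open>t\<close> in \<open>J\<close>, is an orbit of \<open>G(A)\<close>
whatever subset \<open>D\<close> of \<open>A\<close> is used in the encoding.\<close>

lemma Theta_cls_points:
  assumes A: "finite A" "D \<subseteq> A" and u: "u \<notin> A"
  shows "Theta_cls (ghat_gen (ghat_of A (`) ((\<lambda>t. insert t D) ` cell A u))) = Theta_cls (coset_gen A (insert u A))"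
    and "smooth_action A (`) ((\<lambda>t. insert t D) ` cell A u)"
    and "finite (orbs A (`) ((\<lambda>t. insert t D) ` cell A u))"
proof -
  let ?E = "(\<lambda>t. insert t D) ` cell A u" and ?x = "insert u D"
  have D: "finite D" using A finite_subset by blast
  have gD: "g ` D = D" if "g \<in> pw_stab A" for g using that A by (force simp: pw_stab_def)
  have E: "?E = (\<lambda>g. g ` ?x) ` pw_stab A"
    unfolding cell_def image_image using gD by (intro image_cong) auto
  have "smooth_action D (`) (cosets D ?x)" by (rule cosets_smooth) (use D in auto)
  then interpret D: smooth_action D "(`)" "cosets D ?x" .
  have sub: "?E \<subseteq> cosets D ?x" unfolding E cosets_def using pw_stab_antimono[OF A(2)] by blast
  show sm: "smooth_action A (`) ?E"
  proof (rule D.restrict_smooth[OF sub])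
    show "g ` S \<in> ?E" if "g \<in> pw_stab A" "S \<in> ?E" for g S
    proof -
      obtain h where "h \<in> pw_stab A" "S = h ` ?x" using \<open>S \<in> ?E\<close> unfolding E by blast
      then show ?thesis unfolding E using comp_pw_stab[OF that(1)] by (intro image_eqI[of _ _ "g \<circ> h"]) (auto simp: image_comp)
    qed
  qed (use A in auto)
  interpret smooth_action A "(`)" ?E by (rule sm)
  have x: "?x \<in> ?E" using self_cell by blast
  have "support A (`) ?x = A \<union> support D (`) ?x"
    by (rule D.support_restrict) (use A cosets_self in auto)
  also have "\<dots> = insert u A" using cosets_smooth(3)[of ?x D] D A by auto
  finally show "Theta_cls (ghat_gen (ghat_of A (`) ?E)) = Theta_cls (coset_gen A (insert u A))"
    using Theta_cls_transitive[OF sm x E] by simp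
  have "orb ?x = ?E" unfolding orb_def E ..
  then have "orbs A (`) ?E = {?E}" using orb_eq[OF x] x by (auto simp: orbs_eq)
  then show "finite (orbs A (`) ?E)" by simp
qed

lemma cosets_insert: "cosets A (insert b A) = (\<lambda>t. insert t A) ` cell A b"
proof -
  have "g ` A = A" if "g \<in> pw_stab A" for g using that by (force simp: pw_stab_def)
  then show ?thesis unfolding cosets_def cell_def image_image by (intro image_cong) auto
qed

text \<open>The class of an interval depends only on its endpoints: points of \<open>A\<close> other than the neighbours of \<open>b\<close> can
be forgotten.\<close>

lemma coset_gen_neighbours:
  assumes A: "finite A" "D \<subseteq> A" and b: "b \<notin> A" and cell: "cell D b = cell A b"
  shows "Theta_cls (coset_gen A (insert b A)) = Theta_cls (coset_gen D (insert b D))"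
proof -
  have D: "finite D" using A finite_subset by blast
  let ?M = "ghat_of D (`) (cosets D (insert b D))"
  have M: "finitary_ghat ?M" by (rule cosets_valid) (use D in auto)
  have "Theta_cls (ghat_gen ?M) = Theta_cls (ghat_gen (ghat_of A (act ?M) (pts ?M)))"
    by (rule Theta_cls_ghat_of[OF M A(1)]) (use pw_stab_antimono[OF A(2)] in auto)
  also have "ghat_of A (act ?M) (pts ?M) = ghat_of A (`) ((\<lambda>t. insert t D) ` cell A b)"
    by (simp add: ghat_of_def cosets_insert cell)
  also have "Theta_cls (ghat_gen (ghat_of A (`) ((\<lambda>t. insert t D) ` cell A b))) = Theta_cls (coset_gen A (insert b A))"
    by (rule Theta_cls_points(1)[OF A b])
  finally show ?thesis by simp
qed


section \<open>Classes of intervals\<close>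

text \<open>Classes of a middle, a left and a right interval. By conjugation the choice of the endpoints does not
matter.\<close>

definition mid_gen :: free_ring where "mid_gen = coset_gen {0, 2} {0, 1, 2}"
definition left_gen :: free_ring where "left_gen = coset_gen {0} {-1, 0}"
definition right_gen :: free_ring where "right_gen = coset_gen {0} {0, 1}"

lemma coset_gen_left:
  assumes A: "finite A" "A \<noteq> {}" and b: "\<And>a. a \<in> A \<Longrightarrow> b < a"
  shows "Theta_cls (coset_gen A (insert b A)) = Theta_cls left_gen"
proof -
  obtain d where d: "d \<in> A" "b < d" "\<And>a. a \<in> A \<Longrightarrow> d \<le> a"
    using b[OF Min_in[OF A]] Min_in[OF A] Min_le[OF A(1)] by blast
  have bA: "b \<notin> A" using b by blast
  have cell: "cell {d} b = cell A b"
  proof (rule Set.set_eqI)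
    fix t
    have "t \<in> cell A b \<longleftrightarrow> t \<notin> A \<and> (\<forall>a\<in>A. \<not> a < t)"
      using mem_cell[OF A(1) bA, of t] b by (metis less_asym)
    also have "\<dots> \<longleftrightarrow> t < d" using d by (metis leD leI le_less less_le_trans)
    also have "\<dots> \<longleftrightarrow> t \<in> cell {d} b" using d(2) by (subst mem_cell) auto
    finally show "t \<in> cell {d} b \<longleftrightarrow> t \<in> cell A b" ..
  qed
  have "Theta_cls (coset_gen A (insert b A)) = Theta_cls (coset_gen {d} (insert b {d}))"
    by (rule coset_gen_neighbours) (use A d bA cell in auto)
  also have "\<dots> = Theta_cls left_gen"
  proof -
    have "strict_mono_on {b, d} (\<lambda>x. if x = b then -1 else 0 :: real)" using d by (auto intro!: strict_mono_onI)
    then obtain g where g: "g \<in> pw_stab {}" "g b = -1" "g d = 0"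
      using aut_extend[of "{b, d}"] d(2) by force
    then show ?thesis using coset_gen_conj[of g "insert b {d}" "{d}"] by (simp add: left_gen_def)
  qed
  finally show ?thesis .
qed

lemma coset_gen_right:
  assumes A: "finite A" "A \<noteq> {}" and b: "\<And>a. a \<in> A \<Longrightarrow> a < b"
  shows "Theta_cls (coset_gen A (insert b A)) = Theta_cls right_gen"
proof -
  obtain d where d: "d \<in> A" "d < b" "\<And>a. a \<in> A \<Longrightarrow> a \<le> d"
    using b[OF Max_in[OF A]] Max_in[OF A] Max_ge[OF A(1)] by blast
  have bA: "b \<notin> A" using b by blast
  have cell: "cell {d} b = cell A b"
  proof (rule Set.set_eqI)
    fix t
    have "t \<in> cell A b \<longleftrightarrow> t \<notin> A \<and> (\<forall>a\<in>A. a < t)"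
      using mem_cell[OF A(1) bA, of t] b by metis
    also have "\<dots> \<longleftrightarrow> d < t" using d by (metis le_less_trans less_irrefl)
    also have "\<dots> \<longleftrightarrow> t \<in> cell {d} b" using d(2) by (subst mem_cell) auto
    finally show "t \<in> cell {d} b \<longleftrightarrow> t \<in> cell A b" ..
  qed
  have "Theta_cls (coset_gen A (insert b A)) = Theta_cls (coset_gen {d} (insert b {d}))"
    by (rule coset_gen_neighbours) (use A d bA cell in auto)
  also have "\<dots> = Theta_cls right_gen"
  proof -
    have "strict_mono_on {b, d} (\<lambda>x. if x = b then 1 else 0 :: real)" using d by (auto intro!: strict_mono_onI)
    then obtain g where g: "g \<in> pw_stab {}" "g b = 1" "g d = 0"
      using aut_extend[of "{b, d}"] d(2) by force
    then show ?thesis using coset_gen_conj[of g "insert b {d}" "{d}"] by (simp add: right_gen_def insert_commute)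
  qed
  finally show ?thesis .
qed

lemma coset_gen_middle:
  assumes A: "finite A" and b: "b \<notin> A" and a: "a1 \<in> A" "a1 < b" "a2 \<in> A" "b < a2"
  shows "Theta_cls (coset_gen A (insert b A)) = Theta_cls mid_gen"
proof -
  define p where "p = Max {a \<in> A. a < b}"
  define q where "q = Min {a \<in> A. b < a}"
  have "p \<in> {a \<in> A. a < b}" unfolding p_def by (rule Max_in) (use A a in auto)
  moreover have "q \<in> {a \<in> A. b < a}" unfolding q_def by (rule Min_in) (use A a in auto)
  ultimately have pq: "p \<in> A" "p < b" "q \<in> A" "b < q" by auto
  have pq': "c \<le> p \<or> q \<le> c" if "c \<in> A" for c
  proof (cases "c < b")
    case True
    then show ?thesis unfolding p_def using that A by (intro disjI1 Max_ge) auto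
  next
    case False
    then have "b < c" using b that by (metis linorder_cases)
    then show ?thesis unfolding q_def using that A by (intro disjI2 Min_le) auto
  qed
  have cell: "cell {p, q} b = cell A b"
  proof (rule Set.set_eqI)
    fix t
    have "t \<in> cell {p, q} b \<longleftrightarrow> p < t \<and> t < q" using pq by (subst mem_cell) auto
    also have "\<dots> \<longleftrightarrow> t \<notin> A \<and> (\<forall>a\<in>A. a < b \<longleftrightarrow> a < t)"
    proof
      assume t: "p < t \<and> t < q"
      have "t \<noteq> a \<and> (a < b \<longleftrightarrow> a < t)" if "a \<in> A" for a using pq'[OF that] t pq by linarith
      then show "t \<notin> A \<and> (\<forall>a\<in>A. a < b \<longleftrightarrow> a < t)" by blast
    next
      assume t: "t \<notin> A \<and> (\<forall>a\<in>A. a < b \<longleftrightarrow> a < t)"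
      then have "p < t" "\<not> q < t" "t \<noteq> q" using pq by (blast, force, blast)
      then show "p < t \<and> t < q" by linarith
    qed
    also have "\<dots> \<longleftrightarrow> t \<in> cell A b" by (rule mem_cell[OF A b, symmetric])
    finally show "t \<in> cell {p, q} b \<longleftrightarrow> t \<in> cell A b" .
  qed
  have "Theta_cls (coset_gen A (insert b A)) = Theta_cls (coset_gen {p, q} (insert b {p, q}))"
    by (rule coset_gen_neighbours) (use A pq b cell in auto)
  also have "\<dots> = Theta_cls mid_gen"
  proof -
    have "strict_mono_on {p, b, q} (\<lambda>x. if x = p then 0 else if x = b then 1 else 2 :: real)"
      using pq by (auto intro!: strict_mono_onI)
    then obtain g where g: "g \<in> pw_stab {}" "g p = 0" "g b = 1" "g q = 2"
      using aut_extend[of "{p, b, q}"] pq by force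
    then show ?thesis using coset_gen_conj[of g "insert b {p, q}" "{p, q}"] by (simp add: mid_gen_def insert_commute)
  qed
  finally show ?thesis .
qed

lemma cell_intervals:
  "cell {0, 2} 1 = {0<..<2}" "cell {0, 1, 2} (1/2) = {0<..<1}" "cell {0, 1, 2} (3/2) = {1<..<2}"
  by (rule Set.set_eqI; subst mem_cell; force)+

text \<open>Cutting the interval from \<open>0\<close> to \<open>2\<close> at \<open>1\<close> shows \<open>m = m + (1 + m)\<close>.\<close>

lemma Theta_cls_mid: "Theta_cls mid_gen = Theta_cls (-1)"
proof -
  let ?A = "{0, 1, 2} :: real set" and ?M = "ghat_of {0, 2} (`) (cosets {0, 2} {0, 1, 2}) :: real set ghat"
  let ?P = "\<lambda>J. (\<lambda>t. insert t {0, 2}) ` J :: real set set"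
  have c3: "?P {1} = {{0, 1, 2}}" by auto
  have M: "finitary_ghat ?M" by (rule cosets_valid) auto
  have pts: "cosets {0, 2} {0, 1, 2} = ?P {0<..<2}"
    using cosets_insert[of "{0, 2}" 1] cell_intervals(1) by (simp add: insert_commute)
  have J: "{0<..<2 :: real} = {0<..<1} \<union> ({1} \<union> {1<..<2})" by auto
  have A: "finite ?A" "{0, 2} \<subseteq> ?A" by auto
  have sub: "pw_stab ?A \<subseteq> gdef ?M" using pw_stab_antimono[OF A(2)] by simp
  have "ghat_of ?A (act ?M) (pts ?M) = ghat_of ?A (`) (cosets {0, 2} {0, 1, 2})" by (simp add: ghat_of_def)
  then have eq: "ghat_of ?A (act ?M) (pts ?M) = ghat_of ?A (`) (?P {0<..<1} \<union> ?P ({1} \<union> {1<..<2}))"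
    unfolding pts J image_Un .
  have E: "smooth_action ?A (`) (?P {0<..<1} \<union> ?P ({1} \<union> {1<..<2}))"
    "finite (orbs ?A (`) (?P {0<..<1} \<union> ?P ({1} \<union> {1<..<2})))"
  proof -
    interpret M: smooth_action "{0, 2}" "(`)" "cosets {0, 2} {0, 1, 2 :: real}" by (rule cosets_smooth) auto
    have "smooth_action ?A (`) (cosets {0, 2} {0, 1, 2})" by (rule M.refine_smooth) auto
    then show "smooth_action ?A (`) (?P {0<..<1} \<union> ?P ({1} \<union> {1<..<2}))"
      unfolding pts J image_Un .
    have "finite (orbs ?A (`) (cosets {0, 2} {0, 1, 2}))"
      by (rule M.finite_orbs_refine) (use cosets_smooth(2) in auto)
    then show "finite (orbs ?A (`) (?P {0<..<1} \<union> ?P ({1} \<union> {1<..<2})))"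
      unfolding pts J image_Un .
  qed
  have inv: "g ` S \<in> ?P J" if g: "g \<in> pw_stab ?A" and S: "S \<in> ?P J"
    and J: "\<And>t. t \<in> J \<Longrightarrow> g t \<in> J" for g S J
    using g S J by (auto simp: pw_stab_def)
  have invJ: "t \<in> {0<..<1} \<Longrightarrow> g t \<in> {0<..<1}" "t \<in> {1<..<2} \<Longrightarrow> g t \<in> {1<..<2}" "g 1 = 1"
    if "g \<in> pw_stab ?A" for g t
    using pw_stab_less_iff[OF that, of _ t] that by (auto simp: pw_stab_def)
  have P1: "g ` S \<in> ?P {0<..<1}" if "g \<in> pw_stab ?A" "S \<in> ?P {0<..<1}" for g S
    by (rule inv[OF that]) (rule invJ[OF that(1)])
  have P2: "g ` S \<in> ?P {1}" if "g \<in> pw_stab ?A" "S \<in> ?P {1}" for g S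
    by (rule inv[OF that]) (use invJ[OF that(1)] in simp)
  have P3: "g ` S \<in> ?P {1<..<2}" if "g \<in> pw_stab ?A" "S \<in> ?P {1<..<2}" for g S
    by (rule inv[OF that]) (rule invJ[OF that(1)])
  have P23: "g ` S \<in> ?P ({1} \<union> {1<..<2})" if "g \<in> pw_stab ?A" "S \<in> ?P ({1} \<union> {1<..<2})" for g S
    using that(2) P2[OF that(1), of S] P3[OF that(1), of S] unfolding image_Un Un_iff by argo
  have disj: "?P I \<inter> ?P J = {}" if "I \<inter> J = {}" "0 \<notin> I \<union> J" "2 \<notin> I \<union> J" for I J
  proof -
    have inj: "t = t'" if "insert t {0, 2} = insert t' {0, 2}" "t \<noteq> 0" "t \<noteq> 2" for t t' :: real
    proof -
      have "t \<in> insert t' {0, 2}" unfolding that(1)[symmetric] by simp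
      then show ?thesis using that(2,3) by simp
    qed
    show ?thesis
    proof (rule ccontr)
      assume "?P I \<inter> ?P J \<noteq> {}"
      then obtain t t' where t: "t \<in> I" "t' \<in> J" "insert t {0, 2} = insert t' {0, 2}" by blast
      then have "t = t'" using inj[OF t(3)] that(2,3) by blast
      then show False using t(1,2) that(1) by blast
    qed
  qed
  have "Theta_cls mid_gen = Theta_cls (ghat_gen (ghat_of ?A (`) (?P {0<..<1} \<union> ?P ({1} \<union> {1<..<2}))))"
    unfolding mid_gen_def eq[symmetric] by (rule Theta_cls_ghat_of[OF M A(1) sub])
  also have "\<dots> = Theta_cls (ghat_gen (ghat_of ?A (`) (?P {0<..<1})) + ghat_gen (ghat_of ?A (`) (?P ({1} \<union> {1<..<2}))))"
    by (rule Theta_cls_Un[OF E _ P1 P23]) (rule disj, auto)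
  also have "\<dots> = Theta_cls (mid_gen + (1 + mid_gen))"
  proof (rule Theta_cls_add_cong)
    have "Theta_cls (ghat_gen (ghat_of ?A (`) (?P {0<..<1}))) = Theta_cls (coset_gen ?A (insert (1/2) ?A))"
      using Theta_cls_points(1)[OF A, of "1/2"] by (simp add: cell_intervals)
    also have "\<dots> = Theta_cls mid_gen" by (rule coset_gen_middle[of _ _ 0 1]) auto
    finally show "Theta_cls (ghat_gen (ghat_of ?A (`) (?P {0<..<1}))) = Theta_cls mid_gen" .
    interpret E: smooth_action ?A "(`)" "?P {0<..<1} \<union> ?P ({1} \<union> {1<..<2})" by (rule E)
    have sm: "smooth_action ?A (`) (?P {1} \<union> ?P {1<..<2})" unfolding image_Un[symmetric]
      by (rule E.restrict_smooth[OF _ P23]) auto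
    have fin: "finite (orbs ?A (`) (?P {1} \<union> ?P {1<..<2}))"
      using E(2) by (simp add: orbs_def image_Un)
    have "Theta_cls (ghat_gen (ghat_of ?A (`) (?P {1} \<union> ?P {1<..<2}))) =
        Theta_cls (ghat_gen (ghat_of ?A (`) (?P {1})) + ghat_gen (ghat_of ?A (`) (?P {1<..<2})))"
      by (rule Theta_cls_Un[OF sm fin _ P2 P3]) (rule disj, auto)
    also have "\<dots> = Theta_cls (1 + mid_gen)"
    proof (rule Theta_cls_add_cong)
      have "?P {1} = cosets ?A ?A"
        unfolding c3 cosets_def using id_pw_stab(1)[of ?A] by (auto simp: pw_stab_def)
      then show "Theta_cls (ghat_gen (ghat_of ?A (`) (?P {1}))) = Theta_cls 1" using coset_gen_refl[OF A(1)] by simp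
      have "Theta_cls (ghat_gen (ghat_of ?A (`) (?P {1<..<2}))) = Theta_cls (coset_gen ?A (insert (3/2) ?A))"
        using Theta_cls_points(1)[OF A, of "3/2"] by (simp add: cell_intervals)
      also have "\<dots> = Theta_cls mid_gen" by (rule coset_gen_middle[of _ _ 1 2]) auto
      finally show "Theta_cls (ghat_gen (ghat_of ?A (`) (?P {1<..<2}))) = Theta_cls mid_gen" .
    qed
    finally show "Theta_cls (ghat_gen (ghat_of ?A (`) (?P ({1} \<union> {1<..<2})))) = Theta_cls (1 + mid_gen)" by (simp only: image_Un)
  qed
  finally have "Theta_cls (mid_gen - (1 + mid_gen)) = Theta_cls (mid_gen + (1 + mid_gen) - (1 + mid_gen))"
    using Theta_cls_add_cong[of mid_gen "mid_gen + (1 + mid_gen)" "- (1 + mid_gen)" "- (1 + mid_gen)"] by simp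
  then show ?thesis by simp
qed

text \<open>Two ways to evaluate the class of pairs of points to the left of \<open>0\<close>: adding \<open>-1\<close> first leaves a left
interval for \<open>-2\<close>, adding \<open>-2\<close> first leaves a middle interval for \<open>-1\<close>. Hence \<open>l * l = m * l\<close>, and \<open>m = -1\<close>.\<close>

lemma Theta_cls_left: "Theta_cls (left_gen * left_gen) = Theta_cls (- left_gen)"
proof -
  have "Theta_cls (coset_gen {-1, 0} {-2, -1, 0} * coset_gen {0} {-1, 0}) = Theta_cls (coset_gen {-2, 0} {-2, -1, 0} * coset_gen {0} {-2, 0})"
    using coset_gen_chain[of "{-2, -1, 0}" "{0}" "{-1, 0}"] coset_gen_chain[of "{-2, -1, 0}" "{0}" "{-2, 0}"] by auto
  moreover have "Theta_cls (coset_gen {-1, 0} {-2, -1, 0}) = Theta_cls left_gen" by (rule coset_gen_left) auto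
  moreover have "Theta_cls (coset_gen {0} {-1, 0}) = Theta_cls left_gen" by (simp add: left_gen_def)
  moreover have "Theta_cls (coset_gen {-2, 0} {-2, -1, 0}) = Theta_cls (-1)"
    using coset_gen_middle[of "{-2, 0}" "-1" "-2" 0] Theta_cls_mid by (simp add: insert_commute)
  moreover have "Theta_cls (coset_gen {0} {-2, 0}) = Theta_cls left_gen" using coset_gen_left[of "{0}" "-2"] by simp
  ultimately have "Theta_cls (left_gen * left_gen) = Theta_cls (-1 * left_gen)" using Theta_cls_mult_cong by metis
  then show ?thesis by simp
qed

lemma Theta_cls_right: "Theta_cls (right_gen * right_gen) = Theta_cls (- right_gen)"
proof -
  have "Theta_cls (coset_gen {0, 1} {0, 1, 2} * coset_gen {0} {0, 1}) = Theta_cls (coset_gen {0, 2} {0, 1, 2} * coset_gen {0} {0, 2})"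
    using coset_gen_chain[of "{0, 1, 2}" "{0}" "{0, 1}"] coset_gen_chain[of "{0, 1, 2}" "{0}" "{0, 2}"] by auto
  moreover have "Theta_cls (coset_gen {0, 1} {0, 1, 2}) = Theta_cls right_gen"
  proof -
    have "Theta_cls (coset_gen {0, 1} (insert 2 {0, 1})) = Theta_cls right_gen" by (rule coset_gen_right) auto
    then show ?thesis by (simp add: insert_commute)
  qed
  moreover have "Theta_cls (coset_gen {0} {0, 1}) = Theta_cls right_gen" by (simp add: right_gen_def)
  moreover have "Theta_cls (coset_gen {0, 2} {0, 1, 2}) = Theta_cls (-1)" using Theta_cls_mid by (simp add: mid_gen_def)
  moreover have "Theta_cls (coset_gen {0} {0, 2}) = Theta_cls right_gen" using coset_gen_right[of "{0}" 2] by (simp add: insert_commute)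
  ultimately have "Theta_cls (right_gen * right_gen) = Theta_cls (-1 * right_gen)" using Theta_cls_mult_cong by metis
  then show ?thesis by simp
qed


section \<open>Four elements spanning the ring\<close>

definition gen_combination :: "int \<Rightarrow> int \<Rightarrow> int \<Rightarrow> int \<Rightarrow> free_ring" where
  "gen_combination i j k n = of_int i + of_int j * left_gen + of_int k * right_gen + of_int n * (left_gen * right_gen)"

definition spanned :: "free_ring set" where
  "spanned = {p. \<exists>i j k n. Theta_cls p = Theta_cls (gen_combination i j k n)}"

lemma spanned_cong: "Theta_cls p = Theta_cls q \<Longrightarrow> q \<in> spanned \<Longrightarrow> p \<in> spanned"
  by (simp add: spanned_def)

lemma spanned_combination: "gen_combination i j k n \<in> spanned"
  by (auto simp: spanned_def)

lemma spanned_add: "p \<in> spanned \<Longrightarrow> q \<in> spanned \<Longrightarrow> p + q \<in> spanned"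
proof -
  assume "p \<in> spanned" "q \<in> spanned"
  then obtain i j k n i' j' k' n' where "Theta_cls p = Theta_cls (gen_combination i j k n)" "Theta_cls q = Theta_cls (gen_combination i' j' k' n')"
    by (auto simp: spanned_def)
  then have "Theta_cls (p + q) = Theta_cls (gen_combination i j k n + gen_combination i' j' k' n')" by (rule Theta_cls_add_cong)
  also have "gen_combination i j k n + gen_combination i' j' k' n' = gen_combination (i + i') (j + j') (k + k') (n + n')"
    by (simp add: gen_combination_def algebra_simps)
  finally show ?thesis by (auto simp: spanned_def)
qed

lemma spanned_of_int: "p \<in> spanned \<Longrightarrow> of_int c * p \<in> spanned"
proof -
  assume "p \<in> spanned"
  then obtain i j k n where "Theta_cls p = Theta_cls (gen_combination i j k n)" by (auto simp: spanned_def)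
  then have "Theta_cls (of_int c * p) = Theta_cls (of_int c * gen_combination i j k n)" by (rule Theta_cls_mult_cong[OF refl])
  also have "of_int c * gen_combination i j k n = gen_combination (c * i) (c * j) (c * k) (c * n)"
    by (simp add: gen_combination_def algebra_simps)
  finally show ?thesis by (auto simp: spanned_def)
qed

lemma spanned_left: "p \<in> spanned \<Longrightarrow> left_gen * p \<in> spanned"
proof -
  assume "p \<in> spanned"
  then obtain i j k n where "Theta_cls p = Theta_cls (gen_combination i j k n)" by (auto simp: spanned_def)
  then have "Theta_cls (left_gen * p) = Theta_cls (left_gen * gen_combination i j k n)" by (rule Theta_cls_mult_cong[OF refl])
  also have "left_gen * gen_combination i j k n =
      (of_int i * left_gen + of_int k * (left_gen * right_gen)) + (of_int j + of_int n * right_gen) * (left_gen * left_gen)"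
    by (simp add: gen_combination_def algebra_simps)
  also have "Theta_cls \<dots> = Theta_cls ((of_int i * left_gen + of_int k * (left_gen * right_gen)) + (of_int j + of_int n * right_gen) * (- left_gen))"
    by (intro Theta_cls_add_cong Theta_cls_mult_cong refl Theta_cls_left)
  also have "(of_int i * left_gen + of_int k * (left_gen * right_gen)) + (of_int j + of_int n * right_gen) * (- left_gen) = gen_combination 0 (i - j) 0 (k - n)"
    by (simp add: gen_combination_def algebra_simps)
  finally show ?thesis by (auto simp: spanned_def)
qed

lemma spanned_right: "p \<in> spanned \<Longrightarrow> right_gen * p \<in> spanned"
proof -
  assume "p \<in> spanned"
  then obtain i j k n where "Theta_cls p = Theta_cls (gen_combination i j k n)" by (auto simp: spanned_def)
  then have "Theta_cls (right_gen * p) = Theta_cls (right_gen * gen_combination i j k n)" by (rule Theta_cls_mult_cong[OF refl])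
  also have "right_gen * gen_combination i j k n =
      (of_int i * right_gen + of_int j * (left_gen * right_gen)) + (of_int k + of_int n * left_gen) * (right_gen * right_gen)"
    by (simp add: gen_combination_def algebra_simps)
  also have "Theta_cls \<dots> = Theta_cls ((of_int i * right_gen + of_int j * (left_gen * right_gen)) + (of_int k + of_int n * left_gen) * (- right_gen))"
    by (intro Theta_cls_add_cong Theta_cls_mult_cong refl Theta_cls_right)
  also have "(of_int i * right_gen + of_int j * (left_gen * right_gen)) + (of_int k + of_int n * left_gen) * (- right_gen) = gen_combination 0 0 (i - k) (j - n)"
    by (simp add: gen_combination_def algebra_simps)
  finally show ?thesis by (auto simp: spanned_def)
qed

lemma spanned_mult: "p \<in> spanned \<Longrightarrow> q \<in> spanned \<Longrightarrow> p * q \<in> spanned"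
proof -
  assume p: "p \<in> spanned" and q: "q \<in> spanned"
  obtain i j k n where "Theta_cls p = Theta_cls (gen_combination i j k n)" using p by (auto simp: spanned_def)
  then have "Theta_cls (p * q) = Theta_cls (gen_combination i j k n * q)" by (rule Theta_cls_mult_cong) simp
  moreover have "gen_combination i j k n * q = of_int i * q + of_int j * (left_gen * q) + of_int k * (right_gen * q) + of_int n * (left_gen * (right_gen * q))"
    by (simp add: gen_combination_def algebra_simps)
  moreover have "\<dots> \<in> spanned"
    by (intro spanned_add spanned_of_int spanned_left spanned_right q)
  ultimately show ?thesis using spanned_cong by metis
qed

lemma spanned_basic: "0 \<in> spanned" "1 \<in> spanned" "-1 \<in> spanned" "left_gen \<in> spanned" "right_gen \<in> spanned"
  using spanned_combination[of 0 0 0 0] spanned_combination[of 1 0 0 0] spanned_combination[of "-1" 0 0 0]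
    spanned_combination[of 0 1 0 0] spanned_combination[of 0 0 1 0] by (simp_all add: gen_combination_def)

text \<open>Adding the points of \<open>B - A\<close> one at a time writes the class of \<open>G(A)/G(B)\<close> as a product of classes of
intervals. A nonempty \<open>A\<close> ensures that the whole line does not occur among them.\<close>

lemma coset_gen_spanned:
  assumes "finite B" "A \<subseteq> B" "A \<noteq> {}"
  shows "coset_gen A B \<in> spanned"
  using assms
proof (induction "card (B - A)" arbitrary: A rule: less_induct)
  case less
  have A: "finite A" using less.prems finite_subset by blast
  show ?case
  proof (cases "B = A")
    case True
    then show ?thesis using spanned_cong[OF coset_gen_refl[OF A]] spanned_basic by simp
  next
    case False
    then obtain b where b: "b \<in> B" "b \<notin> A" using less.prems by blast
    have "coset_gen (insert b A) B \<in> spanned"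
    proof (rule less.hyps)
      show "card (B - insert b A) < card (B - A)"
        using b less.prems by (intro psubset_card_mono) auto
    qed (use b less.prems in auto)
    moreover have "coset_gen A (insert b A) \<in> spanned"
    proof -
      consider "\<And>a. a \<in> A \<Longrightarrow> b < a" | "\<And>a. a \<in> A \<Longrightarrow> a < b" | a1 a2 where "a1 \<in> A" "a1 < b" "a2 \<in> A" "b < a2"
        using b(2) by (metis linorder_cases)
      then show ?thesis
      proof cases
        case 1
        then show ?thesis using spanned_cong[OF coset_gen_left] A less.prems spanned_basic by metis
      next
        case 2
        then show ?thesis using spanned_cong[OF coset_gen_right] A less.prems spanned_basic by metis
      next
        case 3
        then show ?thesis using spanned_cong[OF coset_gen_middle[OF A b(2)]] spanned_cong[OF Theta_cls_mid] spanned_basic by metis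
      qed
    qed
    ultimately have "coset_gen (insert b A) B * coset_gen A (insert b A) \<in> spanned" by (rule spanned_mult)
    then show ?thesis
      using coset_gen_chain[of B A "insert b A"] spanned_cong b less.prems by blast
  qed
qed

text \<open>Restrict the group of definition to \<open>G(D)\<close> with \<open>D\<close> nonempty and split into the finitely many orbits, each
of which is a coset space.\<close>

lemma gen_spanned: "gen v \<in> spanned"
proof -
  define M where "M = Rep_fin_ghat v"
  have M: "finitary_ghat M" unfolding M_def by (rule finitary_ghat_Rep)
  let ?D = "base_points M"
  note D = base_points[OF M]
  interpret smooth_action ?D "act M" "pts M" by (rule finitary_ghat_refine) (use M D in auto)
  have fin: "finite (orbs ?D (act M) (pts M))" by (rule finitary_ghat_refine) (use M D in auto)
  have "ghat_gen (ghat_of ?D (act M) (\<Union>Q)) \<in> spanned" if "finite Q" "Q \<subseteq> orbs ?D (act M) (pts M)" for Q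
    using that
  proof (induction Q)
    case empty
    \<comment> \<open>the empty set is the coproduct of two copies of itself, so its class is zero\<close>
    have "smooth_action ?D (act M) ({} \<union> {})" by unfold_locales (use finite_A in auto)
    then have "Theta_cls (ghat_gen (ghat_of ?D (act M) {})) = Theta_cls (ghat_gen (ghat_of ?D (act M) {}) + ghat_gen (ghat_of ?D (act M) {}))"
      using Theta_cls_Un[of ?D "act M" "{}" "{}"] by (simp add: orbs_def)
    then have "Theta_cls (ghat_gen (ghat_of ?D (act M) {})) = Theta_cls 0" by (simp add: Theta_cls_eq_iff) (metis add.inverse_inverse theta_ideal_closed(4))
    then show ?case using spanned_cong spanned_basic by simp
  next
    case (insert P Q)
    have P: "P \<in> orbs ?D (act M) (pts M)" using insert by simp
    have inv: "act M g y \<in> P'" if "g \<in> pw_stab ?D" "y \<in> P'" "P' \<in> orbs ?D (act M) (pts M)" for g y P'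
      using that act_in_orb by (auto simp: orbs_eq)
    have sub: "P \<union> \<Union>Q \<subseteq> pts M" using insert.prems E_eq_UN_orbs by blast
    have "Theta_cls (ghat_gen (ghat_of ?D (act M) (P \<union> \<Union>Q))) = Theta_cls (ghat_gen (ghat_of ?D (act M) P) + ghat_gen (ghat_of ?D (act M) (\<Union>Q)))"
    proof (rule Theta_cls_Un)
      show "smooth_action ?D (act M) (P \<union> \<Union>Q)"
        by (rule restrict_smooth[OF sub]) (use inv insert.prems finite_A in blast)+
      show "finite (orbs ?D (act M) (P \<union> \<Union>Q))"
        by (rule finite_subset[OF _ fin]) (use sub in \<open>auto simp: orbs_def\<close>)
      show "P \<inter> \<Union>Q = {}" using orbs_disjoint[OF P] insert by blast
    qed (use inv insert.prems in blast)+
    moreover have "ghat_gen (ghat_of ?D (act M) P) \<in> spanned"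
    proof -
      obtain x where x: "x \<in> pts M" "P = orb x" using P by (auto simp: orbs_eq)
      interpret P: smooth_action ?D "act M" P using orb_smooth x by simp
      have xP: "x \<in> P" using x orb_refl by simp
      have "Theta_cls (ghat_gen (ghat_of ?D (act M) P)) = Theta_cls (coset_gen ?D (support ?D (act M) x))"
        by (rule Theta_cls_transitive[OF P.smooth_action_axioms xP]) (simp add: x(2) orb_def)
      moreover have "coset_gen ?D (support ?D (act M) x) \<in> spanned"
        by (rule coset_gen_spanned) (use finite_supp support_supset x D in auto)
      ultimately show ?thesis using spanned_cong by blast
    qed
    moreover have "ghat_gen (ghat_of ?D (act M) (\<Union>Q)) \<in> spanned" using insert by simp
    ultimately show ?case using spanned_cong spanned_add by (metis Union_insert)
  qed
  from this[OF fin subset_refl] have "ghat_gen (ghat_of ?D (act M) (pts M)) \<in> spanned" using E_eq_UN_orbs by simp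
  then have "ghat_gen M \<in> spanned" using spanned_cong[OF Theta_cls_ghat_of[OF M]] D by blast
  then show ?thesis by (simp add: M_def Rep_fin_ghat_inverse)
qed

lemma monomial_spanned: "frag_of (m :: fin_ghat \<Rightarrow>\<^sub>0 nat) \<in> spanned"
proof (induction m rule: update_induct)
  case const
  then show ?case using spanned_basic(2) by simp
next
  case (update f v n)
  have pow: "(frag_of (Poly_Mapping.single v n) :: free_ring) \<in> spanned" for n
  proof (induction n)
    case 0
    then show ?case using spanned_basic(2) by simp
  next
    case (Suc n)
    have "Poly_Mapping.single v (Suc n) = Poly_Mapping.single v n + Poly_Mapping.single v 1"
      by (simp flip: single_add)
    then have "(frag_of (Poly_Mapping.single v (Suc n)) :: free_ring) = frag_of (Poly_Mapping.single v n) * gen v"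
      by (simp add: gen_def mult_single)
    then show ?case using Suc gen_spanned spanned_mult by simp
  qed
  have "Poly_Mapping.update v n f = f + Poly_Mapping.single v n"
    using update(1) by (intro poly_mapping_eqI) (auto simp: lookup_update lookup_add lookup_single in_keys_iff when_def)
  then have "(frag_of (Poly_Mapping.update v n f) :: free_ring) = frag_of f * frag_of (Poly_Mapping.single v n)"
    by (simp add: mult_single)
  then show ?case using update pow spanned_mult by simp
qed

lemma all_spanned: "p \<in> spanned"
  using subset_UNIV[of "Poly_Mapping.keys p"]
proof (induction p rule: frag_induction)
  case (diff p q)
  then show ?case using spanned_add[of p "-1 * q"] spanned_mult[OF spanned_basic(3), of q] by simp
qed (use spanned_basic monomial_spanned in auto)


section \<open>The isomorphism\<close>

lemma config_class:
  assumes "interval I" "S \<subseteq> I" "finite S"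
  shows "theta_class (config I (card S)) = Theta_cls (coset_gen (frontier I) (frontier I \<union> S))"
proof -
  note c = config_orbit[OF assms]
  let ?M = "config I (card S)"
  have "theta_class ?M = Theta_cls (ghat_gen (ghat_of (frontier I) (act ?M) (pts ?M)))"
    unfolding theta_class_eq by (rule Theta_cls_ghat_of) (use config_finitary_ghat interval_frontier assms in \<open>auto simp: config_def\<close>)
  also have "\<dots> = Theta_cls (coset_gen (frontier I) (frontier I \<union> S))"
    using Theta_cls_transitive[OF c(4,1,2)] c(3) by simp
  finally show ?thesis .
qed

text \<open>The classes \<open>l\<close> and \<open>r\<close> are those of the one-point configurations in end intervals, where the value of
\<open>\<mu>\<close> is prescribed; everything else follows from multiplicativity and additivity.\<close>

lemma is_mu_combination:
  assumes "is_mu \<epsilon> \<delta> \<mu>"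
  shows "\<mu> (Theta_cls (gen_combination i j k n)) = i + j * \<epsilon> + k * \<delta> + n * (\<epsilon> * \<delta>)"
proof -
  have hom: "\<mu> \<in> ring_hom Theta \<Z>" using assms by (simp add: is_mu_def)
  have add: "\<mu> (Theta_cls (p + q)) = \<mu> (Theta_cls p) + \<mu> (Theta_cls q)" and mult: "\<mu> (Theta_cls (p * q)) = \<mu> (Theta_cls p) * \<mu> (Theta_cls q)" for p q
    using ring_hom_add[OF hom, of "Theta_cls p" "Theta_cls q"] ring_hom_mult[OF hom, of "Theta_cls p" "Theta_cls q"] by (simp_all add: Theta_simps)
  have one: "\<mu> (Theta_cls 1) = 1" using ring_hom_one[OF hom] by (simp add: Theta_simps)
  have zero: "\<mu> (Theta_cls 0) = 0" using add[of 0 0] by simp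
  have minus: "\<mu> (Theta_cls (- p)) = - \<mu> (Theta_cls p)" for p using add[of p "- p"] zero by simp
  have nat: "\<mu> (Theta_cls (of_nat c)) = int c" for c by (induction c) (simp_all add: zero one add)
  have int: "\<mu> (Theta_cls (of_int c)) = c" for c
  proof (cases c)
    case (nonneg m)
    then show ?thesis using nat[of m] by simp
  next
    case (neg m)
    then show ?thesis using nat[of "Suc m"] minus[of "of_nat (Suc m)"] by simp
  qed
  have "theta_class (config {..<0} 1) = Theta_cls left_gen"
    using config_class[of "{..<0}" "{-1}"] by (simp add: interval.left frontier_interval left_gen_def insert_commute)
  then have l: "\<mu> (Theta_cls left_gen) = \<epsilon>" using assms unfolding is_mu_def by (metis power_one_right)
  have "theta_class (config {0<..} 1) = Theta_cls right_gen"
    using config_class[of "{0<..}" "{1}"] by (simp add: interval.right frontier_interval right_gen_def insert_commute)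
  then have r: "\<mu> (Theta_cls right_gen) = \<delta>" using assms unfolding is_mu_def by (metis power_one_right)
  show ?thesis by (simp add: gen_combination_def add mult int l r)
qed

lemma Theta_elem:
  assumes "x \<in> carrier Theta"
  obtains i j k n where "x = Theta_cls (gen_combination i j k n)"
proof -
  obtain p where "x = Theta_cls p" using assms by (auto simp: Theta_simps)
  moreover obtain i j k n where "Theta_cls p = Theta_cls (gen_combination i j k n)" using all_spanned[of p] by (auto simp: spanned_def)
  ultimately show ?thesis using that by simp
qed

text \<open>On \<open>i + j * l + k * r + n * l * r\<close> the four homomorphisms take the values \<open>i - j - k + n\<close>, \<open>i - j\<close>, \<open>i - k\<close> and \<open>i\<close>,
from which the integers \<open>i\<close>, \<open>j\<close>, \<open>k\<close>, \<open>n\<close> can be read off and prescribed freely.\<close>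

theorem theorem16p7:
  shows "(\<forall>\<epsilon>\<in>{-1, 0}. \<forall>\<delta>\<in>{-1, 0}. \<exists>!\<mu>. \<mu> \<in> extensional (carrier Theta) \<and> is_mu \<epsilon> \<delta> \<mu>) \<and>
    (\<forall>\<mu>. (\<forall>\<epsilon>\<in>{-1, 0}. \<forall>\<delta>\<in>{-1, 0}. is_mu \<epsilon> \<delta> (\<mu> \<epsilon> \<delta>)) \<longrightarrow>
      (\<lambda>x. (\<mu> (-1) (-1) x, \<mu> (-1) 0 x, \<mu> 0 (-1) x, \<mu> 0 0 x))
        \<in> ring_iso Theta (RDirProd \<Z> (RDirProd \<Z> (RDirProd \<Z> \<Z>))))"
proof (intro conjI ballI allI impI)
  fix \<epsilon> \<delta> :: int assume "\<epsilon> \<in> {-1, 0}" "\<delta> \<in> {-1, 0}"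
  show "\<exists>!\<mu>. \<mu> \<in> extensional (carrier Theta) \<and> is_mu \<epsilon> \<delta> \<mu>"
  proof (rule ex1I)
    show "mu_hom \<epsilon> \<delta> \<in> extensional (carrier Theta) \<and> is_mu \<epsilon> \<delta> (mu_hom \<epsilon> \<delta>)"
      using is_mu_mu_hom[OF \<open>\<epsilon> \<in> _\<close> \<open>\<delta> \<in> _\<close>] by (simp add: mu_hom_def)
    fix \<mu> assume \<mu>: "\<mu> \<in> extensional (carrier Theta) \<and> is_mu \<epsilon> \<delta> \<mu>"
    show "\<mu> = mu_hom \<epsilon> \<delta>"
    proof (rule extensionalityI[of _ "carrier Theta"])
      fix x assume "x \<in> carrier Theta"
      then obtain i j k n where "x = Theta_cls (gen_combination i j k n)" by (rule Theta_elem)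
      then show "\<mu> x = mu_hom \<epsilon> \<delta> x"
        using is_mu_combination[of \<epsilon> \<delta> \<mu>] is_mu_combination[OF is_mu_mu_hom[OF \<open>\<epsilon> \<in> _\<close> \<open>\<delta> \<in> _\<close>]] \<mu> by simp
    qed (use \<mu> in \<open>auto simp: mu_hom_def\<close>)
  qed
next
  fix \<mu> :: "int \<Rightarrow> int \<Rightarrow> free_ring set \<Rightarrow> int"
  assume \<mu>: "\<forall>\<epsilon>\<in>{-1, 0}. \<forall>\<delta>\<in>{-1, 0}. is_mu \<epsilon> \<delta> (\<mu> \<epsilon> \<delta>)"
  let ?f = "\<lambda>x. (\<mu> (-1) (-1) x, \<mu> (-1) 0 x, \<mu> 0 (-1) x, \<mu> 0 0 x)"
  have gen_combination: "?f (Theta_cls (gen_combination i j k n)) = (i - j - k + n, i - j, i - k, i)" for i j k n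
    using \<mu> is_mu_combination[of "-1" "-1" "\<mu> (-1) (-1)"] is_mu_combination[of "-1" 0 "\<mu> (-1) 0"]
      is_mu_combination[of 0 "-1" "\<mu> 0 (-1)"] is_mu_combination[of 0 0 "\<mu> 0 0"] by simp
  have hom: "\<mu> \<epsilon> \<delta> \<in> ring_hom Theta \<Z>" if "\<epsilon> \<in> {-1, 0}" "\<delta> \<in> {-1, 0}" for \<epsilon> \<delta>
    using \<mu> that unfolding is_mu_def by blast
  let ?Z = "RDirProd \<Z> (RDirProd \<Z> (RDirProd \<Z> \<Z>))"
  have "?f \<in> ring_hom Theta ?Z"
    by (rule ring_hom_memI)
       (use ring_hom_add[OF hom] ring_hom_mult[OF hom] ring_hom_one[OF hom] in
         \<open>simp_all add: RDirProd_def DirProd_def monoid.defs\<close>)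
  moreover have "bij_betw ?f (carrier Theta) (carrier ?Z)"
  proof (rule bij_betwI')
    fix x y assume "x \<in> carrier Theta" "y \<in> carrier Theta"
    then obtain i j k n i' j' k' n' where xy: "x = Theta_cls (gen_combination i j k n)" "y = Theta_cls (gen_combination i' j' k' n')"
      using Theta_elem by metis
    show "?f x = ?f y \<longleftrightarrow> x = y"
    proof
      assume "?f x = ?f y"
      then have "i = i'" "j = j'" "k = k'" "n = n'" unfolding xy gen_combination by auto
      then show "x = y" using xy by simp
    qed simp
  next
    show "?f x \<in> carrier ?Z" for x by (simp add: RDirProd_carrier)
    show "\<exists>x\<in>carrier Theta. y = ?f x" for y
    proof (cases y)
      case (fields w x z i)
      have "y = ?f (Theta_cls (gen_combination i (i - x) (i - z) (w + i - x - z)))" unfolding gen_combination fields by simp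
      then show ?thesis by (auto simp: Theta_simps)
    qed
  qed
  ultimately show "?f \<in> ring_iso Theta ?Z" by (simp add: ring_iso_def)
qed

end
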